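(* Let $z=(p,q,v,w)^T$ be a solution of the stochastic system $$M\,d_tz+K z_x\circ dW=\nabla_z S_1(z)\,dt+\nabla_z S_2(z)\circ dW\qquad (t\ge 0,\ x\in\mathbb R),$$ where $$M=\begin{pmatrix}0&-1&0&0\\1&0&0&0\\0&0&0&0\\0&0&0&0\end{pmatrix},\qquad K=\begin{pmatrix}0&0&1&0\\0&0&0&1\\-1&0&0&0\\0&-1&0&0\end{pmatrix},$$ $$S_1(z)=-\frac1{2\sigma+2}(p^2+q^2)^{\sigma+1},\qquad S_2(z)=-\frac12(v^2+w^2).$$ Put $\omega=\frac12\,dz\wedge M\,dz$ and $\kappa=\frac12\,dz\wedge K\,dz$. Then the stochastic multi-symplectic conservation law $$d_t\omega(t,x)+\partial_x\kappa(t,x)\circ dW(t)=0,\quad\text{a.s.},$$ holds locally; that is, for all $0\le t_0\le t_1$ and all $x\in\mathbb R$, $$\omega(t_1,x)-\omega(t_0,x)=-\int_{t_0}^{t_1}\partial_x\kappa(t,x)\circ dW(t),\quad\text{a.s.}$$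
   Context: $W$ is a one-dimensional real-valued Brownian motion on a stochastic basis $(\Omega,\mathscr F,(\mathscr F_t)_{t\ge0},\mathbb P)$, $\circ\, dW$ denotes the Stratonovich differential, and $\sigma\le 2$ is a positive integer. The system is the compact form of the nonlinear Schrödinger equation with white noise dispersion $\mathbf i\,du+\Delta u\circ dW(t)+|u|^{2\sigma}u\,dt=0$ on $\mathbb R_+\times\mathbb R$ ($\mathbf i$ the imaginary unit), where $p,q$ are the real and imaginary parts of $u$, $v=p_x$ and $w=q_x$. $d_t$ denotes the stochastic differential in time, while $d$ denotes the exterior differential on the phase space, i.e. differentiation of the solution with respect to the initial datum. Thus $dz(t,x)$ is a vector of one-forms, and evaluating it on a variation of the initial datum gives the corresponding variation (tangent solution) of $z$ at $(t,x)$. For a $4\times4$ matrix $A$, $dz\wedge A\,dz:=\sum_{i,j}A_{ij}\,dz_i\wedge dz_j$, where $(dz_i\wedge dz_j)(\xi,\eta)=\xi_i\eta_j-\xi_j\eta_i$ on two variations $\xi,\eta$ of $z$. In particular $\kappa=dp\wedge dv+dq\wedge dw$. The two-forms are understood for solutions regular enough that these objects make sense. *)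

theory Defs
  imports "HOL-Probability.Probability"
begin

section \<open>Brownian motion on a stochastic basis\<close>

definition stochastic_basis :: "'a measure \<Rightarrow> (real \<Rightarrow> 'a measure) \<Rightarrow> bool" where
  "stochastic_basis P F \<longleftrightarrow>
     prob_space P \<and>
     (\<forall>t\<ge>0. subalgebra P (F t)) \<and>
     (\<forall>s t. 0 \<le> s \<longrightarrow> s \<le> t \<longrightarrow> sets (F s) \<subseteq> sets (F t))"

definition adapted :: "(real \<Rightarrow> 'a measure) \<Rightarrow> (real \<Rightarrow> 'a \<Rightarrow> 'b::topological_space) \<Rightarrow> bool" where
  "adapted F X \<longleftrightarrow> (\<forall>t\<ge>0. X t \<in> borel_measurable (F t))"

definition continuous_process :: "'a measure \<Rightarrow> (real \<Rightarrow> 'a \<Rightarrow> 'b::topological_space) \<Rightarrow> bool" where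
  "continuous_process P X \<longleftrightarrow> (AE \<omega> in P. continuous_on {0..} (\<lambda>t. X t \<omega>))"

definition brownian_motion ::
  "'a measure \<Rightarrow> (real \<Rightarrow> 'a measure) \<Rightarrow> (real \<Rightarrow> 'a \<Rightarrow> real) \<Rightarrow> bool" where
  "brownian_motion P F W \<longleftrightarrow>
     adapted F W \<and> continuous_process P W \<and> (AE \<omega> in P. W 0 \<omega> = 0) \<and>
     (\<forall>s t. 0 \<le> s \<longrightarrow> s < t \<longrightarrow>
        distributed P lborel (\<lambda>\<omega>. W t \<omega> - W s \<omega>) (normal_density 0 (sqrt (t - s))) \<and>
        prob_space.indep_set P (sets (F s))
          {(\<lambda>\<omega>. W t \<omega> - W s \<omega>) -` B \<inter> space P | B. B \<in> sets borel})"


section \<open>Stratonovich integral and quadratic variation\<close>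

text \<open>Convergence in probability, written so that it is also meaningful (as convergence in
  outer probability) when the quantities are only almost surely equal to random variables,
  e.g. for suprema of almost surely continuous processes over a time interval.\<close>

definition tendsto_in_prob ::
  "'a measure \<Rightarrow> ('i \<Rightarrow> 'a \<Rightarrow> 'b::real_normed_vector) \<Rightarrow> ('a \<Rightarrow> 'b) \<Rightarrow> 'i filter \<Rightarrow> bool" where
  "tendsto_in_prob P X Y G \<longleftrightarrow>
     (\<forall>\<epsilon>>0. \<forall>\<eta>>0. \<forall>\<^sub>F i in G. \<exists>A\<in>sets P. measure P A < \<eta> \<and>
        (\<forall>\<omega>\<in>space P - A. norm (X i \<omega> - Y \<omega>) < \<epsilon>))"

text \<open>A pair \<open>(N, \<tau>)\<close> encodes the partition \<open>a = \<tau> 0 \<le> \<tau> 1 \<le> \<dots> \<le> \<tau> N = b\<close>; the filter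
  describes the limit as the mesh tends to 0.\<close>

definition mesh_filter :: "real \<Rightarrow> real \<Rightarrow> (nat \<times> (nat \<Rightarrow> real)) filter" where
  "mesh_filter a b = (INF \<delta>\<in>{0<..}. principal
     {(N, \<tau>). \<tau> 0 = a \<and> \<tau> N = b \<and> (\<forall>i<N. \<tau> i \<le> \<tau> (Suc i) \<and> \<tau> (Suc i) - \<tau> i < \<delta>)})"

definition stratonovich_sum ::
  "(real \<Rightarrow> 'a \<Rightarrow> real) \<Rightarrow> (real \<Rightarrow> 'a \<Rightarrow> 'b::real_normed_vector) \<Rightarrow> nat \<times> (nat \<Rightarrow> real) \<Rightarrow> 'a \<Rightarrow> 'b" where
  "stratonovich_sum W X = (\<lambda>(N, \<tau>) \<omega>. \<Sum>i<N.
     (W (\<tau> (Suc i)) \<omega> - W (\<tau> i) \<omega>) *\<^sub>R ((1/2) *\<^sub>R (X (\<tau> i) \<omega> + X (\<tau> (Suc i)) \<omega>)))"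

definition has_stratonovich_integral ::
  "'a measure \<Rightarrow> (real \<Rightarrow> 'a \<Rightarrow> real) \<Rightarrow> (real \<Rightarrow> 'a \<Rightarrow> 'b::real_normed_vector) \<Rightarrow>
     real \<Rightarrow> real \<Rightarrow> ('a \<Rightarrow> 'b) \<Rightarrow> bool" where
  "has_stratonovich_integral P W X a b I \<longleftrightarrow>
     I \<in> borel_measurable P \<and> tendsto_in_prob P (stratonovich_sum W X) I (mesh_filter a b)"

definition stratonovich_integrable ::
  "'a measure \<Rightarrow> (real \<Rightarrow> 'a \<Rightarrow> real) \<Rightarrow> (real \<Rightarrow> 'a \<Rightarrow> 'b::real_normed_vector) \<Rightarrow>
     real \<Rightarrow> real \<Rightarrow> bool" where
  "stratonovich_integrable P W X a b \<longleftrightarrow> (\<exists>I. has_stratonovich_integral P W X a b I)"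

text \<open>The value is determined up to almost sure equality.\<close>

definition stratonovich_integral ::
  "'a measure \<Rightarrow> (real \<Rightarrow> 'a \<Rightarrow> real) \<Rightarrow> (real \<Rightarrow> 'a \<Rightarrow> 'b::real_normed_vector) \<Rightarrow>
     real \<Rightarrow> real \<Rightarrow> 'a \<Rightarrow> 'b" where
  "stratonovich_integral P W X a b = (SOME I. has_stratonovich_integral P W X a b I)"

definition has_quadratic_variation ::
  "'a measure \<Rightarrow> (real \<Rightarrow> 'a \<Rightarrow> 'b::real_normed_vector) \<Rightarrow> real \<Rightarrow> ('a \<Rightarrow> real) \<Rightarrow> bool" where
  "has_quadratic_variation P X t Q \<longleftrightarrow>
     tendsto_in_prob P (\<lambda>(N, \<tau>) \<omega>. \<Sum>i<N. (norm (X (\<tau> (Suc i)) \<omega> - X (\<tau> i) \<omega>))\<^sup>2) Q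
       (mesh_filter 0 t)"


section \<open>Regularity of random fields\<close>

text \<open>Every continuous semimartingale satisfies the following condition.\<close>

definition regular_process ::
  "'a measure \<Rightarrow> (real \<Rightarrow> 'a measure) \<Rightarrow> (real \<Rightarrow> 'a \<Rightarrow> 'b::real_normed_vector) \<Rightarrow> bool" where
  "regular_process P F X \<longleftrightarrow>
     adapted F X \<and> continuous_process P X \<and> (\<forall>t\<ge>0. \<exists>Q. has_quadratic_variation P X t Q)"

text \<open>Convergence of processes uniformly on compact time intervals in probability, together with
  convergence to 0 of the quadratic variation of the difference. Both are implied by convergence
  in the semimartingale (Emery) topology. The quadratic variation is needed for limits to pass
  through the Stratonovich integral, which is not continuous for locally uniform convergence
  alone.\<close>

definition process_tendsto ::
  "'a measure \<Rightarrow> ('i \<Rightarrow> real \<Rightarrow> 'a \<Rightarrow> 'b::real_normed_vector) \<Rightarrow> (real \<Rightarrow> 'a \<Rightarrow> 'b) \<Rightarrow>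
     'i filter \<Rightarrow> bool" where
  "process_tendsto P X Y G \<longleftrightarrow>
     (\<forall>T\<ge>0.
        tendsto_in_prob P (\<lambda>i \<omega>. SUP t\<in>{0..T}. norm (X i t \<omega> - Y t \<omega>)) (\<lambda>_. 0) G \<and>
        (\<exists>Q. (\<forall>\<^sub>F i in G. has_quadratic_variation P (\<lambda>t \<omega>. X i t \<omega> - Y t \<omega>) T (Q i)) \<and>
             tendsto_in_prob P Q (\<lambda>_. 0) G))"

text \<open>Random fields are functions of time, space and sample point, in this order.\<close>

definition dx ::
  "(real \<Rightarrow> real \<Rightarrow> 'a \<Rightarrow> 'b::real_normed_vector) \<Rightarrow> real \<Rightarrow> real \<Rightarrow> 'a \<Rightarrow> 'b" where
  "dx f t x \<omega> = vector_derivative (\<lambda>y. f t y \<omega>) (at x)"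

definition regular_field ::
  "'a measure \<Rightarrow> (real \<Rightarrow> 'a measure) \<Rightarrow> (real \<Rightarrow> real \<Rightarrow> 'a \<Rightarrow> 'b::real_normed_vector) \<Rightarrow> bool" where
  "regular_field P F f \<longleftrightarrow>
     (AE \<omega> in P. \<forall>t\<ge>0. \<forall>x. (\<lambda>y. f t y \<omega>) differentiable (at x)) \<and>
     (\<forall>x. regular_process P F (\<lambda>t. f t x) \<and> regular_process P F (\<lambda>t. dx f t x))"

definition field_tendsto ::
  "'a measure \<Rightarrow> ('i \<Rightarrow> real \<Rightarrow> real \<Rightarrow> 'a \<Rightarrow> 'b::real_normed_vector) \<Rightarrow>
     (real \<Rightarrow> real \<Rightarrow> 'a \<Rightarrow> 'b) \<Rightarrow> 'i filter \<Rightarrow> bool" where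
  "field_tendsto P f g G \<longleftrightarrow>
     (\<forall>x. process_tendsto P (\<lambda>i t. f i t x) (\<lambda>t. g t x) G \<and>
          process_tendsto P (\<lambda>i t. dx (f i) t x) (\<lambda>t. dx g t x) G)"


section \<open>The stochastic Hamiltonian system\<close>

definition matM :: "real^4^4" where
  "matM = vector [vector [0, -1, 0, 0],
                  vector [1,  0, 0, 0],
                  vector [0,  0, 0, 0],
                  vector [0,  0, 0, 0]]"

definition matK :: "real^4^4" where
  "matK = vector [vector [ 0,  0, 1, 0],
                  vector [ 0,  0, 0, 1],
                  vector [-1,  0, 0, 0],
                  vector [ 0, -1, 0, 0]]"

text \<open>The components of \<open>z\<close> are \<open>z$1 = p\<close>, \<open>z$2 = q\<close>, \<open>z$3 = v\<close>, \<open>z$4 = w\<close>.\<close>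

definition S1 :: "nat \<Rightarrow> real^4 \<Rightarrow> real" where
  "S1 \<sigma> z = - (1 / (2 * real \<sigma> + 2)) * ((z$1)\<^sup>2 + (z$2)\<^sup>2) ^ (\<sigma> + 1)"

definition S2 :: "real^4 \<Rightarrow> real" where
  "S2 z = - (1/2) * ((z$3)\<^sup>2 + (z$4)\<^sup>2)"

definition grad :: "('b::real_inner \<Rightarrow> real) \<Rightarrow> 'b \<Rightarrow> 'b" where
  "grad f z = (THE D. GDERIV f z :> D)"

text \<open>The system in integrated form, with \<open>v = p\<^sub>x\<close> and \<open>w = q\<^sub>x\<close>.\<close>

definition is_solution ::
  "'a measure \<Rightarrow> (real \<Rightarrow> 'a measure) \<Rightarrow> (real \<Rightarrow> 'a \<Rightarrow> real) \<Rightarrow> nat \<Rightarrow>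
     (real \<Rightarrow> real \<Rightarrow> 'a \<Rightarrow> real^4) \<Rightarrow> bool" where
  "is_solution P F W \<sigma> z \<longleftrightarrow>
     regular_field P F z \<and>
     (AE \<omega> in P. \<forall>t\<ge>0. \<forall>x. z t x \<omega> $ 3 = dx (\<lambda>t x \<omega>. z t x \<omega> $ 1) t x \<omega> \<and>
                         z t x \<omega> $ 4 = dx (\<lambda>t x \<omega>. z t x \<omega> $ 2) t x \<omega>) \<and>
     (\<forall>x. \<forall>t\<ge>0.
        stratonovich_integrable P W (\<lambda>s \<omega>. matK *v dx z s x \<omega>) 0 t \<and>
        stratonovich_integrable P W (\<lambda>s \<omega>. grad S2 (z s x \<omega>)) 0 t \<and>
        (AE \<omega> in P.
           matM *v (z t x \<omega> - z 0 x \<omega>)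
             + stratonovich_integral P W (\<lambda>s \<omega>. matK *v dx z s x \<omega>) 0 t \<omega>
           = integral {0..t} (\<lambda>s. grad (S1 \<sigma>) (z s x \<omega>))
             + stratonovich_integral P W (\<lambda>s \<omega>. grad S2 (z s x \<omega>)) 0 t \<omega>))"


section \<open>Exterior differential with respect to the initial datum\<close>

text \<open>An initial datum is a function of space and sample point; deterministic data do not depend
  on the sample point.\<close>

type_synonym 'a datum = "real \<Rightarrow> 'a \<Rightarrow> real^4"

definition shift :: "'a datum \<Rightarrow> 'a datum \<Rightarrow> real \<Rightarrow> 'a datum" where
  "shift \<phi> h \<epsilon> = (\<lambda>x \<omega>. \<phi> x \<omega> + \<epsilon> *\<^sub>R h x \<omega>)"

definition solution_flow ::
  "'a measure \<Rightarrow> (real \<Rightarrow> 'a measure) \<Rightarrow> (real \<Rightarrow> 'a \<Rightarrow> real) \<Rightarrow> nat \<Rightarrow> 'a datum set \<Rightarrow>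
     ('a datum \<Rightarrow> real \<Rightarrow> real \<Rightarrow> 'a \<Rightarrow> real^4) \<Rightarrow> bool" where
  "solution_flow P F W \<sigma> U Z \<longleftrightarrow>
     (\<forall>\<phi>\<in>U. is_solution P F W \<sigma> (Z \<phi>) \<and> (AE \<omega> in P. \<forall>x. Z \<phi> 0 x \<omega> = \<phi> x \<omega>))"

definition variations :: "'a datum set \<Rightarrow> 'a datum \<Rightarrow> 'a datum set" where
  "variations U \<phi> = {h. \<forall>\<^sub>F \<epsilon> in at 0. shift \<phi> h \<epsilon> \<in> U}"

text \<open>\<open>dz h t x \<omega>\<close> is the vector of one-forms \<open>dz(t,x)\<close> at \<open>\<phi>\<close> evaluated on the variation \<open>h\<close>.\<close>

definition is_exterior_differential ::
  "'a measure \<Rightarrow> (real \<Rightarrow> 'a measure) \<Rightarrow> 'a datum set \<Rightarrow>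
     ('a datum \<Rightarrow> real \<Rightarrow> real \<Rightarrow> 'a \<Rightarrow> real^4) \<Rightarrow> 'a datum \<Rightarrow>
     ('a datum \<Rightarrow> real \<Rightarrow> real \<Rightarrow> 'a \<Rightarrow> real^4) \<Rightarrow> bool" where
  "is_exterior_differential P F U Z \<phi> dz \<longleftrightarrow>
     (\<forall>h\<in>variations U \<phi>.
        regular_field P F (dz h) \<and>
        field_tendsto P
          (\<lambda>\<epsilon> t x \<omega>. (1 / \<epsilon>) *\<^sub>R (Z (shift \<phi> h \<epsilon>) t x \<omega> - Z \<phi> t x \<omega>)) (dz h) (at 0))"

definition wedge :: "('e \<Rightarrow> real) \<Rightarrow> ('e \<Rightarrow> real) \<Rightarrow> 'e \<Rightarrow> 'e \<Rightarrow> real" where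
  "wedge \<alpha> \<beta> h k = \<alpha> h * \<beta> k - \<beta> h * \<alpha> k"

definition wedge_mat :: "('e \<Rightarrow> real^4) \<Rightarrow> real^4^4 \<Rightarrow> 'e \<Rightarrow> 'e \<Rightarrow> real" where
  "wedge_mat \<theta> A h k =
     (\<Sum>i\<in>UNIV. \<Sum>j\<in>UNIV. A $ i $ j * wedge (\<lambda>g. \<theta> g $ i) (\<lambda>g. \<theta> g $ j) h k)"

definition omega_form ::
  "('e \<Rightarrow> real \<Rightarrow> real \<Rightarrow> 'a \<Rightarrow> real^4) \<Rightarrow> 'e \<Rightarrow> 'e \<Rightarrow> real \<Rightarrow> real \<Rightarrow> 'a \<Rightarrow> real" where
  "omega_form dz h k t x \<omega> = (1/2) * wedge_mat (\<lambda>g. dz g t x \<omega>) matM h k"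

definition kappa_form ::
  "('e \<Rightarrow> real \<Rightarrow> real \<Rightarrow> 'a \<Rightarrow> real^4) \<Rightarrow> 'e \<Rightarrow> 'e \<Rightarrow> real \<Rightarrow> real \<Rightarrow> 'a \<Rightarrow> real" where
  "kappa_form dz h k t x \<omega> = (1/2) * wedge_mat (\<lambda>g. dz g t x \<omega>) matK h k"

end

theory Submission
  imports Defs
begin

text \<open>
  Two tangent solutions \<open>\<xi>\<close>, \<open>\<eta>\<close> solve the linearised system, whose drift is the Hessian of \<open>S1\<close>
  along \<open>z\<close>; the linearised equation is the limit of the difference quotients of the system, because
  a Stratonovich sum is small when its integrand and the quadratic variation of its integrand are
  small. Over one cell of a partition, the increment of \<open>\<omega> = \<xi>\<^sub>2 \<eta>\<^sub>1 - \<xi>\<^sub>1 \<eta>\<^sub>2\<close> obeys the exact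
  Leibniz rule with averaged factors. Inserting the linearised equation, the drift cancels by
  symmetry of the Hessian, and the martingale part is the Stratonovich sum of \<open>-\<partial>\<^sub>x \<kappa>\<close>, provided that
  \<open>\<Sum> b \<circ> \<Delta>(\<integral> Y \<circ> dW)\<close> and \<open>\<Sum> (b Y) \<circ> \<Delta>W\<close> have the same limit. No Ito calculus is needed:
  the only probabilistic input is the isometry \<open>E (\<Sum> \<theta> \<Delta>W)\<^sup>2 \<le> \<Sum> c\<^sup>2 \<Delta>t\<close> for finite sums with
  adapted \<open>\<bar>\<theta>\<bar> \<le> c\<close>.
\<close>

section \<open>Events of large outer probability\<close>

text \<open>The hypotheses give the tangent solutions and their space derivatives only adaptedness,
  continuity in time and a quadratic variation, not a semimartingale decomposition. The obstacle is
  the associativity step: the integral \<open>A\<close> of \<open>Y\<close> is itself known only as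
  a limit in probability at each fixed time and without a rate, so its errors on the cells of a
  partition cannot simply be added up. The remedy is to replace \<open>b\<close> by a step function
  whose number of jumps does not depend on the partition. Abel summation then leaves errors of
  \<open>A\<close> at boundedly many times. The rest of \<open>b\<close> is uniformly small; it
  multiplies the error of each cell, which a refinement of the cell resolves into a sum over adapted
  integrands, for the isometry, and terms bounded by quadratic sums. All estimates are pathwise off
  a set of small measure. Suprema over uncountably many times need not be measurable, so an
  exceptional event is covered by a measurable set instead of being measured itself. The isometry
  asks for deterministic bounds; they come from truncating integrands outside a likely
  event.\<close>

definition likely :: "'a measure \<Rightarrow> real \<Rightarrow> ('a \<Rightarrow> bool) \<Rightarrow> bool" where
  "likely P \<eta> S \<longleftrightarrow> (\<exists>A\<in>sets P. measure P A < \<eta> \<and> (\<forall>w\<in>space P - A. S w))"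

lemma likely_mono:
  "likely P \<eta> S \<Longrightarrow> \<eta> \<le> \<eta>' \<Longrightarrow> (\<And>w. w \<in> space P \<Longrightarrow> S w \<Longrightarrow> S' w) \<Longrightarrow> likely P \<eta>' S'"
  unfolding likely_def by (meson DiffD1 order_less_le_trans)

context finite_measure
begin

lemma likely_conj:
  assumes "likely M \<eta> S" "likely M \<eta>' S'"
  shows "likely M (\<eta> + \<eta>') (\<lambda>w. S w \<and> S' w)"
proof -
  obtain A where A: "A \<in> sets M" "measure M A < \<eta>" "\<forall>w\<in>space M - A. S w"
    using assms(1) unfolding likely_def by auto
  obtain B where B: "B \<in> sets M" "measure M B < \<eta>'" "\<forall>w\<in>space M - B. S' w"
    using assms(2) unfolding likely_def by auto
  have "measure M (A \<union> B) \<le> measure M A + measure M B"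
    by (rule measure_Un_le) (use A B in auto)
  then show ?thesis
    unfolding likely_def using A B by (intro bexI[of _ "A \<union> B"]) auto
qed

lemma likely_mp:
  assumes "likely M \<eta> S" "likely M \<eta>' S'" "\<And>w. w \<in> space M \<Longrightarrow> S w \<Longrightarrow> S' w \<Longrightarrow> R w" "\<eta> + \<eta>' \<le> \<zeta>"
  shows "likely M \<zeta> R"
  using likely_conj[OF assms(1,2)] by (rule likely_mono) (use assms in auto)

lemma likely_AE:
  assumes "AE w in M. S w" "0 < \<eta>"
  shows "likely M \<eta> S"
proof -
  from assms(1) obtain N where "{x\<in>space M. \<not> S x} \<subseteq> N" "emeasure M N = 0" "N \<in> sets M"
    by (rule AE_E)
  then show ?thesis unfolding likely_def
    by (intro bexI[of _ N]) (auto simp: measure_def assms(2))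
qed

lemma likely_AE_mp:
  assumes "likely M \<eta> S" "AE w in M. S w \<longrightarrow> R w" "\<eta> < \<zeta>"
  shows "likely M \<zeta> R"
  by (rule likely_mp[OF assms(1) likely_AE[OF assms(2), of "\<zeta> - \<eta>"]]) (use assms in auto)

text \<open>A union bound with one share more than there are events: \<open>likely\<close> asks for
  a strict inequality, so the induction already spends a positive share on the empty set.\<close>

lemma likely_ball:
  assumes "finite J" "\<And>i. i \<in> J \<Longrightarrow> likely M (\<eta> / (real (card J) + 1)) (S i)" "0 < \<eta>"
  shows "likely M \<eta> (\<lambda>w. \<forall>i\<in>J. S i w)"
proof -
  define \<zeta> where "\<zeta> = \<eta> / (real (card J) + 1)"
  have \<zeta>: "0 < \<zeta>" using assms(3) by (simp add: \<zeta>_def)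
  have "likely M (real (card K) * \<zeta> + \<zeta>) (\<lambda>w. \<forall>i\<in>K. S i w)" if "K \<subseteq> J" for K
    using finite_subset[OF that assms(1)] that
  proof (induction K rule: finite_induct)
    case empty
    show ?case by (rule likely_AE) (use \<zeta> in auto)
  next
    case (insert x K)
    then have "likely M (real (card K) * \<zeta> + \<zeta> + \<zeta>) (\<lambda>w. (\<forall>i\<in>K. S i w) \<and> S x w)"
      by (intro likely_conj insert.IH) (use assms(2) in \<open>auto simp: \<zeta>_def\<close>)
    then show ?case
      by (rule likely_mono) (use insert in \<open>auto simp: algebra_simps\<close>)
  qed
  from this[of J] show ?thesis
  proof (rule likely_mono)
    have "real (card J) * \<zeta> + \<zeta> = \<zeta> * (real (card J) + 1)" by (simp add: algebra_simps)
    also have "\<dots> = \<eta>" unfolding \<zeta>_def by (simp add: add_nonneg_eq_0_iff)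
    finally show "real (card J) * \<zeta> + \<zeta> \<le> \<eta>" by simp
  qed auto
qed

text \<open>The failure set may be non-measurable, but it lies in the intersection of the covers,
  whose measure is at most every \<open>1 / Suc n\<close>.\<close>

lemma likely_imp_AE:
  assumes "\<And>\<eta>. 0 < \<eta> \<Longrightarrow> likely M \<eta> S"
  shows "AE w in M. S w"
proof -
  have "\<exists>A\<in>sets M. measure M A < 1 / Suc n \<and> (\<forall>w\<in>space M - A. S w)" for n
    using assms[of "1 / Suc n"] unfolding likely_def by auto
  then obtain A where A: "\<And>n. A n \<in> sets M" "\<And>n. measure M (A n) < 1 / Suc n"
     "\<And>n w. w \<in> space M - A n \<Longrightarrow> S w" by metis
  define B where "B = (\<Inter>n. A n)"
  have B: "B \<in> sets M" using A(1) unfolding B_def by auto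
  have "measure M B \<le> 1 / Suc n" for n
  proof -
    have "measure M B \<le> measure M (A n)"
      by (rule finite_measure_mono) (use A(1) in \<open>auto simp: B_def\<close>)
    with A(2)[of n] show ?thesis by linarith
  qed
  then have "measure M B \<le> 0"
    by (intro LIMSEQ_le_const[OF LIMSEQ_Suc[OF lim_inverse_n']]) auto
  then have "emeasure M B = 0"
    by (simp add: emeasure_eq_measure measure_le_0_iff)
  then show ?thesis
    by (intro AE_I[of _ _ B]) (use A(3) B in \<open>auto simp: B_def\<close>)
qed

lemma likely_close_imp_AE_eq:
  fixes X Y :: "'a \<Rightarrow> real"
  assumes "\<And>e \<eta>. 0 < e \<Longrightarrow> 0 < \<eta> \<Longrightarrow> likely M \<eta> (\<lambda>w. \<bar>X w - Y w\<bar> \<le> e)"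
  shows "AE w in M. X w = Y w"
proof -
  have "AE w in M. \<bar>X w - Y w\<bar> \<le> 1 / Suc n" for n :: nat
    by (rule likely_imp_AE) (use assms in auto)
  then have "AE w in M. \<forall>n::nat. \<bar>X w - Y w\<bar> \<le> 1 / Suc n"
    by (simp only: AE_all_countable) blast
  then show ?thesis
  proof eventually_elim
    case (elim w)
    have "\<bar>X w - Y w\<bar> \<le> 0"
      by (rule LIMSEQ_le_const[OF LIMSEQ_Suc[OF lim_1_over_n]]) (use elim in blast)
    then show ?case by simp
  qed
qed

text \<open>Continuity of the measure from above along the decreasing failure sets. It turns an
  index \<open>n\<close> that depends on the sample point into one that serves off a small
  set.\<close>

lemma likely_increasing:
  assumes [measurable]: "\<And>n::nat. {w\<in>space M. S n w} \<in> sets M"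
    and mono: "\<And>m n w. m \<le> n \<Longrightarrow> S m w \<Longrightarrow> S n w"
    and ae: "AE w in M. \<exists>n. S n w" and "0 < \<eta>"
  shows "\<exists>n. likely M \<eta> (S n)"
proof -
  define A where "A n = {w\<in>space M. \<not> S n w}" for n
  have A[measurable]: "A n \<in> sets M" for n unfolding A_def by measurable
  have "(\<lambda>n. measure M (A n)) \<longlonglongrightarrow> measure M (\<Inter>n. A n)"
    by (rule finite_Lim_measure_decseq) (auto simp: decseq_def A_def dest: mono)
  moreover have "measure M (\<Inter>n. A n) = 0"
  proof -
    have "AE w in M. w \<notin> (\<Inter>n. A n)" using ae by eventually_elim (auto simp: A_def)
    then have "(\<Inter>n. A n) \<in> null_sets M" by (subst AE_iff_null_sets) auto
    then show ?thesis by (simp add: measure_def null_setsD1)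
  qed
  ultimately have "eventually (\<lambda>n. measure M (A n) < \<eta>) sequentially"
    using \<open>0 < \<eta>\<close> by (simp add: order_tendsto_iff)
  then obtain n where "measure M (A n) < \<eta>" by (auto simp: eventually_sequentially)
  then show ?thesis unfolding likely_def
    by (intro exI[of _ n] bexI[of _ "A n"]) (auto simp: A_def)
qed

lemma tight_real:
  fixes X :: "'a \<Rightarrow> real"
  assumes [measurable]: "X \<in> borel_measurable M" and "0 < \<eta>"
  shows "\<exists>C>0. likely M \<eta> (\<lambda>w. \<bar>X w\<bar> \<le> C)"
proof -
  have "\<exists>n. likely M \<eta> (\<lambda>w. \<bar>X w\<bar> \<le> real n)"
    by (rule likely_increasing) (use assms(2) in \<open>auto intro: real_arch_simple\<close>)
  then obtain n where "likely M \<eta> (\<lambda>w. \<bar>X w\<bar> \<le> real n)" by auto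
  then have "likely M \<eta> (\<lambda>w. \<bar>X w\<bar> \<le> real n + 1)" by (rule likely_mono) auto
  then show ?thesis by (intro exI[of _ "real n + 1"]) auto
qed

end

section \<open>Uniform bounds for continuous processes\<close>

abbreviation osc_le :: "(real \<Rightarrow> 'a \<Rightarrow> real) \<Rightarrow> real \<Rightarrow> real \<Rightarrow> real \<Rightarrow> 'a \<Rightarrow> bool" where
  "osc_le X T h \<kappa> w \<equiv> \<forall>s\<in>{0..T}. \<forall>t\<in>{0..T}. \<bar>s - t\<bar> < h \<longrightarrow> \<bar>X s w - X t w\<bar> \<le> \<kappa>"

lemma real_limit_of_rationals:
  obtains p :: "nat \<Rightarrow> real" where "\<And>n. p n \<in> \<rat>" "p \<longlonglongrightarrow> s"
  using closure_sequential[of s "\<rat>"] Rats_closure_real by auto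

text \<open>Each continuous path is uniformly continuous on \<open>{0..T}\<close>, with a random
  modulus. Restricted to rational times, the event that \<open>1 / Suc n\<close> serves as modulus
  is measurable, so \<open>likely_increasing\<close> makes it deterministic; density of the
  rationals restores all times.\<close>

lemma (in finite_measure) likely_modulus:
  fixes X :: "real \<Rightarrow> 'a \<Rightarrow> real"
  assumes meas: "\<And>t. 0 \<le> t \<Longrightarrow> X t \<in> borel_measurable M"
    and cont: "AE w in M. continuous_on {0..} (\<lambda>t. X t w)"
    and T: "0 \<le> T" and \<kappa>: "0 < \<kappa>" and \<eta>: "0 < \<eta>"
  shows "\<exists>h>0. likely M \<eta> (\<lambda>w. osc_le X T h \<kappa> w)"
proof -
  \<comment> \<open>Rationals that approximate an endpoint may lie outside \<open>{0..T}\<close>.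
    Clamping is 1-Lipschitz and fixes \<open>{0..T}\<close>, so all rationals can be used.\<close>
  define c where "c t = max 0 (min T t)" for t :: real
  have c: "0 \<le> c t" "c t \<in> {0..T}" for t using T by (auto simp: c_def)
  have cid: "c t = t" if "t \<in> {0..T}" for t using that by (auto simp: c_def)
  have cdist: "\<bar>c s - c t\<bar> \<le> \<bar>s - t\<bar>" for s t by (auto simp: c_def)
  have cc: "continuous_on UNIV c" unfolding c_def by (intro continuous_intros)
  have [measurable]: "X (c t) \<in> borel_measurable M" for t using meas c(1) by blast
  define S where "S n w \<longleftrightarrow> (\<forall>p\<in>\<rat>. \<forall>q\<in>\<rat>. \<bar>p - q\<bar> < 1 / Suc n \<longrightarrow> \<bar>X (c p) w - X (c q) w\<bar> \<le> \<kappa>)"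
    for n :: nat and w
  have Rc: "countable (\<rat> :: real set)" by (rule countable_rat)
  have "\<exists>n. likely M (\<eta>/2) (S n)"
  proof (rule likely_increasing)
    show "{w \<in> space M. S n w} \<in> sets M" for n
      unfolding S_def by (intro sets.sets_Collect_countable_All' Rc) measurable
    show "S n w" if "m \<le> n" "S m w" for m n w
    proof -
      have "1 / real (Suc n) \<le> 1 / real (Suc m)" using that(1) by (simp add: frac_le)
      then show ?thesis using that(2) unfolding S_def by (meson order_less_le_trans)
    qed
    show "AE w in M. \<exists>n. S n w" using cont
    proof eventually_elim
      case (elim w)
      have "uniformly_continuous_on {0..T} (\<lambda>t. X t w)"
        by (rule compact_uniformly_continuous) (auto intro: continuous_on_subset[OF elim])
      then obtain d where d: "d > 0" "\<And>s t. s \<in> {0..T} \<Longrightarrow> t \<in> {0..T} \<Longrightarrow> dist s t < d \<Longrightarrow> dist (X s w) (X t w) < \<kappa>"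
        using \<kappa> unfolding uniformly_continuous_on_def by metis
      obtain n where n: "1 / Suc n < d"
        using reals_Archimedean[OF d(1)] by (auto simp: inverse_eq_divide)
      have "S n w" unfolding S_def
      proof (intro ballI impI)
        fix p q :: real assume "\<bar>p - q\<bar> < 1 / Suc n"
        then have "dist (c p) (c q) < d" using cdist[of p q] n by (simp add: dist_real_def)
        from d(2)[OF c(2) c(2) this] show "\<bar>X (c p) w - X (c q) w\<bar> \<le> \<kappa>" by (simp add: dist_real_def)
      qed
      then show ?case by blast
    qed
  qed (use \<eta> in auto)
  then obtain n where n: "likely M (\<eta>/2) (S n)" ..
  have "likely M \<eta> (\<lambda>w. \<forall>s\<in>{0..T}. \<forall>t\<in>{0..T}. \<bar>s - t\<bar> < 1 / Suc n \<longrightarrow> \<bar>X s w - X t w\<bar> \<le> \<kappa>)"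
  proof (rule likely_AE_mp[OF n])
    show "AE w in M. S n w \<longrightarrow> (\<forall>s\<in>{0..T}. \<forall>t\<in>{0..T}. \<bar>s - t\<bar> < 1 / Suc n \<longrightarrow> \<bar>X s w - X t w\<bar> \<le> \<kappa>)"
      using cont
    proof eventually_elim
      case (elim w)
      have "continuous_on UNIV (\<lambda>t. X (c t) w)"
        by (rule continuous_on_compose2[OF elim cc]) (use c(1) in auto)
      then have ct: "(\<lambda>i. X (c (p i)) w) \<longlonglongrightarrow> X (c s) w" if "p \<longlonglongrightarrow> s" for p :: "nat \<Rightarrow> real" and s
        using that isCont_tendsto_compose[of s "\<lambda>t. X (c t) w" p] by (simp add: continuous_on_eq_continuous_at)
      show ?case
      proof (intro impI ballI)
        fix s t assume S: "S n w" and st: "s \<in> {0..T}" "t \<in> {0..T}" "\<bar>s - t\<bar> < 1 / Suc n"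
        obtain p where p: "\<And>n::nat. p n \<in> \<rat>" "p \<longlonglongrightarrow> s" by (rule real_limit_of_rationals) auto
        obtain q where q: "\<And>n::nat. q n \<in> \<rat>" "q \<longlonglongrightarrow> t" by (rule real_limit_of_rationals) auto
        have "(\<lambda>i. \<bar>p i - q i\<bar>) \<longlonglongrightarrow> \<bar>s - t\<bar>" by (intro tendsto_intros p q)
        then have "\<forall>\<^sub>F i in sequentially. \<bar>p i - q i\<bar> < 1 / Suc n" using st(3) by (rule order_tendstoD)
        then have ev: "\<forall>\<^sub>F i in sequentially. \<bar>X (c (p i)) w - X (c (q i)) w\<bar> \<le> \<kappa>"
          by eventually_elim (use S p(1) q(1) in \<open>auto simp: S_def\<close>)
        have "(\<lambda>i. \<bar>X (c (p i)) w - X (c (q i)) w\<bar>) \<longlonglongrightarrow> \<bar>X (c s) w - X (c t) w\<bar>"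
          by (intro tendsto_intros ct p q)
        from tendsto_upperbound[OF this ev] show "\<bar>X s w - X t w\<bar> \<le> \<kappa>" by (simp add: cid[OF st(1)] cid[OF st(2)])
      qed
    qed
  qed (use \<eta> in auto)
  moreover have "0 < 1 / real (Suc n)" by simp
  ultimately show ?thesis by blast
qed

text \<open>Chaining from time 0: a modulus \<open>h\<close> for oscillation 1 reaches any time in
  \<open>n\<close> steps of length \<open>h/2\<close>, each adding at most 1. Half of
  \<open>h\<close> is used because the modulus asks for a distance strictly below
  \<open>h\<close>.\<close>

lemma (in finite_measure) likely_bounded:
  fixes X :: "real \<Rightarrow> 'a \<Rightarrow> real"
  assumes meas: "\<And>t. 0 \<le> t \<Longrightarrow> X t \<in> borel_measurable M"
    and cont: "AE w in M. continuous_on {0..} (\<lambda>t. X t w)"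
    and T: "0 \<le> T" and "0 < \<eta>"
  shows "\<exists>B>0. likely M \<eta> (\<lambda>w. \<forall>t\<in>{0..T}. \<bar>X t w\<bar> \<le> B)"
proof -
  have \<eta>: "0 < \<eta>/2" using assms by simp
  obtain h where h: "0 < h" "likely M (\<eta>/2) (\<lambda>w. osc_le X T h 1 w)"
    using likely_modulus[OF meas cont T zero_less_one \<eta>] by auto
  obtain C where C: "0 < C" "likely M (\<eta>/2) (\<lambda>w. \<bar>X 0 w\<bar> \<le> C)" using tight_real[OF meas \<eta>] by auto
  obtain n :: nat where n: "T / (h/2) \<le> n" using real_arch_simple by blast
  have "likely M \<eta> (\<lambda>w. \<forall>t\<in>{0..T}. \<bar>X t w\<bar> \<le> C + n)"
  proof (rule likely_mp[OF h(2) C(2)])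
    fix w assume *: "osc_le X T h 1 w" and 0: "\<bar>X 0 w\<bar> \<le> C"
    have "\<bar>X t w\<bar> \<le> C + m" if "t \<in> {0..T}" "t \<le> m * (h/2)" for t and m :: nat
      using that
    proof (induction m arbitrary: t)
      case 0
      then show ?case using \<open>\<bar>X 0 w\<bar> \<le> C\<close> by simp
    next
      case (Suc m)
      define s where "s = max 0 (t - h/2)"
      have s: "s \<in> {0..T}" "s \<le> m * (h/2)" "\<bar>s - t\<bar> < h"
      proof -
        have "0 \<le> m * (h/2)" "t - h/2 \<le> m * (h/2)" using Suc.prems(2) h(1) by (simp_all add: algebra_simps)
        then show "s \<le> m * (h/2)" unfolding s_def by (rule max.boundedI)
        show "s \<in> {0..T}" "\<bar>s - t\<bar> < h" using Suc.prems(1) h(1) by (auto simp: s_def)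
      qed
      then have "\<bar>X s w - X t w\<bar> \<le> 1" using * Suc.prems(1) by blast
      then show ?case using Suc.IH[OF s(1,2)] by simp
    qed
    moreover have "t \<le> n * (h/2)" if "t \<in> {0..T}" for t
      using n that h(1) by (simp add: field_simps)
    ultimately show "\<forall>t\<in>{0..T}. \<bar>X t w\<bar> \<le> C + n" by blast
  qed simp
  then show ?thesis using C(1) by (intro exI[of _ "C + n"]) auto
qed

section \<open>Partitions\<close>

definition part :: "real \<Rightarrow> real \<Rightarrow> real \<Rightarrow> nat \<Rightarrow> (nat \<Rightarrow> real) \<Rightarrow> bool" where
  "part a b \<delta> N \<tau> \<longleftrightarrow> \<tau> 0 = a \<and> \<tau> N = b \<and> (\<forall>i<N. \<tau> i \<le> \<tau> (Suc i) \<and> \<tau> (Suc i) - \<tau> i < \<delta>)"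

lemma eventually_mesh_filter:
  "eventually Q (mesh_filter a b) \<longleftrightarrow> (\<exists>\<delta>>0. \<forall>N \<tau>. part a b \<delta> N \<tau> \<longrightarrow> Q (N, \<tau>))"
  unfolding mesh_filter_def part_def
proof (subst eventually_INF_base)
  fix x y :: real assume xy: "x \<in> {0<..}" "y \<in> {0<..}"
  show "\<exists>z\<in>{0<..}. principal {(N, \<tau>). \<tau> 0 = a \<and> \<tau> N = b \<and> (\<forall>i<N. \<tau> i \<le> \<tau> (Suc i) \<and> \<tau> (Suc i) - \<tau> i < z)}
    \<le> inf (principal {(N, \<tau>). \<tau> 0 = a \<and> \<tau> N = b \<and> (\<forall>i<N. \<tau> i \<le> \<tau> (Suc i) \<and> \<tau> (Suc i) - \<tau> i < x)})
       (principal {(N, \<tau>). \<tau> 0 = a \<and> \<tau> N = b \<and> (\<forall>i<N. \<tau> i \<le> \<tau> (Suc i) \<and> \<tau> (Suc i) - \<tau> i < y)})"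
    by (rule bexI[of _ "min x y"]) (use xy in auto)
qed (auto simp: eventually_principal)

lemma tendsto_in_prob_mesh:
  "tendsto_in_prob P X Y (mesh_filter a b) \<longleftrightarrow>
    (\<forall>\<epsilon>>0. \<forall>\<eta>>0. \<exists>\<delta>>0. \<forall>N \<tau>. part a b \<delta> N \<tau> \<longrightarrow> likely P \<eta> (\<lambda>w. norm (X (N, \<tau>) w - Y w) < \<epsilon>))"
  unfolding tendsto_in_prob_def eventually_mesh_filter likely_def ..

lemma tendsto_in_prob_likely:
  "tendsto_in_prob P X Y G \<longleftrightarrow>
    (\<forall>\<epsilon>>0. \<forall>\<eta>>0. \<forall>\<^sub>F i in G. likely P \<eta> (\<lambda>w. norm (X i w - Y w) < \<epsilon>))"
  unfolding tendsto_in_prob_def likely_def ..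

lemma part_mono: "part a b \<delta> N \<tau> \<Longrightarrow> \<delta> \<le> \<delta>' \<Longrightarrow> part a b \<delta>' N \<tau>"
  unfolding part_def by fastforce

lemma part_le:
  assumes "part a b \<delta> N \<tau>" "i \<le> j" "j \<le> N"
  shows "\<tau> i \<le> \<tau> j"
  using assms(2,3)
proof (induction j rule: dec_induct)
  case (step n)
  then show ?case using assms(1) unfolding part_def by (metis Suc_le_lessD less_imp_le_nat order_trans)
qed simp

lemma part_bounds:
  assumes "part a b \<delta> N \<tau>" "i \<le> N"
  shows "a \<le> \<tau> i" "\<tau> i \<le> b"
  using part_le[OF assms(1), of 0 i] part_le[OF assms(1), of i N] assms unfolding part_def by auto

lemma part_take: "part a b \<delta> N \<tau> \<Longrightarrow> m \<le> N \<Longrightarrow> part a (\<tau> m) \<delta> m \<tau>"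
  unfolding part_def by auto

text \<open>Quantifying over every function \<open>f\<close> of the two ends of a cell makes all
  sums over cells split at once, whatever their integrand.\<close>

lemma part_append:
  assumes "part a b \<delta> N \<tau>" "part b c \<delta> N' \<tau>'"
  obtains \<rho> where "part a c \<delta> (N + N') \<rho>"
    "\<And>f :: real \<Rightarrow> real \<Rightarrow> 'b::comm_monoid_add. (\<Sum>i<N + N'. f (\<rho> i) (\<rho> (Suc i))) =
       (\<Sum>i<N. f (\<tau> i) (\<tau> (Suc i))) + (\<Sum>i<N'. f (\<tau>' i) (\<tau>' (Suc i)))"
proof -
  define \<rho> where "\<rho> i = (if i < N then \<tau> i else \<tau>' (i - N))" for i
  have *: "\<rho> i = \<tau> i" if "i \<le> N" for i
    using that assms unfolding \<rho>_def part_def by auto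
  have **: "\<rho> (N + i) = \<tau>' i" for i unfolding \<rho>_def by auto
  have "part a c \<delta> (N + N') \<rho>" unfolding part_def
  proof (intro conjI allI impI)
    show "\<rho> 0 = a" using *[of 0] assms by (auto simp: part_def)
    show "\<rho> (N + N') = c" using ** assms by (auto simp: part_def)
    fix i assume i: "i < N + N'"
    have "\<rho> i \<le> \<rho> (Suc i) \<and> \<rho> (Suc i) - \<rho> i < \<delta>"
    proof (cases "i < N")
      case True then show ?thesis using *[of i] *[of "Suc i"] assms by (auto simp: part_def)
    next
      case False
      then obtain k where "i = N + k" "k < N'" using i by (metis add_less_cancel_left le_Suc_ex not_less)
      then show ?thesis using **[of k] **[of "Suc k"] assms by (auto simp: part_def)
    qed
    then show "\<rho> i \<le> \<rho> (Suc i)" "\<rho> (Suc i) - \<rho> i < \<delta>" by auto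
  qed
  moreover have "(\<Sum>i<N + N'. f (\<rho> i) (\<rho> (Suc i))) =
       (\<Sum>i<N. f (\<tau> i) (\<tau> (Suc i))) + (\<Sum>i<N'. f (\<tau>' i) (\<tau>' (Suc i)))" for f :: "real \<Rightarrow> real \<Rightarrow> 'b"
  proof -
    have "(\<Sum>i<N + k. f (\<rho> i) (\<rho> (Suc i))) =
       (\<Sum>i<N. f (\<tau> i) (\<tau> (Suc i))) + (\<Sum>i<k. f (\<tau>' i) (\<tau>' (Suc i)))" for k
    proof (induction k)
      case 0
      show ?case using * by (auto intro!: sum.cong)
    next
      case (Suc k)
      then show ?case using **[of k] **[of "Suc k"] by (simp add: add.assoc)
    qed
    then show ?thesis .
  qed
  ultimately show ?thesis by (rule that)
qed

section \<open>Uniform partitions and refinements\<close>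

definition unif :: "real \<Rightarrow> real \<Rightarrow> nat \<Rightarrow> nat \<Rightarrow> real" where
  "unif a b n j = a + (real j / real n) * (b - a)"

lemma part_unif:
  assumes "a \<le> b" "0 < n" "(b - a) / n < \<delta>"
  shows "part a b \<delta> n (unif a b n)"
proof -
  have step: "unif a b n (Suc i) - unif a b n i = (b - a) / n" for i
    unfolding unif_def using assms(2) by (simp add: field_simps)
  have "unif a b n i \<le> unif a b n (Suc i) \<and> unif a b n (Suc i) - unif a b n i < \<delta>" for i
  proof -
    have "0 \<le> (b - a) / n" using assms by simp
    then show ?thesis using step[of i] assms(3) by linarith
  qed
  then show ?thesis using assms(2) unfolding part_def by (simp add: unif_def)
qed

text \<open>Every large number of pieces works, so that a single number can later serve all cells of
  a given partition.\<close>

lemma part_exists: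
  assumes "a \<le> b" "0 < \<delta>"
  obtains N where "0 < N" "\<And>n. N \<le> n \<Longrightarrow> part a b \<delta> n (unif a b n)"
proof -
  obtain N :: nat where N: "(b - a) / \<delta> < real N" using reals_Archimedean2 by blast
  have N0: "0 < Suc N" by simp
  have "part a b \<delta> n (unif a b n)" if "Suc N \<le> n" for n
  proof (rule part_unif)
    have "(b - a) / \<delta> < real n" using N that by simp
    then show "(b - a) / n < \<delta>" using that assms(2) by (simp add: field_simps)
  qed (use assms that in auto)
  with N0 show ?thesis by (rule that)
qed

text \<open>Cell \<open>i\<close> of \<open>\<tau>\<close> is cut into the cells \<open>i * n, \<dots>, i * n + n - 1\<close> of the refinement.\<close>

definition refine :: "(nat \<Rightarrow> real) \<Rightarrow> nat \<Rightarrow> nat \<Rightarrow> real" where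
  "refine \<tau> n k = unif (\<tau> (k div n)) (\<tau> (Suc (k div n))) n (k mod n)"

text \<open>The value \<open>j = n\<close> is included: division sends this index to the next cell,
  whose left end is the right end of cell \<open>i\<close>.\<close>

lemma refine_cell:
  assumes "0 < n" "j \<le> n"
  shows "refine \<tau> n (i * n + j) = unif (\<tau> i) (\<tau> (Suc i)) n j"
proof (cases "j = n")
  case True
  have "i * n + n = (Suc i) * n" by simp
  then show ?thesis using assms True by (simp add: refine_def unif_def del: mult_Suc)
next
  case False
  then show ?thesis using assms by (simp add: refine_def)
qed

lemma part_refine:
  assumes "part a b \<delta> N \<tau>" "0 < n"
  shows "part a b \<delta> (N * n) (refine \<tau> n)"
    and "k < N * n \<Longrightarrow> \<tau> (k div n) \<le> refine \<tau> n k \<and> refine \<tau> n k \<le> \<tau> (Suc (k div n))"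
proof -
  have cell: "part (\<tau> i) (\<tau> (Suc i)) \<delta> n (unif (\<tau> i) (\<tau> (Suc i)) n)" if "i < N" for i
  proof (rule part_unif)
    have *: "\<tau> i \<le> \<tau> (Suc i)" "\<tau> (Suc i) - \<tau> i < \<delta>" using assms that by (auto simp: part_def)
    show "\<tau> i \<le> \<tau> (Suc i)" by fact
    have "(\<tau> (Suc i) - \<tau> i) / real n \<le> (\<tau> (Suc i) - \<tau> i) / 1"
      by (rule divide_left_mono) (use * assms(2) in auto)
    then show "(\<tau> (Suc i) - \<tau> i) / real n < \<delta>" using *(2) by (simp only: div_by_1)
  qed fact
  have dm: "k = (k div n) * n + k mod n" "k mod n < n" for k using assms(2) by auto
  show "part a b \<delta> (N * n) (refine \<tau> n)" unfolding part_def
  proof (intro conjI allI impI)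
    show "refine \<tau> n 0 = a" using assms by (auto simp: refine_def unif_def part_def)
    show "refine \<tau> n (N * n) = b" using assms by (auto simp: refine_def unif_def part_def)
    fix k assume "k < N * n"
    then have i: "k div n < N" by (simp add: less_mult_imp_div_less)
    have 1: "refine \<tau> n k = unif (\<tau> (k div n)) (\<tau> (Suc (k div n))) n (k mod n)"
      by (simp add: refine_def)
    have 2: "refine \<tau> n (Suc k) = unif (\<tau> (k div n)) (\<tau> (Suc (k div n))) n (Suc (k mod n))"
      using refine_cell[OF assms(2), of "Suc (k mod n)" \<tau> "k div n"] dm[of k]
      by (metis Suc_leI add_Suc_right)
    show "refine \<tau> n k \<le> refine \<tau> n (Suc k)" "refine \<tau> n (Suc k) - refine \<tau> n k < \<delta>"
      using cell[OF i] dm(2)[of k] unfolding 1 2 part_def by auto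
  qed
  assume "k < N * n"
  then have i: "k div n < N" by (simp add: less_mult_imp_div_less)
  then show "\<tau> (k div n) \<le> refine \<tau> n k \<and> refine \<tau> n k \<le> \<tau> (Suc (k div n))"
    using part_bounds[OF cell[OF i], of "k mod n"] dm(2)[of k] by (auto simp: refine_def)
qed

lemma sum_refine:
  fixes f :: "real \<Rightarrow> real \<Rightarrow> 'b::comm_monoid_add"
  assumes "0 < n"
  shows "(\<Sum>k\<in>{i * n ..< i * n + n}. f (refine \<tau> n k) (refine \<tau> n (Suc k))) =
    (\<Sum>j<n. f (unif (\<tau> i) (\<tau> (Suc i)) n j) (unif (\<tau> i) (\<tau> (Suc i)) n (Suc j)))"
proof -
  have "(\<Sum>k\<in>{i * n ..< i * n + n}. f (refine \<tau> n k) (refine \<tau> n (Suc k))) =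
     (\<Sum>j\<in>{0..<n}. f (refine \<tau> n (j + i * n)) (refine \<tau> n (Suc (j + i * n))))"
    using sum.shift_bounds_nat_ivl[of "\<lambda>k. f (refine \<tau> n k) (refine \<tau> n (Suc k))" 0 "i * n" n]
    by (simp add: add.commute)
  also have "\<dots> = (\<Sum>j<n. f (unif (\<tau> i) (\<tau> (Suc i)) n j) (unif (\<tau> i) (\<tau> (Suc i)) n (Suc j)))"
    unfolding lessThan_atLeast0
  proof (rule sum.cong)
    fix j assume "j \<in> {0..<n}"
    then show "f (refine \<tau> n (j + i * n)) (refine \<tau> n (Suc (j + i * n))) =
       f (unif (\<tau> i) (\<tau> (Suc i)) n j) (unif (\<tau> i) (\<tau> (Suc i)) n (Suc j))"
      using refine_cell[OF assms, of j \<tau> i] refine_cell[OF assms, of "Suc j" \<tau> i] by (simp add: add.commute)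
  qed simp
  finally show ?thesis .
qed

section \<open>Martingale sums\<close>

abbreviation mid :: "(real \<Rightarrow> 'a \<Rightarrow> real) \<Rightarrow> (nat \<Rightarrow> real) \<Rightarrow> nat \<Rightarrow> 'a \<Rightarrow> real" where
  "mid X \<tau> k w \<equiv> (X (\<tau> k) w + X (\<tau> (Suc k)) w) / 2"

abbreviation incr :: "(real \<Rightarrow> 'a \<Rightarrow> 'b) \<Rightarrow> (nat \<Rightarrow> real) \<Rightarrow> nat \<Rightarrow> 'a \<Rightarrow> 'b::minus" where
  "incr X \<tau> k w \<equiv> X (\<tau> (Suc k)) w - X (\<tau> k) w"

locale brownian = prob_space P for P :: "'a measure" +
  fixes F :: "real \<Rightarrow> 'a measure" and W :: "real \<Rightarrow> 'a \<Rightarrow> real"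
  assumes basis: "stochastic_basis P F" and bm: "brownian_motion P F W"
begin

lemma subalg: "0 \<le> t \<Longrightarrow> subalgebra P (F t)"
  using basis by (auto simp: stochastic_basis_def)

lemma F_measurable:
  "0 \<le> t \<Longrightarrow> X \<in> measurable (F t) N \<Longrightarrow> X \<in> measurable P N"
  using measurable_from_subalg subalg by blast

lemma F_mono:
  assumes "0 \<le> s" "s \<le> t" "X \<in> measurable (F s) N"
  shows "X \<in> measurable (F t) N"
proof -
  have "sets (F s) \<subseteq> sets (F t)" using basis assms by (auto simp: stochastic_basis_def)
  moreover have "space (F s) = space (F t)" using subalg[of s] subalg[of t] assms by (auto simp: subalgebra_def)
  ultimately show ?thesis using assms(3) unfolding measurable_def by auto
qed

lemma W_measurable: "0 \<le> t \<Longrightarrow> W t \<in> borel_measurable (F t)"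
  using bm by (auto simp: brownian_motion_def adapted_def)

lemma increment_indep:
  assumes "0 \<le> s" "s < t" "X \<in> borel_measurable (F s)"
  shows "indep_var borel X borel (\<lambda>w. W t w - W s w)"
  unfolding indep_var_eq
proof (intro conjI)
  show "X \<in> borel_measurable P" using assms F_measurable by blast
  show W: "(\<lambda>w. W t w - W s w) \<in> borel_measurable P"
    using assms F_measurable[OF _ W_measurable, of t] F_measurable[OF _ W_measurable, of s] by auto
  have sp: "space (F s) = space P" using subalg[OF assms(1)] by (auto simp: subalgebra_def)
  let ?B = "{(\<lambda>w. W t w - W s w) -` B \<inter> space P | B. B \<in> sets borel}"
  have ind: "indep_set (sets (F s)) ?B" using bm assms by (auto simp: brownian_motion_def)
  have A: "sigma_sets (space P) {X -` A \<inter> space P | A. A \<in> sets borel} \<subseteq> sets (F s)"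
    using sets.sigma_sets_subset[of "{X -` A \<inter> space P | A. A \<in> sets borel}" "F s"] assms(3)
    by (auto simp: sp measurable_def)
  \<comment> \<open>The preimages of all Borel sets already form a sigma-algebra, so the
    independence assumed for this class is independence from the generated sigma-algebra.\<close>
  have B: "sigma_sets (space P) ?B \<subseteq> ?B"
  proof -
    let ?V = "vimage_algebra (space P) (\<lambda>w. W t w - W s w) (borel :: real measure)"
    have "sets ?V = ?B" by (rule sets_vimage_algebra2) auto
    then show ?thesis using sets.sigma_sets_eq[of ?V] by simp
  qed
  show "indep_set (sigma_sets (space P) {X -` A \<inter> space P | A. A \<in> sets borel}) (sigma_sets (space P) ?B)"
    using ind unfolding indep_set_def
    by (rule indep_sets_mono_sets) (use A B in \<open>auto split: bool.split\<close>)
qed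

text \<open>The case \<open>s = t\<close> is separate because the normal law is assumed only for
  \<open>s < t\<close>, while partitions may repeat points.\<close>

lemma increment_moments_conj:
  assumes "0 \<le> s" "s \<le> t"
  shows "integrable P (\<lambda>w. W t w - W s w) \<and>
    expectation (\<lambda>w. W t w - W s w) = 0 \<and>
    integrable P (\<lambda>w. (W t w - W s w)\<^sup>2) \<and>
    expectation (\<lambda>w. (W t w - W s w)\<^sup>2) = t - s"
proof (cases "s = t")
  case False
  with assms have st: "s < t" by auto
  define D where "D w = W t w - W s w" for w
  have d: "distributed P lborel D (normal_density 0 (sqrt (t - s)))"
    using bm assms st unfolding brownian_motion_def D_def by auto
  have pos: "0 < sqrt (t - s)" using st by simp
  have 1: "integrable P D"
    using distributed_integrable[OF d, of "\<lambda>x. x"] integrable_normal_moment[OF pos, of 0 1] by simp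
  have 2: "expectation D = 0" by (rule normal_distributed_expectation[OF pos d])
  have 3: "integrable P (\<lambda>w. (D w)\<^sup>2)"
    using distributed_integrable[OF d, of "\<lambda>x. x\<^sup>2"] integrable_normal_moment[OF pos, of 0 2] by simp
  have 4: "expectation (\<lambda>w. (D w)\<^sup>2) = t - s"
    using normal_distributed_variance[OF pos d] st by (simp add: 2)
  show ?thesis using 1 2 3 4 unfolding D_def by simp
qed simp

lemmas increment_moments =
  increment_moments_conj[THEN conjunct1]
  increment_moments_conj[THEN conjunct2, THEN conjunct1]
  increment_moments_conj[THEN conjunct2, THEN conjunct2, THEN conjunct1]
  increment_moments_conj[THEN conjunct2, THEN conjunct2, THEN conjunct2]

lemma increment_times_conj:
  fixes X :: "'a \<Rightarrow> real"
  assumes "0 \<le> s" "s \<le> t" "X \<in> borel_measurable (F s)" "integrable P X"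
  shows "integrable P (\<lambda>w. X w * (W t w - W s w)) \<and>
    expectation (\<lambda>w. X w * (W t w - W s w)) = 0 \<and>
    integrable P (\<lambda>w. X w * (W t w - W s w)\<^sup>2) \<and>
    expectation (\<lambda>w. X w * (W t w - W s w)\<^sup>2) = expectation X * (t - s)"
proof (cases "s = t")
  case False
  with assms have st: "s < t" by auto
  have i: "indep_var borel X borel (\<lambda>w. W t w - W s w)" by (rule increment_indep[OF assms(1) st assms(3)])
  have i2: "indep_var borel X borel (\<lambda>w. (W t w - W s w)\<^sup>2)"
    using indep_var_compose[OF i, of "\<lambda>x. x" borel "\<lambda>x. x\<^sup>2" borel] by (simp add: comp_def)
  note m = increment_moments[OF assms(1,2)]
  show ?thesis
    using indep_var_integrable[OF i assms(4) m(1)] indep_var_lebesgue_integral[OF i assms(4) m(1)]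
      indep_var_integrable[OF i2 assms(4) m(3)] indep_var_lebesgue_integral[OF i2 assms(4) m(3)] m
    by simp
qed simp

lemmas increment_times =
  increment_times_conj[THEN conjunct1]
  increment_times_conj[THEN conjunct2, THEN conjunct1]
  increment_times_conj[THEN conjunct2, THEN conjunct2, THEN conjunct1]
  increment_times_conj[THEN conjunct2, THEN conjunct2, THEN conjunct2]

text \<open>Adding one cell, the cross term has mean zero because \<open>S n\<close> and
  \<open>\<theta> n\<close> are known at its left end; for this the induction carries the
  measurability of \<open>S n\<close>. The bounds \<open>c k\<close> may vary with \<open>k\<close>,
  so a sum over a block of cells is covered by taking \<open>c k = 0\<close> elsewhere.\<close>

lemma martingale_sum_L2:
  fixes \<theta> :: "nat \<Rightarrow> 'a \<Rightarrow> real"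
  assumes tau: "part a b \<delta> N \<tau>" "0 \<le> a"
    and meas: "\<And>k. k < N \<Longrightarrow> \<theta> k \<in> borel_measurable (F (\<tau> k))"
    and bound: "\<And>k w. k < N \<Longrightarrow> \<bar>\<theta> k w\<bar> \<le> c k"
  defines "S n w \<equiv> \<Sum>k<n. \<theta> k w * incr W \<tau> k w"
  assumes "n \<le> N"
  shows "S n \<in> borel_measurable (F (\<tau> n)) \<and> integrable P (\<lambda>w. (S n w)\<^sup>2) \<and>
    expectation (\<lambda>w. (S n w)\<^sup>2) \<le> (\<Sum>k<n. (c k)\<^sup>2 * (\<tau> (Suc k) - \<tau> k))"
  using \<open>n \<le> N\<close>
proof (induction n)
  case 0
  then show ?case by (simp add: S_def)
next
  case (Suc n)
  then have n: "n < N" and mS: "S n \<in> borel_measurable (F (\<tau> n))" and iS2: "integrable P (\<lambda>w. (S n w)\<^sup>2)"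
    and eS2: "expectation (\<lambda>w. (S n w)\<^sup>2) \<le> (\<Sum>k<n. (c k)\<^sup>2 * (\<tau> (Suc k) - \<tau> k))" by auto
  have st: "0 \<le> \<tau> n" "\<tau> n \<le> \<tau> (Suc n)" "0 \<le> \<tau> (Suc n)"
    using part_bounds[OF tau(1), of n] part_bounds[OF tau(1), of "Suc n"] tau n by (auto simp: part_def)
  define D where "D w = incr W \<tau> n w" for w
  have m\<theta>: "\<theta> n \<in> borel_measurable (F (\<tau> n))" using meas n by auto
  have [measurable]: "S n \<in> borel_measurable P" "\<theta> n \<in> borel_measurable P"
    using F_measurable[OF st(1)] mS m\<theta> by auto
  have eq: "S (Suc n) w = S n w + \<theta> n w * D w" for w by (simp add: S_def D_def)
  have mD: "D \<in> borel_measurable (F (\<tau> (Suc n)))"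
    unfolding D_def using W_measurable[OF st(3)] F_mono[OF st(1,2) W_measurable[OF st(1)]] by measurable
  have "S (Suc n) \<in> borel_measurable (F (\<tau> (Suc n)))"
    unfolding eq[abs_def] using F_mono[OF st(1,2) mS] F_mono[OF st(1,2) m\<theta>] mD by measurable
  moreover
  \<comment> \<open>The function that dominates the cross factor: the product of \<open>S n\<close>
    and \<open>\<theta> n\<close> is at most the sum of their squares.\<close>
  have "integrable P (\<lambda>w. (S n w)\<^sup>2 + (c n)\<^sup>2)" using iS2 by simp
  then have iX: "integrable P (\<lambda>w. S n w * \<theta> n w)"
  proof (rule Bochner_Integration.integrable_bound)
    show "AE w in P. norm (S n w * \<theta> n w) \<le> norm ((S n w)\<^sup>2 + (c n)\<^sup>2)"
    proof (rule AE_I2)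
      fix w
      have c: "(\<theta> n w)\<^sup>2 \<le> (c n)\<^sup>2" using bound[OF n, of w] by (simp add: power2_le_iff_abs_le order_trans[OF abs_ge_zero bound[OF n]])
      have "0 \<le> (\<bar>S n w\<bar> - \<bar>\<theta> n w\<bar>)\<^sup>2" by simp
      then have "2 * (\<bar>S n w\<bar> * \<bar>\<theta> n w\<bar>) \<le> (S n w)\<^sup>2 + (\<theta> n w)\<^sup>2" by (simp add: power2_diff)
      then have "\<bar>S n w\<bar> * \<bar>\<theta> n w\<bar> \<le> (S n w)\<^sup>2 + (\<theta> n w)\<^sup>2"
        using mult_nonneg_nonneg[of "\<bar>S n w\<bar>" "\<bar>\<theta> n w\<bar>"] by linarith
      with c show "norm (S n w * \<theta> n w) \<le> norm ((S n w)\<^sup>2 + (c n)\<^sup>2)" by (simp add: abs_mult)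
    qed
  qed measurable
  have mX: "(\<lambda>w. S n w * \<theta> n w) \<in> borel_measurable (F (\<tau> n))" using mS m\<theta> by measurable
  have m\<theta>2: "(\<lambda>w. (\<theta> n w)\<^sup>2) \<in> borel_measurable (F (\<tau> n))" using m\<theta> by measurable
  have c2: "(\<theta> n w)\<^sup>2 \<le> (c n)\<^sup>2" for w
    using bound[OF n, of w] by (simp add: power2_le_iff_abs_le order_trans[OF abs_ge_zero bound[OF n]])
  have i\<theta>2: "integrable P (\<lambda>w. (\<theta> n w)\<^sup>2)"
    by (rule integrable_const_bound[of _ "(c n)\<^sup>2"]) (use c2 in auto)
  note X = increment_times[OF st(1,2) mX iX, folded D_def]
  note T = increment_times[OF st(1,2) m\<theta>2 i\<theta>2, folded D_def]
  have sq: "(S (Suc n) w)\<^sup>2 = (S n w)\<^sup>2 + 2 * (S n w * \<theta> n w * D w) + (\<theta> n w)\<^sup>2 * (D w)\<^sup>2" for w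
    unfolding eq by (simp add: power2_eq_square algebra_simps)
  have "integrable P (\<lambda>w. (S (Suc n) w)\<^sup>2)" unfolding sq using iS2 X(1) T(3) by simp
  moreover have "expectation (\<lambda>w. (S (Suc n) w)\<^sup>2) =
     expectation (\<lambda>w. (S n w)\<^sup>2) + expectation (\<lambda>w. (\<theta> n w)\<^sup>2) * (\<tau> (Suc n) - \<tau> n)"
    unfolding sq using iS2 X(1,2) T(3,4) by simp
  moreover have "expectation (\<lambda>w. (\<theta> n w)\<^sup>2) \<le> (c n)\<^sup>2"
    using integral_mono[OF i\<theta>2, of "\<lambda>_. (c n)\<^sup>2"] c2 prob_space by simp
  then have "expectation (\<lambda>w. (\<theta> n w)\<^sup>2) * (\<tau> (Suc n) - \<tau> n) \<le> (c n)\<^sup>2 * (\<tau> (Suc n) - \<tau> n)"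
    by (rule mult_right_mono) (use st in auto)
  ultimately show ?case using eS2 by simp
qed

lemma likely_Markov:
  fixes Y :: "'a \<Rightarrow> real"
  assumes "integrable P Y" "\<And>w. 0 \<le> Y w" "expectation Y \<le> v" "0 < c" "v < \<eta> * c"
  shows "likely P \<eta> (\<lambda>w. Y w < c)"
proof -
  have [measurable]: "Y \<in> borel_measurable P" using assms(1) by simp
  have "measure P {w\<in>space P. Y w \<ge> c} \<le> expectation Y / c"
    using integral_Markov_inequality_measure[OF assms(1), of "space P" c] assms by auto
  also have "\<dots> < \<eta>" using assms by (simp add: field_simps)
  finally show ?thesis unfolding likely_def
    by (intro bexI[of _ "{w\<in>space P. Y w \<ge> c}"]) (auto simp: not_le)
qed

lemma part_sum_length:
  assumes "part a b \<delta> N \<tau>"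
  shows "(\<Sum>k<N. \<tau> (Suc k) - \<tau> k) = b - a"
  using assms sum_lessThan_telescope[of \<tau> N] by (simp add: part_def)

text \<open>Markov's inequality for a sum whose expectation is \<open>b - a\<close>, hence a bound
  that is uniform over all partitions.\<close>

lemma likely_W_quadratic:
  assumes "part a b \<delta> N \<tau>" "0 \<le> a" "0 < C" "b - a < \<eta> * C"
  shows "likely P \<eta> (\<lambda>w. (\<Sum>k<N. (incr W \<tau> k w)\<^sup>2) < C)"
proof (rule likely_Markov)
  have st: "0 \<le> \<tau> k" "\<tau> k \<le> \<tau> (Suc k)" if "k < N" for k
    using part_bounds[OF assms(1), of k] assms that by (auto simp: part_def)
  show "integrable P (\<lambda>w. \<Sum>k<N. (incr W \<tau> k w)\<^sup>2)"
    using increment_moments(3) st by auto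
  have "expectation (\<lambda>w. \<Sum>k<N. (incr W \<tau> k w)\<^sup>2) = (\<Sum>k<N. \<tau> (Suc k) - \<tau> k)"
    using increment_moments(3,4) st by (subst Bochner_Integration.integral_sum) auto
  then show "expectation (\<lambda>w. \<Sum>k<N. (incr W \<tau> k w)\<^sup>2) \<le> b - a"
    using part_sum_length[OF assms(1)] by simp
qed (use assms in \<open>auto intro: sum_nonneg\<close>)

text \<open>The isometry bounds the expected square of the sum over one block by \<kappa> squared
  times the length of the block. The blocks are disjoint, so the lengths add up to at most
  \<open>b - a\<close>, and Markov's inequality costs \<open>\<eta>'\<close>.\<close>

lemma likely_block_sums:
  fixes \<theta> :: "nat \<Rightarrow> 'a \<Rightarrow> real" and B :: "nat \<Rightarrow> nat set"
  assumes tau: "part a b \<delta> N \<tau>" "0 \<le> a"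
    and meas: "\<And>k. k < N \<Longrightarrow> \<theta> k \<in> borel_measurable (F (\<tau> k))"
    and bound: "likely P \<eta> (\<lambda>w. \<forall>k<N. \<bar>\<theta> k w\<bar> \<le> \<kappa>)"
    and B: "\<And>i. i < m \<Longrightarrow> B i \<subseteq> {..<N}" "disjoint_family_on B {..<m}"
    and c: "0 < c" "\<kappa>\<^sup>2 * (b - a) < \<eta>' * c" "0 \<le> \<kappa>"
  shows "likely P (\<eta> + \<eta>')
    (\<lambda>w. (\<Sum>i<m. (\<Sum>k\<in>B i. \<theta> k w * incr W \<tau> k w)\<^sup>2) < c)"
proof -
  \<comment> \<open>The truncation depends on \<open>\<theta> k\<close> alone, so it stays adapted;
    on the likely event of the hypothesis it changes nothing.\<close>
  define \<theta>' where "\<theta>' k w = (if \<bar>\<theta> k w\<bar> \<le> \<kappa> then \<theta> k w else 0)" for k w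
  define D where "D k w = incr W \<tau> k w" for k w
  define Q where "Q i w = (\<Sum>k\<in>B i. \<theta>' k w * D k w)\<^sup>2" for i w
  have Q: "integrable P (Q i)" "expectation (Q i) \<le> (\<Sum>k\<in>B i. \<kappa>\<^sup>2 * (\<tau> (Suc k) - \<tau> k))" if "i < m" for i
  proof -
    define \<theta>'' where "\<theta>'' k w = (if k \<in> B i then \<theta>' k w else 0)" for k w
    define cc where "cc k = (if k \<in> B i then \<kappa> else 0)" for k
    have m: "\<theta>'' k \<in> borel_measurable (F (\<tau> k))" if "k < N" for k
      using meas[OF that] unfolding \<theta>''_def \<theta>'_def by (cases "k \<in> B i") simp_all
    have bd: "\<bar>\<theta>'' k w\<bar> \<le> cc k" for k w using c(3) by (auto simp: \<theta>''_def \<theta>'_def cc_def)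
    have s: "(\<Sum>k<N. \<theta>'' k w * D k w) = (\<Sum>k\<in>B i. \<theta>' k w * D k w)" for w
      by (rule sum.mono_neutral_cong_right) (use B(1)[OF that] in \<open>auto simp: \<theta>''_def\<close>)
    have s2: "(\<Sum>k<N. (cc k)\<^sup>2 * (\<tau> (Suc k) - \<tau> k)) = (\<Sum>k\<in>B i. \<kappa>\<^sup>2 * (\<tau> (Suc k) - \<tau> k))"
      by (rule sum.mono_neutral_cong_right) (use B(1)[OF that] in \<open>auto simp: cc_def\<close>)
    have "integrable P (\<lambda>w. (\<Sum>k<N. \<theta>'' k w * D k w)\<^sup>2) \<and>
      expectation (\<lambda>w. (\<Sum>k<N. \<theta>'' k w * D k w)\<^sup>2) \<le> (\<Sum>k<N. (cc k)\<^sup>2 * (\<tau> (Suc k) - \<tau> k))"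
      using martingale_sum_L2[OF tau m bd, of N] by (simp add: D_def)
    then show "integrable P (Q i)" "expectation (Q i) \<le> (\<Sum>k\<in>B i. \<kappa>\<^sup>2 * (\<tau> (Suc k) - \<tau> k))"
      unfolding s s2 Q_def by (auto simp: Q_def[abs_def])
  qed
  have "likely P \<eta>' (\<lambda>w. (\<Sum>i<m. Q i w) < c)"
  proof (rule likely_Markov)
    show "integrable P (\<lambda>w. \<Sum>i<m. Q i w)" using Q by auto
    have "expectation (\<lambda>w. \<Sum>i<m. Q i w) \<le> (\<Sum>i<m. \<Sum>k\<in>B i. \<kappa>\<^sup>2 * (\<tau> (Suc k) - \<tau> k))"
      using Q by (subst Bochner_Integration.integral_sum) (auto intro: sum_mono)
    also have "\<dots> = (\<Sum>k\<in>(\<Union>i<m. B i). \<kappa>\<^sup>2 * (\<tau> (Suc k) - \<tau> k))"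
      by (rule sum.UNION_disjoint[symmetric])
        (use B in \<open>auto simp: disjoint_family_on_def intro: finite_subset[OF B(1)]\<close>)
    also have "\<dots> \<le> (\<Sum>k<N. \<kappa>\<^sup>2 * (\<tau> (Suc k) - \<tau> k))"
      by (rule sum_mono2) (use B(1) tau in \<open>auto simp: part_def\<close>)
    also have "\<dots> = \<kappa>\<^sup>2 * (b - a)"
      using part_sum_length[OF tau(1)] by (simp add: sum_distrib_left[symmetric])
    finally show "expectation (\<lambda>w. \<Sum>i<m. Q i w) \<le> \<kappa>\<^sup>2 * (b - a)" .
  qed (use c in \<open>auto intro: sum_nonneg simp: Q_def\<close>)
  from bound this show ?thesis
  proof (rule likely_mp)
    fix w assume 1: "\<forall>k<N. \<bar>\<theta> k w\<bar> \<le> \<kappa>" and 2: "(\<Sum>i<m. Q i w) < c"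
    have "Q i w = (\<Sum>k\<in>B i. \<theta> k w * incr W \<tau> k w)\<^sup>2" if "i < m" for i
    proof -
      have "(\<Sum>k\<in>B i. \<theta>' k w * D k w) = (\<Sum>k\<in>B i. \<theta> k w * D k w)"
        by (rule sum.cong) (use 1 B(1)[OF that] in \<open>auto simp: \<theta>'_def\<close>)
      then show ?thesis by (simp add: Q_def D_def)
    qed
    with 2 show "(\<Sum>i<m. (\<Sum>k\<in>B i. \<theta> k w * incr W \<tau> k w)\<^sup>2) < c" by simp
  qed simp
qed

lemma likely_martingale_sum:
  fixes \<theta> :: "nat \<Rightarrow> 'a \<Rightarrow> real"
  assumes tau: "part a b \<delta> N \<tau>" "0 \<le> a"
    and meas: "\<And>k. k < N \<Longrightarrow> \<theta> k \<in> borel_measurable (F (\<tau> k))"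
    and bound: "likely P \<eta> (\<lambda>w. \<forall>k<N. \<bar>\<theta> k w\<bar> \<le> \<kappa>)"
    and c: "0 < e" "\<kappa>\<^sup>2 * (b - a) < \<eta>' * e\<^sup>2" "0 \<le> \<kappa>"
  shows "likely P (\<eta> + \<eta>') (\<lambda>w. \<bar>\<Sum>k<N. \<theta> k w * incr W \<tau> k w\<bar> < e)"
proof -
  have "likely P (\<eta> + \<eta>')
    (\<lambda>w. (\<Sum>i<1::nat. (\<Sum>k\<in>{..<N}. \<theta> k w * incr W \<tau> k w)\<^sup>2) < e\<^sup>2)"
    by (rule likely_block_sums[OF tau meas bound]) (use c in \<open>auto simp: disjoint_family_on_def\<close>)
  then show ?thesis
  proof (rule likely_mono)
    fix w assume "(\<Sum>i<1::nat. (\<Sum>k\<in>{..<N}. \<theta> k w * incr W \<tau> k w)\<^sup>2) < e\<^sup>2"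
    then show "\<bar>\<Sum>k<N. \<theta> k w * incr W \<tau> k w\<bar> < e"
      using power_less_imp_less_base[of "\<bar>\<Sum>k<N. \<theta> k w * incr W \<tau> k w\<bar>" 2 e] c(1) by simp
  qed simp
qed

end

section \<open>Associativity of the Stratonovich integral\<close>

lemma abel_summation:
  fixes c E :: "nat \<Rightarrow> real"
  assumes "E 0 = 0"
  shows "(\<Sum>i<N. c i * (E (Suc i) - E i)) = c N * E N - (\<Sum>i<N. E (Suc i) * (c (Suc i) - c i))"
  using assms by (induction N) (auto simp: algebra_simps)

text \<open>Abel summation moves the differences onto \<open>c\<close>, which changes only at
  indices in \<open>J\<close>: a jump costs at most \<open>2 * B * e\<close> and the boundary term
  \<open>B * e\<close>. Thus \<open>E\<close> must be small only at the end and just after the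
  jumps.\<close>

lemma sum_piecewise_constant_le:
  fixes c E :: "nat \<Rightarrow> real"
  assumes "E 0 = 0" and c: "\<And>i. i \<le> N \<Longrightarrow> \<bar>c i\<bar> \<le> B"
    and J: "J \<subseteq> {..<N}" "\<And>i. i < N \<Longrightarrow> i \<notin> J \<Longrightarrow> c (Suc i) = c i"
    and E: "\<bar>E N\<bar> \<le> e" "\<And>i. i \<in> J \<Longrightarrow> \<bar>E (Suc i)\<bar> \<le> e"
  shows "\<bar>\<Sum>i<N. c i * (E (Suc i) - E i)\<bar> \<le> B * e * (1 + 2 * real (card J))"
proof -
  have B: "0 \<le> B" using c[of 0] by linarith
  have e: "0 \<le> e" using E(1) by linarith
  have "(\<Sum>i<N. E (Suc i) * (c (Suc i) - c i)) = (\<Sum>i\<in>J. E (Suc i) * (c (Suc i) - c i))"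
    by (rule sum.mono_neutral_right) (use J in auto)
  moreover have "\<bar>\<Sum>i\<in>J. E (Suc i) * (c (Suc i) - c i)\<bar> \<le> (\<Sum>i\<in>J. \<bar>E (Suc i) * (c (Suc i) - c i)\<bar>)"
    by (rule sum_abs)
  moreover have "\<dots> \<le> (\<Sum>i\<in>J. e * (2 * B))"
  proof (rule sum_mono)
    fix i assume i: "i \<in> J"
    then have "\<bar>c (Suc i) - c i\<bar> \<le> 2 * B" using c[of i] c[of "Suc i"] J(1) by fastforce
    then show "\<bar>E (Suc i) * (c (Suc i) - c i)\<bar> \<le> e * (2 * B)"
      unfolding abs_mult by (intro mult_mono E(2) i) (use e in auto)
  qed
  moreover have "\<bar>c N * E N\<bar> \<le> B * e" unfolding abs_mult by (intro mult_mono c E(1)) (use B in auto)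
  moreover have "(\<Sum>i\<in>J. e * (2 * B)) = 2 * (B * e * real (card J))" by simp
  moreover have "B * e * (1 + 2 * real (card J)) = B * e + 2 * (B * e * real (card J))" by (simp add: algebra_simps)
  ultimately show ?thesis
    unfolding abel_summation[of E, OF assms(1)] by linarith
qed

text \<open>The cells that cross a grid line are mapped injectively to the last grid line at or
  before their right end, which gives a count independent of the partition.\<close>

lemma card_grid_jumps:
  assumes "part 0 T \<delta> N \<tau>" "0 < h"
  shows "card {i. i < N \<and> \<lfloor>\<tau> (Suc i) / h\<rfloor> \<noteq> \<lfloor>\<tau> i / h\<rfloor>} \<le> nat \<lfloor>T / h\<rfloor>"
proof -
  let ?J = "{i. i < N \<and> \<lfloor>\<tau> (Suc i) / h\<rfloor> \<noteq> \<lfloor>\<tau> i / h\<rfloor>}"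
  define G where "G i = \<lfloor>\<tau> i / h\<rfloor>" for i
  have mono: "G i \<le> G j" if "i \<le> j" "j \<le> N" for i j
    unfolding G_def using part_le[OF assms(1) that] assms(2) by (intro floor_mono divide_right_mono) auto
  have lt: "G i < G (Suc i)" if "i \<in> ?J" for i using that mono[of i "Suc i"] by (auto simp: G_def)
  have G0: "G 0 = 0" using assms(1) by (simp add: G_def part_def)
  have GN: "G N = \<lfloor>T / h\<rfloor>" using assms(1) by (simp add: G_def part_def)
  have inj: "inj_on (\<lambda>i. G (Suc i)) ?J"
  proof (rule linorder_inj_onI)
    fix i j assume "i < j" "i \<in> ?J" "j \<in> ?J"
    then have "G (Suc i) \<le> G j" "G j < G (Suc j)" using mono[of "Suc i" j] lt[of j] by auto
    then show "G (Suc i) \<noteq> G (Suc j)" by simp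
  qed auto
  have "(\<lambda>i. G (Suc i)) ` ?J \<subseteq> {0<..\<lfloor>T / h\<rfloor>}"
  proof safe
    fix i assume i: "i < N" "\<lfloor>\<tau> (Suc i) / h\<rfloor> \<noteq> \<lfloor>\<tau> i / h\<rfloor>"
    then show "G (Suc i) \<in> {0<..\<lfloor>T / h\<rfloor>}"
      using lt[of i] mono[of 0 i] mono[of "Suc i" N] G0 GN by auto
  qed
  then have "card ((\<lambda>i. G (Suc i)) ` ?J) \<le> card {0<..\<lfloor>T / h\<rfloor>}" by (rule card_mono[rotated]) simp
  then show ?thesis by (simp add: card_image[OF inj])
qed

text \<open>Young's inequality. The weight \<open>l\<close> makes a bounded quadratic sum cheap when
  the other quadratic sum is small.\<close>

lemma abs_mult_le_weighted:
  fixes x y :: real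
  assumes "0 < l"
  shows "\<bar>x * y\<bar> \<le> l * x\<^sup>2 + y\<^sup>2 / l"
proof -
  have "0 \<le> (l * \<bar>x\<bar> - \<bar>y\<bar>)\<^sup>2 / l" using assms by simp
  also have "\<dots> = l * x\<^sup>2 + y\<^sup>2 / l - 2 * \<bar>x * y\<bar>"
    using assms by (simp add: power2_eq_square field_simps abs_mult)
  finally show ?thesis using abs_ge_zero[of "x * y"] by linarith
qed

lemma abs_mult_le_mean: "\<bar>x * y\<bar> \<le> (x\<^sup>2 + y\<^sup>2) / 2" for x y :: real
proof -
  have "0 \<le> (\<bar>x\<bar> - \<bar>y\<bar>)\<^sup>2" by simp
  then show ?thesis by (simp add: power2_diff abs_mult)
qed

text \<open>\<open>M\<close> is the martingale part of the integral of \<open>y\<close> against \<open>dw\<close> on a cell after freezing \<open>y\<close> at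
  the left endpoint, \<open>Q\<close> its bracket on a refinement, and \<open>\<beta>\<close> approximates \<open>b\<close> by a function
  with few jumps.\<close>

lemma associativity_defect_le:
  fixes b \<beta> y dw a M Q r E :: "nat \<Rightarrow> real"
  assumes E: "\<And>i. i < N \<Longrightarrow> E (Suc i) - E i = (y i + y (Suc i)) / 2 * dw i - a i"
    and dec: "\<And>i. i < N \<Longrightarrow> (y i + y (Suc i)) / 2 * dw i - a i = - M i + (y (Suc i) - y i) * dw i / 2 - Q i / 2 + r i"
    and b: "\<And>i. i < N \<Longrightarrow> \<bar>b i - \<beta> i\<bar> \<le> \<kappa>" "\<And>i. i < N \<Longrightarrow> \<bar>b (Suc i) - b i\<bar> \<le> \<kappa>" "0 \<le> \<kappa>"
    and qv: "(\<Sum>i<N. (b (Suc i) - b i)\<^sup>2) \<le> C" "(\<Sum>i<N. (y (Suc i) - y i)\<^sup>2) \<le> C" "(\<Sum>i<N. (dw i)\<^sup>2) \<le> C"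
    and Q: "(\<Sum>i<N. \<bar>Q i\<bar>) \<le> C" and M: "(\<Sum>i<N. (M i)\<^sup>2) \<le> m" "0 < l"
    and S: "\<bar>\<Sum>i<N. (b i - \<beta> i) * M i\<bar> \<le> e" "\<bar>\<Sum>i<N. \<beta> i * (E (Suc i) - E i)\<bar> \<le> e"
    and r: "(\<Sum>i<N. \<bar>r i\<bar>) \<le> C"
  shows "\<bar>(\<Sum>i<N. (b i + b (Suc i)) / 2 * a i) - (\<Sum>i<N. dw i * ((b i * y i + b (Suc i) * y (Suc i)) / 2))\<bar>
    \<le> 2 * e + (l * C + m / l) + 5 * \<kappa> * C"
proof -
  \<comment> \<open>The gap between the average of \<open>b\<close> on a cell and the step function:
    the left gap plus half an increment of \<open>b\<close>, hence at most
    \<open>2 * \<kappa>\<close>.\<close>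
  define c where "c i = (b i + b (Suc i)) / 2 - \<beta> i" for i
  define z where "z i = (y (Suc i) - y i) * dw i" for i
  have c: "\<bar>c i\<bar> \<le> 2 * \<kappa>" if "i < N" for i
  proof -
    have "c i = (b i - \<beta> i) + (b (Suc i) - b i) / 2" by (simp add: c_def field_simps)
    then show ?thesis using b(1)[OF that] b(2)[OF that] b(3) by (simp only: abs_le_iff) argo
  qed
  \<comment> \<open>An exact identity. The last term arises because the average of the products
    exceeds the product of the averages by a quarter of the product of the increments.\<close>
  have 1: "(b i + b (Suc i)) / 2 * a i - dw i * ((b i * y i + b (Suc i) * y (Suc i)) / 2) =
      - (\<beta> i * (E (Suc i) - E i)) + (b i - \<beta> i) * M i + (b (Suc i) - b i) * M i / 2
      - c i * (z i / 2 - Q i / 2 + r i) - (b (Suc i) - b i) * z i / 4" (is "?L = ?R") if "i < N" for i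
  proof -
    have "?L = - ((b i + b (Suc i)) / 2 * ((y i + y (Suc i)) / 2 * dw i - a i)) - (b (Suc i) - b i) * z i / 4"
      by (simp add: z_def field_simps)
    also have "(b i + b (Suc i)) / 2 * ((y i + y (Suc i)) / 2 * dw i - a i) =
      \<beta> i * (E (Suc i) - E i) + c i * (- M i + z i / 2 - Q i / 2 + r i)"
      unfolding E[OF that] dec[OF that, folded z_def] by (simp add: c_def algebra_simps)
    \<comment> \<open>\<open>c i * M i\<close> is split because \<open>b i - \<beta> i\<close> is
      known at the left end of the cell and suits the isometry, whereas the increment of
      \<open>b\<close> looks ahead and is left to Young's inequality.\<close>
    also have "c i * (- M i + z i / 2 - Q i / 2 + r i) =
       - ((b i - \<beta> i) * M i + (b (Suc i) - b i) * M i / 2) + c i * (z i / 2 - Q i / 2 + r i)"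
      by (simp add: c_def field_simps)
    finally show ?thesis by simp
  qed
  have "(\<Sum>i<N. (b i + b (Suc i)) / 2 * a i) - (\<Sum>i<N. dw i * ((b i * y i + b (Suc i) * y (Suc i)) / 2)) =
    - (\<Sum>i<N. \<beta> i * (E (Suc i) - E i)) + (\<Sum>i<N. (b i - \<beta> i) * M i) +
    ((\<Sum>i<N. (b (Suc i) - b i) * M i / 2) - (\<Sum>i<N. c i * (z i / 2 - Q i / 2 + r i)) - (\<Sum>i<N. (b (Suc i) - b i) * z i / 4))"
  proof -
    have "(\<Sum>i<N. (b i + b (Suc i)) / 2 * a i) - (\<Sum>i<N. dw i * ((b i * y i + b (Suc i) * y (Suc i)) / 2)) =
      (\<Sum>i<N. - (\<beta> i * (E (Suc i) - E i)) + (b i - \<beta> i) * M i + (b (Suc i) - b i) * M i / 2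
      - c i * (z i / 2 - Q i / 2 + r i) - (b (Suc i) - b i) * z i / 4)"
      unfolding sum_subtractf[symmetric] by (rule sum.cong) (use 1 in auto)
    then show ?thesis by (simp only: sum_subtractf sum.distrib sum_negf)
  qed
  moreover have "\<bar>\<Sum>i<N. (b (Suc i) - b i) * M i / 2\<bar> \<le> l * C + m / l"
  proof -
    have "\<bar>\<Sum>i<N. (b (Suc i) - b i) * M i / 2\<bar> \<le> (\<Sum>i<N. l * (b (Suc i) - b i)\<^sup>2 + (M i)\<^sup>2 / l)"
    proof (rule order_trans[OF sum_abs], rule sum_mono)
      fix i
      show "\<bar>(b (Suc i) - b i) * M i / 2\<bar> \<le> l * (b (Suc i) - b i)\<^sup>2 + (M i)\<^sup>2 / l"
        using abs_mult_le_weighted[OF M(2), of "b (Suc i) - b i" "M i"]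
          abs_ge_zero[of "(b (Suc i) - b i) * M i"] unfolding abs_divide by linarith
    qed
    also have "\<dots> = l * (\<Sum>i<N. (b (Suc i) - b i)\<^sup>2) + (\<Sum>i<N. (M i)\<^sup>2) / l"
      by (simp add: sum.distrib sum_distrib_left sum_divide_distrib)
    also have "\<dots> \<le> l * C + m / l"
      by (intro add_mono mult_left_mono divide_right_mono qv M(1)) (use M(2) in auto)
    finally show ?thesis .
  qed
  moreover have z: "(\<Sum>i<N. \<bar>z i\<bar>) \<le> C"
  proof -
    have "(\<Sum>i<N. \<bar>z i\<bar>) \<le> (\<Sum>i<N. ((y (Suc i) - y i)\<^sup>2 + (dw i)\<^sup>2) / 2)"
      unfolding z_def by (intro sum_mono abs_mult_le_mean)
    also have "\<dots> = ((\<Sum>i<N. (y (Suc i) - y i)\<^sup>2) + (\<Sum>i<N. (dw i)\<^sup>2)) / 2"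
      by (simp add: sum.distrib sum_divide_distrib add_divide_distrib)
    finally show ?thesis using qv by simp
  qed
  \<comment> \<open>The factor is at most \<open>2 * \<kappa>\<close>, and the brackets sum to at
    most \<open>C / 2 + C / 2 + C\<close>. So the residuals \<open>r\<close> need only be bounded in
    total, not small.\<close>
  moreover have "\<bar>\<Sum>i<N. c i * (z i / 2 - Q i / 2 + r i)\<bar> \<le> 4 * (\<kappa> * C)"
  proof -
    have "\<bar>\<Sum>i<N. c i * (z i / 2 - Q i / 2 + r i)\<bar> \<le> (\<Sum>i<N. (2 * \<kappa>) * (\<bar>z i\<bar> / 2 + \<bar>Q i\<bar> / 2 + \<bar>r i\<bar>))"
    proof (rule order_trans[OF sum_abs], rule sum_mono)
      fix i assume "i \<in> {..<N}"
      then show "\<bar>c i * (z i / 2 - Q i / 2 + r i)\<bar> \<le> (2 * \<kappa>) * (\<bar>z i\<bar> / 2 + \<bar>Q i\<bar> / 2 + \<bar>r i\<bar>)"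
        unfolding abs_mult by (intro mult_mono c) (use b(3) in auto)
    qed
    also have "\<dots> = (2 * \<kappa>) * ((\<Sum>i<N. \<bar>z i\<bar>) / 2 + (\<Sum>i<N. \<bar>Q i\<bar>) / 2 + (\<Sum>i<N. \<bar>r i\<bar>))"
      by (simp only: sum_distrib_left[symmetric] sum.distrib sum_divide_distrib)
    also have "\<dots> \<le> (2 * \<kappa>) * (C / 2 + C / 2 + C)"
      by (intro mult_left_mono add_mono divide_right_mono z Q r) (use b(3) in auto)
    finally show ?thesis by simp
  qed
  moreover have "\<bar>\<Sum>i<N. (b (Suc i) - b i) * z i / 4\<bar> \<le> \<kappa> * C"
  proof -
    have "\<bar>\<Sum>i<N. (b (Suc i) - b i) * z i / 4\<bar> \<le> (\<Sum>i<N. \<kappa> * \<bar>z i\<bar>)"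
    proof (rule order_trans[OF sum_abs], rule sum_mono)
      fix i assume "i \<in> {..<N}"
      then have "\<bar>b (Suc i) - b i\<bar> * \<bar>z i\<bar> \<le> \<kappa> * \<bar>z i\<bar>" by (intro mult_right_mono b) auto
      then show "\<bar>(b (Suc i) - b i) * z i / 4\<bar> \<le> \<kappa> * \<bar>z i\<bar>"
        using abs_ge_zero[of "(b (Suc i) - b i) * z i"] unfolding abs_divide abs_mult by linarith
    qed
    also have "\<dots> \<le> \<kappa> * C" using mult_left_mono[OF z b(3)] by (simp add: sum_distrib_left)
    finally show ?thesis .
  qed
  ultimately show ?thesis using S by (simp only: abs_le_iff) linarith
qed

section \<open>Integrands and limits of trapezoidal sums\<close>

context brownian
begin

text \<open>Only tightness of the quadratic sums is kept, because this passes from a vector-valued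
  process to its coordinates.\<close>

definition tame :: "(real \<Rightarrow> 'a \<Rightarrow> real) \<Rightarrow> bool" where
  "tame X \<longleftrightarrow> (\<forall>t\<ge>0. X t \<in> borel_measurable (F t)) \<and> (AE w in P. continuous_on {0..} (\<lambda>t. X t w)) \<and>
    (\<forall>T\<ge>0. \<forall>\<eta>>0. \<exists>C>0. \<exists>\<delta>>0. \<forall>N \<tau>. part 0 T \<delta> N \<tau> \<longrightarrow>
       likely P \<eta> (\<lambda>w. (\<Sum>i<N. (incr X \<tau> i w)\<^sup>2) \<le> C))"

definition ssum :: "(real \<Rightarrow> 'a \<Rightarrow> real) \<Rightarrow> nat \<Rightarrow> (nat \<Rightarrow> real) \<Rightarrow> 'a \<Rightarrow> real" where
  "ssum X N \<tau> w = (\<Sum>i<N. incr W \<tau> i w * (mid X \<tau> i w))"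

lemma stratonovich_sum_real: "stratonovich_sum W X (N, \<tau>) w = ssum X N \<tau> w"
  by (simp add: stratonovich_sum_def ssum_def)

text \<open>The mesh threshold may depend on \<open>t\<close>, so this is convergence at fixed times
  and says nothing about the paths of \<open>A\<close>.\<close>

definition ssum_limit :: "(real \<Rightarrow> 'a \<Rightarrow> real) \<Rightarrow> (real \<Rightarrow> 'a \<Rightarrow> real) \<Rightarrow> bool" where
  "ssum_limit X A \<longleftrightarrow> (\<forall>t\<ge>0. \<forall>e>0. \<forall>\<eta>>0. \<exists>\<delta>>0. \<forall>N \<tau>. part 0 t \<delta> N \<tau> \<longrightarrow>
     likely P \<eta> (\<lambda>w. \<bar>ssum X N \<tau> w - A t w\<bar> < e))"

text \<open>A partition of \<open>{s..t}\<close> is prefixed by one of \<open>{0..s}\<close> that is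
  fine enough for both endpoints; the two limits are then subtracted.\<close>

lemma ssum_limit_increment:
  assumes "ssum_limit X A" "0 \<le> s" "s \<le> t" "0 < e" "0 < \<eta>"
  shows "\<exists>\<delta>>0. \<forall>N \<tau>. part s t \<delta> N \<tau> \<longrightarrow>
     likely P \<eta> (\<lambda>w. \<bar>ssum X N \<tau> w - (A t w - A s w)\<bar> < e)"
proof -
  have "\<exists>\<delta>>0. \<forall>N \<tau>. part 0 u \<delta> N \<tau> \<longrightarrow> likely P (\<eta>/2) (\<lambda>w. \<bar>ssum X N \<tau> w - A u w\<bar> < e/2)" if "0 \<le> u" for u
    using assms(1,4,5) that unfolding ssum_limit_def by (meson half_gt_zero)
  from this[of s] this[of t] assms obtain d1 d2 where d: "0 < d1" "0 < d2"
    "\<And>N \<tau>. part 0 s d1 N \<tau> \<Longrightarrow> likely P (\<eta>/2) (\<lambda>w. \<bar>ssum X N \<tau> w - A s w\<bar> < e/2)"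
    "\<And>N \<tau>. part 0 t d2 N \<tau> \<Longrightarrow> likely P (\<eta>/2) (\<lambda>w. \<bar>ssum X N \<tau> w - A t w\<bar> < e/2)" by auto
  obtain n where "part 0 s (min d1 d2) n (unif 0 s n)" using part_exists[of 0 s "min d1 d2"] assms d by (metis min_less_iff_conj order_refl)
  then have n: "part 0 s d1 n (unif 0 s n)" "part 0 s d2 n (unif 0 s n)" by (auto elim: part_mono)
  have "likely P \<eta> (\<lambda>w. \<bar>ssum X N \<tau> w - (A t w - A s w)\<bar> < e)" if p: "part s t d2 N \<tau>" for N \<tau>
  proof -
    obtain \<rho> where \<rho>: "part 0 t d2 (n + N) \<rho>"
      "\<And>f :: real \<Rightarrow> real \<Rightarrow> real. (\<Sum>i<n + N. f (\<rho> i) (\<rho> (Suc i))) =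
       (\<Sum>i<n. f (unif 0 s n i) (unif 0 s n (Suc i))) + (\<Sum>i<N. f (\<tau> i) (\<tau> (Suc i)))"
      using part_append[OF n(2) p] by metis
    have eq: "ssum X (n + N) \<rho> w = ssum X n (unif 0 s n) w + ssum X N \<tau> w" for w
      unfolding ssum_def using \<rho>(2)[of "\<lambda>u v. (W v w - W u w) * ((X u w + X v w) / 2)"] .
    show ?thesis
    proof (rule likely_mp[OF d(3)[OF n(1)] d(4)[OF \<rho>(1)]])
      fix w assume "\<bar>ssum X n (unif 0 s n) w - A s w\<bar> < e/2" "\<bar>ssum X (n + N) \<rho> w - A t w\<bar> < e/2"
      then show "\<bar>ssum X N \<tau> w - (A t w - A s w)\<bar> < e" unfolding eq by linarith
    qed simp
  qed
  with d(2) show ?thesis by auto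
qed

text \<open>The threshold is uniform in \<open>m\<close>: complete the first \<open>m\<close> cells by a very fine partition of
  the remaining interval.\<close>

lemma ssum_limit_partial:
  assumes "ssum_limit X A" "0 < e" "0 < \<eta>" "0 \<le> T"
  shows "\<exists>\<delta>>0. \<forall>N \<tau>. part 0 T \<delta> N \<tau> \<longrightarrow> (\<forall>m\<le>N. likely P \<eta> (\<lambda>w. \<bar>ssum X m \<tau> w - A (\<tau> m) w\<bar> < e))"
proof -
  have "\<exists>\<delta>>0. \<forall>N \<tau>. part 0 T \<delta> N \<tau> \<longrightarrow> likely P (\<eta>/2) (\<lambda>w. \<bar>ssum X N \<tau> w - A T w\<bar> < e/2)"
    using assms unfolding ssum_limit_def by (meson half_gt_zero)
  then obtain d where d: "0 < d"
    "\<And>N \<tau>. part 0 T d N \<tau> \<Longrightarrow> likely P (\<eta>/2) (\<lambda>w. \<bar>ssum X N \<tau> w - A T w\<bar> < e/2)" by auto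
  have "likely P \<eta> (\<lambda>w. \<bar>ssum X m \<tau> w - A (\<tau> m) w\<bar> < e)" if p: "part 0 T d N \<tau>" and m: "m \<le> N" for N \<tau> m
  proof -
    have tm: "0 \<le> \<tau> m" "\<tau> m \<le> T" using part_bounds[OF p m] .
    obtain d' where d': "0 < d'" "\<And>N \<rho>. part (\<tau> m) T d' N \<rho> \<Longrightarrow>
        likely P (\<eta>/2) (\<lambda>w. \<bar>ssum X N \<rho> w - (A T w - A (\<tau> m) w)\<bar> < e/2)"
      using ssum_limit_increment[OF assms(1) tm, of "e/2" "\<eta>/2"] assms by auto
    obtain n where "part (\<tau> m) T (min d d') n (unif (\<tau> m) T n)"
      using part_exists[of "\<tau> m" T "min d d'"] tm d d' by (metis min_less_iff_conj order_refl)
    then have n: "part (\<tau> m) T d n (unif (\<tau> m) T n)" "part (\<tau> m) T d' n (unif (\<tau> m) T n)" by (auto elim: part_mono)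
    obtain \<rho> where \<rho>: "part 0 T d (m + n) \<rho>"
      "\<And>f :: real \<Rightarrow> real \<Rightarrow> real. (\<Sum>i<m + n. f (\<rho> i) (\<rho> (Suc i))) =
       (\<Sum>i<m. f (\<tau> i) (\<tau> (Suc i))) + (\<Sum>i<n. f (unif (\<tau> m) T n i) (unif (\<tau> m) T n (Suc i)))"
      using part_append[OF part_take[OF p m] n(1)] by metis
    have eq: "ssum X (m + n) \<rho> w = ssum X m \<tau> w + ssum X n (unif (\<tau> m) T n) w" for w
      unfolding ssum_def using \<rho>(2)[of "\<lambda>u v. (W v w - W u w) * ((X u w + X v w) / 2)"] .
    show ?thesis
    proof (rule likely_mp[OF d'(2)[OF n(2)] d(2)[OF \<rho>(1)]])
      fix w assume "\<bar>ssum X n (unif (\<tau> m) T n) w - (A T w - A (\<tau> m) w)\<bar> < e/2" "\<bar>ssum X (m + n) \<rho> w - A T w\<bar> < e/2"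
      then show "\<bar>ssum X m \<tau> w - A (\<tau> m) w\<bar> < e" unfolding eq by linarith
    qed simp
  qed
  with d(1) show ?thesis by auto
qed

text \<open>\<open>refine\<close> cuts all cells into the same number of pieces, so one
  \<open>n\<close> must exceed the thresholds of all cells; one more than their sum does, and is
  positive.\<close>

lemma common_cell_refinement:
  assumes "ssum_limit X A" "part 0 T \<delta> N \<tau>" "0 < e" "0 < \<eta>"
  obtains n where "0 < n" "\<And>i. i < N \<Longrightarrow> likely P \<eta>
     (\<lambda>w. \<bar>ssum X n (unif (\<tau> i) (\<tau> (Suc i)) n) w - (incr A \<tau> i w)\<bar> < e)"
proof -
  have "\<exists>m. \<forall>n\<ge>m. likely P \<eta>
     (\<lambda>w. \<bar>ssum X n (unif (\<tau> i) (\<tau> (Suc i)) n) w - (incr A \<tau> i w)\<bar> < e)" if "i < N" for i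
  proof -
    have t: "0 \<le> \<tau> i" "\<tau> i \<le> \<tau> (Suc i)" using part_bounds[OF assms(2), of i] assms(2) that by (auto simp: part_def)
    obtain d' where d': "0 < d'" "\<And>N \<rho>. part (\<tau> i) (\<tau> (Suc i)) d' N \<rho> \<Longrightarrow>
        likely P \<eta> (\<lambda>w. \<bar>ssum X N \<rho> w - (incr A \<tau> i w)\<bar> < e)"
      using ssum_limit_increment[OF assms(1) t assms(3,4)] by auto
    obtain m where "\<And>n. m \<le> n \<Longrightarrow> part (\<tau> i) (\<tau> (Suc i)) d' n (unif (\<tau> i) (\<tau> (Suc i)) n)"
      using part_exists[OF t(2) d'(1)] by metis
    with d' show ?thesis by blast
  qed
  then obtain m where m: "\<And>i n. i < N \<Longrightarrow> m i \<le> n \<Longrightarrow> likely P \<eta>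
     (\<lambda>w. \<bar>ssum X n (unif (\<tau> i) (\<tau> (Suc i)) n) w - (incr A \<tau> i w)\<bar> < e)" by metis
  have "m i \<le> Suc (\<Sum>i<N. m i)" if "i < N" for i
    using member_le_sum[of i "{..<N}" m] that by simp
  with m show ?thesis by (intro that[of "Suc (\<Sum>i<N. m i)"]) auto
qed

end

lemma small_square:
  fixes T :: real
  assumes "0 < x" "0 < y"
  shows "\<exists>\<kappa>>0. \<kappa> \<le> x \<and> \<kappa>\<^sup>2 * T < y"
proof -
  have "((\<lambda>\<kappa>. \<kappa>\<^sup>2 * T) \<longlongrightarrow> 0) (at_right (0::real))"
    by (rule tendsto_eq_intros refl | simp)+
  from order_tendstoD(2)[OF this assms(2)] have "\<forall>\<^sub>F \<kappa> in at_right 0. \<kappa>\<^sup>2 * T < y" .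
  moreover have "\<forall>\<^sub>F \<kappa> in at_right 0. 0 < \<kappa> \<and> \<kappa> \<le> x"
    using eventually_at_right[OF assms(1)] assms(1) by (auto intro!: exI[of _ x])
  ultimately have "\<forall>\<^sub>F \<kappa> in at_right 0. 0 < \<kappa> \<and> \<kappa> \<le> x \<and> \<kappa>\<^sup>2 * T < y"
    by eventually_elim auto
  from eventually_happens[OF this] show ?thesis by auto
qed

context brownian
begin

lemma sum_refined_cell:
  assumes "0 < n"
  shows "(\<Sum>k\<in>{i * n..<i * n + n}. W (refine \<tau> n (Suc k)) w - W (refine \<tau> n k) w) = incr W \<tau> i w"
    and "(\<Sum>k\<in>{i * n..<i * n + n}. (W (refine \<tau> n (Suc k)) w - W (refine \<tau> n k) w) *
       ((X (refine \<tau> n k) w + X (refine \<tau> n (Suc k)) w) / 2)) = ssum X n (unif (\<tau> i) (\<tau> (Suc i)) n) w"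
proof -
  have "(\<Sum>k\<in>{i * n..<i * n + n}. W (refine \<tau> n (Suc k)) w - W (refine \<tau> n k) w) =
    (\<Sum>j<n. W (unif (\<tau> i) (\<tau> (Suc i)) n (Suc j)) w - W (unif (\<tau> i) (\<tau> (Suc i)) n j) w)"
    by (rule sum_refine[OF assms, of "\<lambda>u v. W v w - W u w"])
  also have "\<dots> = W (unif (\<tau> i) (\<tau> (Suc i)) n n) w - W (unif (\<tau> i) (\<tau> (Suc i)) n 0) w"
    by (rule sum_lessThan_telescope)
  finally show "(\<Sum>k\<in>{i * n..<i * n + n}. W (refine \<tau> n (Suc k)) w - W (refine \<tau> n k) w) = incr W \<tau> i w"
    using assms by (simp add: unif_def)
  show "(\<Sum>k\<in>{i * n..<i * n + n}. (W (refine \<tau> n (Suc k)) w - W (refine \<tau> n k) w) *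
       ((X (refine \<tau> n k) w + X (refine \<tau> n (Suc k)) w) / 2)) = ssum X n (unif (\<tau> i) (\<tau> (Suc i)) n) w"
    unfolding ssum_def by (rule sum_refine[OF assms, of "\<lambda>u v. (W v w - W u w) * ((X u w + X v w) / 2)"])
qed

text \<open>The order of the choices is the point. The bounds, the oscillation \<kappa>, the grid
  width \<open>h1\<close> and with it the number of jumps of the step function are fixed before the
  partition. Only then is a refinement chosen, depending on the partition, on which the increments
  of \<open>A\<close> are close to their sums.\<close>

lemma stratonovich_associative:
  assumes b: "tame b" and Y: "tame Y" and A: "ssum_limit Y A" and T: "0 \<le> T" and e: "0 < e" and \<eta>: "0 < \<eta>"
  shows "\<exists>\<delta>>0. \<forall>N \<tau>. part 0 T \<delta> N \<tau> \<longrightarrow> likely P \<eta> (\<lambda>w.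
    \<bar>(\<Sum>i<N. mid b \<tau> i w * incr A \<tau> i w)
      - ssum (\<lambda>t w. b t w * Y t w) N \<tau> w\<bar> < e)"
proof -
  \<comment> \<open>The exceptional events collected below cost \<open>15 * \<zeta>\<close>
    altogether.\<close>
  define \<zeta> where "\<zeta> = \<eta> / 20"
  have \<zeta>: "0 < \<zeta>" using \<eta> by (simp add: \<zeta>_def)
  have fb: "b t \<in> borel_measurable (F t)" and fY: "Y t \<in> borel_measurable (F t)" if "0 \<le> t" for t
    using b Y that by (simp_all add: tame_def)
  have mb: "b t \<in> borel_measurable P" and mY: "Y t \<in> borel_measurable P" if "0 \<le> t" for t
    using F_measurable[OF that fb[OF that]] F_measurable[OF that fY[OF that]] by simp_all
  have cb: "AE w in P. continuous_on {0..} (\<lambda>t. b t w)" and cY: "AE w in P. continuous_on {0..} (\<lambda>t. Y t w)"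
    using b Y by (simp_all add: tame_def)
  obtain B where B: "0 < B" "likely P \<zeta> (\<lambda>w. \<forall>t\<in>{0..T}. \<bar>b t w\<bar> \<le> B)"
    using likely_bounded[OF mb cb T \<zeta>] by auto
  obtain Cb db where Cb: "0 < Cb" "0 < db" "\<And>N \<tau>. part 0 T db N \<tau> \<Longrightarrow>
       likely P \<zeta> (\<lambda>w. (\<Sum>i<N. (incr b \<tau> i w)\<^sup>2) \<le> Cb)"
    using b T \<zeta> unfolding tame_def by meson
  obtain CY dY where CY: "0 < CY" "0 < dY" "\<And>N \<tau>. part 0 T dY N \<tau> \<Longrightarrow>
       likely P \<zeta> (\<lambda>w. (\<Sum>i<N. (incr Y \<tau> i w)\<^sup>2) \<le> CY)"
    using Y T \<zeta> unfolding tame_def by meson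
  \<comment> \<open>One bound for the quadratic sums of \<open>b\<close>, \<open>Y\<close> and
    \<open>W\<close>; the term \<open>T / \<zeta>\<close> is what Markov's inequality needs for
    \<open>W\<close>.\<close>
  define C where "C = Cb + CY + T / \<zeta> + 1"
  have Tz: "0 \<le> T / \<zeta>" using T \<zeta> by simp
  then have C: "0 < C" "Cb \<le> C" "CY \<le> C" using Cb CY by (auto simp: C_def)
  have "T / \<zeta> < C" using Cb CY by (simp add: C_def)
  then have CW: "T < \<zeta> * C" using \<zeta> by (simp add: field_simps)
  have QW: "likely P \<zeta> (\<lambda>w. (\<Sum>i<N. (incr W \<tau> i w)\<^sup>2) < C)" if "part 0 T \<delta> N \<tau>" for \<delta> N \<tau>
    by (rule likely_W_quadratic[OF that]) (use C CW in auto)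
  \<comment> \<open>With \<open>m\<close> below, both terms of Young's inequality,
    \<open>l * C\<close> and \<open>m / l\<close>, equal \<open>e / 8\<close>.\<close>
  define l where "l = e / (8 * C)"
  have l: "0 < l" using e C by (simp add: l_def)
  define m where "m = l * e / 8"
  have m: "0 < m" using e l by (simp add: m_def)
  have lm: "l * C = e / 8" "m / l = e / 8" using C l by (auto simp: l_def m_def)
  \<comment> \<open>\<open>\<kappa> \<le> 1\<close> keeps the product of two oscillations below
    \<kappa>; \<open>e / (40 * C)\<close> gives \<open>5 * \<kappa> * C \<le> e / 8\<close>; the
    bounds on its square are for the two applications of the isometry.\<close>
  obtain \<kappa> where "0 < \<kappa>" "\<kappa> \<le> min 1 (e / (40 * C))" "\<kappa>\<^sup>2 * T < min (\<zeta> * (e / 8)\<^sup>2) (\<zeta> * m)"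
    using small_square[of "min 1 (e / (40 * C))" "min (\<zeta> * (e / 8)\<^sup>2) (\<zeta> * m)" T] C m \<zeta> e by auto
  then have \<kappa>: "0 < \<kappa>" "\<kappa> \<le> 1" "5 * \<kappa> * C \<le> e / 8" "\<kappa>\<^sup>2 * T < \<zeta> * (e / 8)\<^sup>2" "\<kappa>\<^sup>2 * T < \<zeta> * m"
    using C by (auto simp: field_simps)
  obtain h1 where h1: "0 < h1" "likely P \<zeta> (\<lambda>w. osc_le b T h1 \<kappa> w)"
    using likely_modulus[OF mb cb T \<kappa>(1) \<zeta>] by auto
  obtain h2 where h2: "0 < h2" "likely P \<zeta> (\<lambda>w. osc_le Y T h2 \<kappa> w)"
    using likely_modulus[OF mY cY T \<kappa>(1) \<zeta>] by auto
  \<comment> \<open>A bound on the jumps of the step function. \<open>e1\<close> makes the estimate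
    of \<open>sum_piecewise_constant_le\<close>, with errors \<open>2 * e1\<close>, come out as
    \<open>e / 8\<close>; \<open>z1\<close> is the share of each of at most \<open>K + 2\<close>
    times, plus the spare share of \<open>likely_ball\<close>.\<close>
  define K where "K = nat \<lfloor>T / h1\<rfloor>"
  define e1 where "e1 = e / (16 * B * (1 + 2 * real K))"
  have e1: "0 < e1" using B e by (simp add: e1_def add_pos_nonneg)
  define z1 where "z1 = \<zeta> / (real K + 3)"
  have z1: "0 < z1" using \<zeta> by (simp add: z1_def add_nonneg_pos)
  obtain d3 where d3: "0 < d3" "\<And>N \<tau> j. part 0 T d3 N \<tau> \<Longrightarrow> j \<le> N \<Longrightarrow> likely P z1 (\<lambda>w. \<bar>ssum Y j \<tau> w - A (\<tau> j) w\<bar> < e1)"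
    using ssum_limit_partial[OF A e1 z1 T] by blast
  define \<delta> where "\<delta> = min (min db dY) (min d3 (min h1 h2))"
  have \<delta>: "0 < \<delta>" "\<delta> \<le> db" "\<delta> \<le> dY" "\<delta> \<le> d3" "\<delta> \<le> h1" "\<delta> \<le> h2" using Cb CY d3 h1 h2 by (auto simp: \<delta>_def)
  have "likely P \<eta> (\<lambda>w.
    \<bar>(\<Sum>i<N. mid b \<tau> i w * incr A \<tau> i w)
      - ssum (\<lambda>t w. b t w * Y t w) N \<tau> w\<bar> < e)" if p: "part 0 T \<delta> N \<tau>" for N \<tau>
  proof -
    have t: "0 \<le> \<tau> i" "\<tau> i \<le> T" if "i \<le> N" for i using part_bounds[OF p that] .
    have tS: "\<tau> i \<le> \<tau> (Suc i)" "\<tau> (Suc i) - \<tau> i < \<delta>" if "i < N" for i using p that by (auto simp: part_def)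
    \<comment> \<open>The residuals of the \<open>N\<close> cells then sum to at most
      \<open>C\<close>, which suffices because they enter the final estimate with a factor
      \<kappa>.\<close>
    define r0 where "r0 = C / (real N + 1)"
    have r0: "0 < r0" using C by (simp add: r0_def)
    have z2: "0 < \<zeta> / (real N + 1)" using \<zeta> by simp
    obtain n where n: "0 < n" and cell: "\<And>i. i < N \<Longrightarrow> likely P (\<zeta> / (real N + 1))
       (\<lambda>w. \<bar>ssum Y n (unif (\<tau> i) (\<tau> (Suc i)) n) w - (incr A \<tau> i w)\<bar> < r0)"
      by (rule common_cell_refinement[OF A p r0 z2]) auto
    define \<rho> where "\<rho> = refine \<tau> n"
    have p': "part 0 T \<delta> (N * n) \<rho>" unfolding \<rho>_def by (rule part_refine[OF p n])
    have \<rho>: "\<tau> (k div n) \<le> \<rho> k" "\<rho> k \<le> \<tau> (Suc (k div n))" "k div n < N" "0 \<le> \<tau> (k div n)" "\<rho> k \<le> T"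
        "\<bar>\<rho> k - \<tau> (k div n)\<bar> < h2" if "k < N * n" for k
    proof -
      show *: "k div n < N" using that by (simp add: less_mult_imp_div_less)
      show **: "\<tau> (k div n) \<le> \<rho> k" "\<rho> k \<le> \<tau> (Suc (k div n))"
        using part_refine(2)[OF p n that] by (auto simp: \<rho>_def)
      show "0 \<le> \<tau> (k div n)" "\<rho> k \<le> T" using t[of "k div n"] t[of "Suc (k div n)"] * ** by auto
      show "\<bar>\<rho> k - \<tau> (k div n)\<bar> < h2" using tS[OF *] ** \<delta>(6) by auto
    qed
    \<comment> \<open>The last grid time not after \<open>\<tau> i\<close>. Looking backwards keeps
      \<open>b (g i)\<close> adapted; it is within \<kappa> of \<open>b (\<tau> i)\<close> and
      changes only when a cell crosses the grid.\<close>
    define g where "g i = h1 * of_int \<lfloor>\<tau> i / h1\<rfloor>" for i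
    have g: "0 \<le> g i" "g i \<le> \<tau> i" "\<tau> i - g i < h1" if "i \<le> N" for i
    proof -
      show "0 \<le> g i" unfolding g_def using t[OF that] h1(1) by (intro mult_nonneg_nonneg) auto
      have "h1 * of_int \<lfloor>\<tau> i / h1\<rfloor> \<le> h1 * (\<tau> i / h1)" "h1 * (\<tau> i / h1) < h1 * (of_int \<lfloor>\<tau> i / h1\<rfloor> + 1)"
        by (rule mult_left_mono[OF of_int_floor_le less_imp_le[OF h1(1)]],
            rule mult_strict_left_mono[OF real_of_int_floor_add_one_gt h1(1)])
      moreover have "h1 * (\<tau> i / h1) = \<tau> i" using h1(1) by simp
      ultimately show "g i \<le> \<tau> i" "\<tau> i - g i < h1" unfolding g_def by (simp_all only: distrib_left mult_1_right)
    qed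
    define J where "J = {i. i < N \<and> \<lfloor>\<tau> (Suc i) / h1\<rfloor> \<noteq> \<lfloor>\<tau> i / h1\<rfloor>}"
    have J: "finite J" "J \<subseteq> {..<N}" "card J \<le> K"
      using card_grid_jumps[OF p h1(1)] by (auto simp: J_def K_def)
    \<comment> \<open>The indices at which Abel summation evaluates the error of \<open>A\<close>,
      and index 0, from which that error is measured.\<close>
    define J' where "J' = insert 0 (insert N (Suc ` J))"
    have J': "finite J'" "J' \<subseteq> {..N}" using J by (auto simp: J'_def)
    have cJ': "real (card J') + 1 \<le> real K + 3"
    proof -
      have "card J' \<le> Suc (card (insert N (Suc ` J)))" unfolding J'_def using J(1) by (simp add: card_insert_if)
      moreover have "card (insert N (Suc ` J)) \<le> Suc (card (Suc ` J))" using J(1) by (simp add: card_insert_if)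
      moreover have "card (Suc ` J) = card J" by (simp add: card_image)
      ultimately show ?thesis using J(3) by simp
    qed
    have L1: "likely P \<zeta> (\<lambda>w. \<forall>j\<in>J'. \<bar>ssum Y j \<tau> w - A (\<tau> j) w\<bar> < e1)"
    proof (rule likely_ball[OF J'(1) _ \<zeta>])
      fix j assume "j \<in> J'"
      then have "likely P z1 (\<lambda>w. \<bar>ssum Y j \<tau> w - A (\<tau> j) w\<bar> < e1)"
        using d3(2)[OF part_mono[OF p \<delta>(4)]] J' by auto
      then show "likely P (\<zeta> / (real (card J') + 1)) (\<lambda>w. \<bar>ssum Y j \<tau> w - A (\<tau> j) w\<bar> < e1)"
        by (rule likely_mono) (use cJ' \<zeta> in \<open>auto simp: z1_def intro!: divide_left_mono mult_pos_pos add_nonneg_pos\<close>)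
    qed
    have L2: "likely P \<zeta> (\<lambda>w. \<forall>i\<in>{..<N}. \<bar>ssum Y n (unif (\<tau> i) (\<tau> (Suc i)) n) w - (incr A \<tau> i w)\<bar> < r0)"
      by (rule likely_ball) (use cell \<zeta> in auto)
    \<comment> \<open>On the refinement, \<open>Y\<close> minus its value at the left end of the
      coarse cell: adapted, and at most \<kappa> because the mesh is below
      \<open>h2\<close>.\<close>
    define \<theta> where "\<theta> k w = Y (\<rho> k) w - Y (\<tau> (k div n)) w" for k w
    define \<beta> where "\<beta> i w = b (g i) w" for i w
    define D where "D k w = incr W \<rho> k w" for k w
    have m\<theta>: "\<theta> k \<in> borel_measurable (F (\<rho> k))" if "k < N * n" for k
    proof -
      have "Y (\<rho> k) \<in> borel_measurable (F (\<rho> k))" using fY \<rho>[OF that] by auto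
      moreover have "Y (\<tau> (k div n)) \<in> borel_measurable (F (\<rho> k))"
        by (rule F_mono[OF \<rho>(4)[OF that] \<rho>(1)[OF that] fY]) (use \<rho>[OF that] in auto)
      ultimately show ?thesis unfolding \<theta>_def by measurable
    qed
    have m\<theta>': "(\<lambda>w. (b (\<tau> (k div n)) w - \<beta> (k div n) w) * \<theta> k w) \<in> borel_measurable (F (\<rho> k))" if "k < N * n" for k
    proof -
      have "b (\<tau> (k div n)) \<in> borel_measurable (F (\<rho> k))"
        by (rule F_mono[OF \<rho>(4)[OF that] \<rho>(1)[OF that] fb]) (use \<rho>[OF that] in auto)
      moreover have "\<beta> (k div n) \<in> borel_measurable (F (\<rho> k))"
        unfolding \<beta>_def[abs_def]
        by (rule F_mono[OF _ _ fb]) (use g[of "k div n"] \<rho>[OF that] in auto)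
      ultimately show ?thesis using m\<theta>[OF that] by measurable
    qed
    have \<theta>le: "\<bar>\<theta> k w\<bar> \<le> \<kappa>"
      if "k < N * n" "osc_le Y T h2 \<kappa> w" for k w
    proof -
      have "\<tau> (k div n) \<in> {0..T}" "\<rho> k \<in> {0..T}" using \<rho>[OF that(1)] by auto
      then show ?thesis unfolding \<theta>_def using that(2) \<rho>(6)[OF that(1)] by blast
    qed
    have ble: "\<bar>b (\<tau> i) w - \<beta> i w\<bar> \<le> \<kappa>"
      if "i \<le> N" "osc_le b T h1 \<kappa> w" for i w
    proof -
      have "\<tau> i \<in> {0..T}" "g i \<in> {0..T}" "\<bar>\<tau> i - g i\<bar> < h1" using t[OF that(1)] g[OF that(1)] by auto
      then show ?thesis unfolding \<beta>_def using that(2) by blast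
    qed
    have L3: "likely P (\<zeta> + \<zeta>) (\<lambda>w. (\<Sum>i<N. (\<Sum>k\<in>{i * n..<i * n + n}. \<theta> k w * D k w)\<^sup>2) < m)"
      unfolding D_def
    proof (rule likely_block_sums[OF p' _ m\<theta>])
      show "likely P \<zeta> (\<lambda>w. \<forall>k<N * n. \<bar>\<theta> k w\<bar> \<le> \<kappa>)"
        using h2(2) by (rule likely_mono) (use \<theta>le in auto)
      show "{i * n..<i * n + n} \<subseteq> {..<N * n}" if "i < N" for i
      proof -
        have "i * n + n = Suc i * n" by simp
        also have "\<dots> \<le> N * n" using that by (intro mult_right_mono) auto
        finally show ?thesis by auto
      qed
      have "k div n = i" if "k \<in> {i * n..<i * n + n}" for k i
        using that by (intro div_nat_eqI) (auto simp: algebra_simps)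
      then show "disjoint_family_on (\<lambda>i. {i * n..<i * n + n}) {..<N}"
        unfolding disjoint_family_on_def by blast
    qed (use m \<kappa> in auto)
    have L4: "likely P (2 * \<zeta> + \<zeta>) (\<lambda>w. \<bar>\<Sum>k<N * n. ((b (\<tau> (k div n)) w - \<beta> (k div n) w) * \<theta> k w) * D k w\<bar> < e / 8)"
      unfolding D_def
    proof (rule likely_martingale_sum[OF p' _ m\<theta>'])
      show "likely P (2 * \<zeta>) (\<lambda>w. \<forall>k<N * n. \<bar>(b (\<tau> (k div n)) w - \<beta> (k div n) w) * \<theta> k w\<bar> \<le> \<kappa>)"
        using h1(2) h2(2)
      proof (rule likely_mp)
        fix w assume 1: "osc_le b T h1 \<kappa> w"
          and 2: "osc_le Y T h2 \<kappa> w"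
        show "\<forall>k<N * n. \<bar>(b (\<tau> (k div n)) w - \<beta> (k div n) w) * \<theta> k w\<bar> \<le> \<kappa>"
        proof (intro allI impI)
          fix k assume k: "k < N * n"
          have "\<bar>b (\<tau> (k div n)) w - \<beta> (k div n) w\<bar> * \<bar>\<theta> k w\<bar> \<le> 1 * \<kappa>"
            by (intro mult_mono \<theta>le[OF k 2] order_trans[OF ble[OF _ 1] \<kappa>(2)]) (use \<rho>[OF k] in auto)
          then show "\<bar>(b (\<tau> (k div n)) w - \<beta> (k div n) w) * \<theta> k w\<bar> \<le> \<kappa>" by (simp add: abs_mult)
        qed
      qed auto
    qed (use \<kappa> e in auto)
    note Lb = Cb(3)[OF part_mono[OF p \<delta>(2)]]
    note LY = CY(3)[OF part_mono[OF p \<delta>(3)]]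
    note LY' = CY(3)[OF part_mono[OF p' \<delta>(3)]]
    note LW = QW[OF p] and LW' = QW[OF p']
    note all = likely_conj[OF L1 likely_conj[OF L2 likely_conj[OF L3 likely_conj[OF L4 likely_conj[OF Lb
      likely_conj[OF LY likely_conj[OF LY' likely_conj[OF LW likely_conj[OF LW' likely_conj[OF B(2)
      likely_conj[OF h1(2) h2(2)]]]]]]]]]]]
    from all show ?thesis
    proof (rule likely_mono, goal_cases)
      case 1
      show ?case using \<zeta> by (simp add: \<zeta>_def)
    next
      case (2 w)
      then have 1: "\<And>j. j \<in> J' \<Longrightarrow> \<bar>ssum Y j \<tau> w - A (\<tau> j) w\<bar> < e1"
        and 2: "\<And>i. i < N \<Longrightarrow> \<bar>ssum Y n (unif (\<tau> i) (\<tau> (Suc i)) n) w - (incr A \<tau> i w)\<bar> < r0"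
        and 3: "(\<Sum>i<N. (\<Sum>k\<in>{i * n..<i * n + n}. \<theta> k w * D k w)\<^sup>2) < m"
        and 4: "\<bar>\<Sum>k<N * n. ((b (\<tau> (k div n)) w - \<beta> (k div n) w) * \<theta> k w) * D k w\<bar> < e / 8"
        and 5: "(\<Sum>i<N. (incr b \<tau> i w)\<^sup>2) \<le> Cb" "(\<Sum>i<N. (incr Y \<tau> i w)\<^sup>2) \<le> CY"
          "(\<Sum>i<N * n. (incr Y \<rho> i w)\<^sup>2) \<le> CY" "(\<Sum>i<N. (incr W \<tau> i w)\<^sup>2) < C"
          "(\<Sum>i<N * n. (incr W \<rho> i w)\<^sup>2) < C"
        and 6: "\<And>t. t \<in> {0..T} \<Longrightarrow> \<bar>b t w\<bar> \<le> B"
        and 7: "osc_le b T h1 \<kappa> w"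
        and 8: "osc_le Y T h2 \<kappa> w"
        by blast+
      define dw where "dw i = incr W \<tau> i w" for i
      define a where "a i = incr A \<tau> i w" for i
      define M where "M i = (\<Sum>k\<in>{i * n..<i * n + n}. \<theta> k w * D k w)" for i
      define Q where "Q i = (\<Sum>k\<in>{i * n..<i * n + n}. incr Y \<rho> k w * D k w)" for i
      define r where "r i = ssum Y n (unif (\<tau> i) (\<tau> (Suc i)) n) w - a i" for i
      define E where "E j = (\<Sum>i<j. mid Y \<tau> i w * dw i - a i)" for j
      have kdiv: "k div n = i" if "k \<in> {i * n..<i * n + n}" for k i
        using that by (intro div_nat_eqI) (auto simp: algebra_simps)
      have E: "E j = (ssum Y j \<tau> w - A (\<tau> j) w) - (ssum Y 0 \<tau> w - A (\<tau> 0) w)" for j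
        unfolding E_def by (induction j) (simp_all add: ssum_def dw_def a_def algebra_simps)
      have EJ: "\<bar>E j\<bar> \<le> 2 * e1" if "j \<in> J'" for j
        using 1[OF that] 1[of 0] unfolding E by (simp add: J'_def)
      \<comment> \<open>On a fine cell, the average of \<open>Y\<close> is its coarse left value
        plus \<open>\<theta>\<close> plus half a fine increment. On the coarse cell, it is the same
        left value plus half a coarse increment, so the left values cancel.\<close>
      have dec: "mid Y \<tau> i w * dw i - a i =
        - M i + incr Y \<tau> i w * dw i / 2 - Q i / 2 + r i" if "i < N" for i
      proof -
        have dw: "dw i = (\<Sum>k\<in>{i * n..<i * n + n}. D k w)"
          unfolding dw_def D_def \<rho>_def by (rule sum_refined_cell(1)[OF n, symmetric])
        have "ssum Y n (unif (\<tau> i) (\<tau> (Suc i)) n) w =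
            (\<Sum>k\<in>{i * n..<i * n + n}. D k w * (mid Y \<rho> k w))"
          unfolding D_def \<rho>_def by (rule sum_refined_cell(2)[OF n, symmetric])
        also have "\<dots> = (\<Sum>k\<in>{i * n..<i * n + n}. \<theta> k w * D k w + Y (\<tau> i) w * D k w + incr Y \<rho> k w * D k w / 2)"
          unfolding \<theta>_def by (intro sum.cong refl, subst kdiv, assumption) (simp add: field_simps)
        also have "\<dots> = M i + Y (\<tau> i) w * dw i + Q i / 2"
          unfolding dw by (simp add: sum.distrib M_def Q_def sum_distrib_left sum_divide_distrib)
        finally show ?thesis by (simp add: r_def field_simps)
      qed
      have "\<bar>(\<Sum>i<N. mid b \<tau> i w * a i)
          - (\<Sum>i<N. dw i * ((b (\<tau> i) w * Y (\<tau> i) w + b (\<tau> (Suc i)) w * Y (\<tau> (Suc i)) w) / 2))\<bar>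
        \<le> 2 * (e / 8) + (l * C + m / l) + 5 * \<kappa> * C"
      proof (rule associativity_defect_le[where E = E and Q = Q and M = M and r = r and \<beta> = "\<lambda>i. \<beta> i w"])
        show "E (Suc i) - E i = mid Y \<tau> i w * dw i - a i" for i by (simp add: E_def)
        show "\<bar>b (\<tau> i) w - \<beta> i w\<bar> \<le> \<kappa>" if "i < N" for i using ble[OF _ 7] that by auto
        show "\<bar>incr b \<tau> i w\<bar> \<le> \<kappa>" if i: "i < N" for i
        proof -
          have "\<tau> i \<in> {0..T}" "\<tau> (Suc i) \<in> {0..T}" "\<bar>\<tau> (Suc i) - \<tau> i\<bar> < h1"
            using t[of i] t[of "Suc i"] tS[OF i] \<delta>(5) i by auto
          then show ?thesis using 7 by blast
        qed
        show "(\<Sum>i<N. \<bar>Q i\<bar>) \<le> C"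
        proof -
          have "(\<Sum>i<N. \<bar>Q i\<bar>) \<le> (\<Sum>i<N. \<Sum>k\<in>{i * n..<i * n + n}. \<bar>(incr Y \<rho> k w) * D k w\<bar>)"
            unfolding Q_def by (intro sum_mono sum_abs)
          also have "\<dots> = (\<Sum>k<N * n. \<bar>(incr Y \<rho> k w) * D k w\<bar>)" by (rule sum.nat_group)
          also have "\<dots> \<le> (\<Sum>k<N * n. ((incr Y \<rho> k w)\<^sup>2 + (D k w)\<^sup>2) / 2)"
            by (intro sum_mono abs_mult_le_mean)
          also have "\<dots> = ((\<Sum>k<N * n. (incr Y \<rho> k w)\<^sup>2) + (\<Sum>k<N * n. (D k w)\<^sup>2)) / 2"
            by (simp add: sum.distrib sum_divide_distrib add_divide_distrib)
          also have "\<dots> \<le> C"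
          proof -
            have "(x + y) / 2 \<le> C" if "x \<le> CY" "y < C" for x y using that C by (simp add: field_simps)
            then show ?thesis using 5(3,5) unfolding D_def by blast
          qed
          finally show ?thesis .
        qed
        show "\<bar>\<Sum>i<N. (b (\<tau> i) w - \<beta> i w) * M i\<bar> \<le> e / 8"
        proof -
          have "(\<Sum>i<N. (b (\<tau> i) w - \<beta> i w) * M i) =
            (\<Sum>i<N. \<Sum>k\<in>{i * n..<i * n + n}. ((b (\<tau> (k div n)) w - \<beta> (k div n) w) * \<theta> k w) * D k w)"
            unfolding M_def sum_distrib_left by (intro sum.cong refl, subst kdiv, assumption, subst kdiv, assumption) (simp add: mult.assoc)
          also have "\<dots> = (\<Sum>k<N * n. ((b (\<tau> (k div n)) w - \<beta> (k div n) w) * \<theta> k w) * D k w)" by (rule sum.nat_group)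
          finally show ?thesis using 4 by simp
        qed
        show "\<bar>\<Sum>i<N. \<beta> i w * (E (Suc i) - E i)\<bar> \<le> e / 8"
        proof -
          have "\<bar>\<Sum>i<N. \<beta> i w * (E (Suc i) - E i)\<bar> \<le> B * (2 * e1) * (1 + 2 * real (card J))"
          proof (rule sum_piecewise_constant_le[OF _ _ J(2)])
            show "E 0 = 0" by (simp add: E_def)
            show "\<bar>\<beta> i w\<bar> \<le> B" if "i \<le> N" for i
              unfolding \<beta>_def using g[OF that] t[OF that] by (intro 6) auto
            show "\<beta> (Suc i) w = \<beta> i w" if "i < N" "i \<notin> J" for i
              using that by (simp add: \<beta>_def g_def J_def)
            show "\<bar>E N\<bar> \<le> 2 * e1" by (rule EJ) (simp add: J'_def)
            show "\<bar>E (Suc i)\<bar> \<le> 2 * e1" if "i \<in> J" for i by (rule EJ) (use that in \<open>simp add: J'_def\<close>)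
          qed
          also have "\<dots> \<le> B * (2 * e1) * (1 + 2 * real K)"
            by (intro mult_left_mono) (use J(3) B e1 in auto)
          also have "\<dots> = e / 8"
          proof -
            define K' where "K' = 1 + 2 * real K"
            have "0 < K'" by (simp add: K'_def add_pos_nonneg)
            then show ?thesis using B(1) unfolding e1_def K'_def[symmetric] by (simp add: field_simps)
          qed
          finally show ?thesis .
        qed
        show "(\<Sum>i<N. \<bar>r i\<bar>) \<le> C"
        proof -
          have "(\<Sum>i<N. \<bar>r i\<bar>) \<le> (\<Sum>i<N. r0)" by (rule sum_mono) (use 2 in \<open>auto simp: r_def a_def less_imp_le\<close>)
          also have "\<dots> \<le> C" unfolding r0_def using C by (simp add: field_simps)
          finally show ?thesis .
        qed
      qed (use dec 3 5 C l \<kappa>(1) in \<open>auto simp: M_def dw_def\<close>)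
      \<comment> \<open>Five contributions of at most \<open>e / 8\<close> each.\<close>
      also have "\<dots> < e" using lm \<kappa>(3) e by linarith
      finally show ?case by (simp add: ssum_def a_def dw_def)
    qed
  qed
  with \<delta>(1) show ?thesis by auto
qed

end

section \<open>The Hamiltonian system\<close>

lemma grad_eq:
  assumes "GDERIV f z :> D"
  shows "grad f z = D"
  unfolding grad_def
proof (rule the_equality, rule assms)
  fix D' assume "GDERIV f z :> D'"
  then have "(\<lambda>h. h \<bullet> D) = (\<lambda>h. h \<bullet> D')"
    using has_derivative_unique assms unfolding gderiv_def by blast
  then have "(D' - D) \<bullet> D = (D' - D) \<bullet> D'" by meson
  then have "(D' - D) \<bullet> (D' - D) = 0" by (simp add: inner_diff_right)
  then show "D' = D" by simp
qed

lemma vector_4: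
  "(vector [a, b, c, d] :: 'a::zero^4) $ 1 = a" "(vector [a, b, c, d] :: 'a^4) $ 2 = b"
  "(vector [a, b, c, d] :: 'a^4) $ 3 = c" "(vector [a, b, c, d] :: 'a^4) $ 4 = d"
  by (simp_all add: vector_def)

lemma has_derivative_vec_nth: "((\<lambda>x. x $ i) has_derivative (\<lambda>h. h $ i)) (at u)" for u :: "real^'n"
  by (rule bounded_linear.has_derivative[OF bounded_linear_vec_nth has_derivative_ident])

definition S1_p :: "nat \<Rightarrow> real^4 \<Rightarrow> real" where "S1_p \<sigma> u = - (((u$1)\<^sup>2 + (u$2)\<^sup>2) ^ \<sigma> * u$1)"
definition S1_q :: "nat \<Rightarrow> real^4 \<Rightarrow> real" where "S1_q \<sigma> u = - (((u$1)\<^sup>2 + (u$2)\<^sup>2) ^ \<sigma> * u$2)"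

text \<open>The first row of the Hessian of \<open>S1\<close> at \<open>u\<close>, applied to
  \<open>d\<close>. At \<open>\<sigma> = 0\<close> the truncated exponent does no harm, since the
  factor \<open>real \<sigma>\<close> vanishes.\<close>

definition hess_p :: "nat \<Rightarrow> real^4 \<Rightarrow> real^4 \<Rightarrow> real" where
  "hess_p \<sigma> u d = - (real \<sigma> * ((u$1)\<^sup>2 + (u$2)\<^sup>2) ^ (\<sigma> - 1) * (2 * u$1 * d$1 + 2 * u$2 * d$2) * u$1 + ((u$1)\<^sup>2 + (u$2)\<^sup>2) ^ \<sigma> * d$1)"
definition hess_q :: "nat \<Rightarrow> real^4 \<Rightarrow> real^4 \<Rightarrow> real" where
  "hess_q \<sigma> u d = - (real \<sigma> * ((u$1)\<^sup>2 + (u$2)\<^sup>2) ^ (\<sigma> - 1) * (2 * u$1 * d$1 + 2 * u$2 * d$2) * u$2 + ((u$1)\<^sup>2 + (u$2)\<^sup>2) ^ \<sigma> * d$2)"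

lemma hessian_symmetric: "hess_p \<sigma> u d * k$1 + hess_q \<sigma> u d * k$2 = hess_p \<sigma> u k * d$1 + hess_q \<sigma> u k * d$2"
  by (simp add: hess_p_def hess_q_def algebra_simps)

lemma grad_S1: "grad (S1 \<sigma>) z $ 1 = S1_p \<sigma> z" "grad (S1 \<sigma>) z $ 2 = S1_q \<sigma> z"
  "grad (S1 \<sigma>) z $ 3 = 0" "grad (S1 \<sigma>) z $ 4 = 0"
proof -
  define r where "r = (z$1)\<^sup>2 + (z$2)\<^sup>2"
  define k where "k = 1 / (2 * real \<sigma> + 2)"
  have "2 * real \<sigma> + 2 \<noteq> 0" by linarith
  then have k: "- k * (real (\<sigma> + 1) * X * (2 * Y)) = - (X * Y)" for X Y
    unfolding k_def by (simp add: field_simps)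
  have "((\<lambda>z::real^4. ((z$1)\<^sup>2 + (z$2)\<^sup>2) ^ (\<sigma> + 1)) has_derivative
      (\<lambda>h. real (\<sigma> + 1) * r ^ \<sigma> * (2 * (z$1 * h$1 + z$2 * h$2)))) (at z)"
    apply (rule derivative_eq_intros has_derivative_vec_nth refl)+
    by (auto simp: fun_eq_iff algebra_simps r_def)
  then have "((\<lambda>z::real^4. - k * ((z$1)\<^sup>2 + (z$2)\<^sup>2) ^ (\<sigma> + 1)) has_derivative
      (\<lambda>h. - k * (real (\<sigma> + 1) * r ^ \<sigma> * (2 * (z$1 * h$1 + z$2 * h$2))))) (at z)"
    by (rule has_derivative_mult_right)
  moreover have "(\<lambda>h. - k * (real (\<sigma> + 1) * r ^ \<sigma> * (2 * (z$1 * h$1 + z$2 * h$2)))) = (\<lambda>h::real^4. h \<bullet> vector [S1_p \<sigma> z, S1_q \<sigma> z, 0, 0])"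
    unfolding k by (simp add: fun_eq_iff inner_vec_def sum_4 vector_4 S1_p_def S1_q_def r_def algebra_simps)
  ultimately have "GDERIV (S1 \<sigma>) z :> vector [S1_p \<sigma> z, S1_q \<sigma> z, 0, 0]"
    unfolding gderiv_def S1_def[abs_def] k_def by metis
  from grad_eq[OF this]
  show "grad (S1 \<sigma>) z $ 1 = S1_p \<sigma> z" "grad (S1 \<sigma>) z $ 2 = S1_q \<sigma> z"
    "grad (S1 \<sigma>) z $ 3 = 0" "grad (S1 \<sigma>) z $ 4 = 0" by (simp_all add: vector_4)
qed

text \<open>The first two rows of the system are those containing the time differential. There the
  stochastic right-hand side disappears, which leaves one Stratonovich integral per row.\<close>

lemma grad_S2: "grad S2 z $ 1 = 0" "grad S2 z $ 2 = 0"
proof -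
  have "GDERIV S2 z :> vector [0, 0, - z$3, - z$4]"
    unfolding gderiv_def S2_def[abs_def]
    apply (rule derivative_eq_intros has_derivative_vec_nth refl)+
    by (auto simp: fun_eq_iff inner_vec_def sum_4 vector_4 algebra_simps)
  from grad_eq[OF this] show "grad S2 z $ 1 = 0" "grad S2 z $ 2 = 0" by (simp_all add: vector_4)
qed

lemma continuous_on_grad_S1:
  assumes "continuous_on S z"
  shows "continuous_on S (\<lambda>s. grad (S1 \<sigma>) (z s))"
proof -
  have "grad (S1 \<sigma>) u = S1_p \<sigma> u *\<^sub>R axis 1 1 + S1_q \<sigma> u *\<^sub>R axis 2 1" for u
    by (simp add: vec_eq_iff forall_4 grad_S1 axis_def)
  then show ?thesis
    unfolding S1_p_def S1_q_def by (simp only:) (intro continuous_intros assms)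
qed

lemma matK_mult: "(matK *v y) $ 1 = y $ 3" "(matK *v y) $ 2 = y $ 4"
  by (simp_all add: matK_def matrix_vector_mult_def sum_4 vector_4)

lemma matM_mult: "(matM *v y) $ 1 = - y $ 2" "(matM *v y) $ 2 = y $ 1"
  by (simp_all add: matM_def matrix_vector_mult_def sum_4 vector_4)

lemma wedge_matM: "wedge_mat \<theta> matM h k = 2 * (\<theta> h $ 2 * \<theta> k $ 1 - \<theta> h $ 1 * \<theta> k $ 2)"
  by (simp add: wedge_mat_def matM_def sum_4 vector_4 wedge_def)

lemma wedge_matK: "wedge_mat \<theta> matK h k =
    2 * (\<theta> h $ 1 * \<theta> k $ 3 - \<theta> h $ 3 * \<theta> k $ 1 + \<theta> h $ 2 * \<theta> k $ 4 - \<theta> h $ 4 * \<theta> k $ 2)"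
  by (simp add: wedge_mat_def matK_def sum_4 vector_4 wedge_def)

section \<open>Linearisation of the drift\<close>

lemma has_derivative_S1_p: "(S1_p \<sigma> has_derivative hess_p \<sigma> u) (at u)"
  unfolding S1_p_def[abs_def] hess_p_def[abs_def]
  apply (rule derivative_eq_intros has_derivative_vec_nth refl)+
  by (auto simp: fun_eq_iff algebra_simps)

lemma has_derivative_S1_q: "(S1_q \<sigma> has_derivative hess_q \<sigma> u) (at u)"
  unfolding S1_q_def[abs_def] hess_q_def[abs_def]
  apply (rule derivative_eq_intros has_derivative_vec_nth refl)+
  by (auto simp: fun_eq_iff algebra_simps)

lemma continuous_hess_p: "continuous_on S (\<lambda>y. hess_p \<sigma> (fst y) (snd y))"
  unfolding hess_p_def by (intro continuous_intros)

lemma continuous_hess_q: "continuous_on S (\<lambda>y. hess_q \<sigma> (fst y) (snd y))"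
  unfolding hess_q_def by (intro continuous_intros)

text \<open>The mean value theorem turns the quotient into \<open>g'\<close> at a nearby point and
  direction, and \<open>g'\<close> is uniformly continuous on compact sets. The uniformity in
  \<open>u\<close>, \<xi> and \<open>D\<close> is needed because they will be values along random
  paths.\<close>

lemma difference_quotient_uniform:
  fixes g :: "'v::euclidean_space \<Rightarrow> real"
  assumes g: "\<And>u. (g has_derivative g' u) (at u)"
    and cont: "continuous_on UNIV (\<lambda>y. g' (fst y) (snd y))"
    and "0 < e" and R: "0 \<le> R"
  shows "\<exists>d>0. \<forall>u \<xi> D \<epsilon>. norm u \<le> R \<longrightarrow> norm \<xi> \<le> R \<longrightarrow> norm (D - \<xi>) \<le> d \<longrightarrow> \<epsilon> \<noteq> 0 \<longrightarrow> \<bar>\<epsilon>\<bar> \<le> d \<longrightarrow>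
    \<bar>(g (u + \<epsilon> *\<^sub>R D) - g u) / \<epsilon> - g' u \<xi>\<bar> \<le> e"
proof -
  \<comment> \<open>As \<open>D\<close> has norm at most \<open>R + 1\<close> and steps have size at
    most 1, intermediate points stay within \<open>R + (R + 1)\<close>.\<close>
  define K where "K = cball (0::'v) (2 * R + 1) \<times> cball (0::'v) (R + 1)"
  have "uniformly_continuous_on K (\<lambda>y. g' (fst y) (snd y))"
    by (rule compact_uniformly_continuous) (auto simp: K_def intro: compact_Times continuous_on_subset[OF cont])
  then obtain \<delta> where \<delta>: "0 < \<delta>" "\<And>y y'. y \<in> K \<Longrightarrow> y' \<in> K \<Longrightarrow> dist y' y < \<delta> \<Longrightarrow>
      dist (g' (fst y') (snd y')) (g' (fst y) (snd y)) < e"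
    unfolding uniformly_continuous_on_def using \<open>0 < e\<close> by metis
  \<comment> \<open>The point moves by at most \<open>d * (R + 1)\<close> and the direction by at
    most \<open>d\<close>, in total at most \<open>\<delta> / 2\<close>.\<close>
  define d where "d = min 1 (\<delta> / (2 * (R + 2)))"
  have d: "0 < d" "d \<le> 1" "d * (R + 2) \<le> \<delta> / 2"
  proof -
    show "0 < d" "d \<le> 1" using \<delta>(1) R by (auto simp: d_def)
    have "d * (R + 2) \<le> \<delta> / (2 * (R + 2)) * (R + 2)"
      by (rule mult_right_mono) (use R in \<open>auto simp: d_def\<close>)
    also have "\<dots> = \<delta> / 2"
    proof -
      have "\<delta> / (2 * c) * c = \<delta> / 2" if "c \<noteq> 0" for c using that by simp
      moreover have "R + 2 \<noteq> 0" using R by linarith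
      ultimately show ?thesis by blast
    qed
    finally show "d * (R + 2) \<le> \<delta> / 2" .
  qed
  have "\<bar>(g (u + \<epsilon> *\<^sub>R D) - g u) / \<epsilon> - g' u \<xi>\<bar> \<le> e"
    if u: "norm u \<le> R" "norm \<xi> \<le> R" "norm (D - \<xi>) \<le> d" "\<epsilon> \<noteq> 0" "\<bar>\<epsilon>\<bar> \<le> d" for u \<xi> D \<epsilon>
  proof -
    have D: "norm D \<le> R + 1" using u d norm_triangle_sub[of D \<xi>] by linarith
    have der: "((\<lambda>s. g (u + (s * \<epsilon>) *\<^sub>R D)) has_real_derivative \<epsilon> * g' (u + (s * \<epsilon>) *\<^sub>R D) D) (at s)" for s
    proof -
      have "((\<lambda>s. g (u + (s * \<epsilon>) *\<^sub>R D)) has_derivative (\<lambda>r. g' (u + (s * \<epsilon>) *\<^sub>R D) ((r * \<epsilon>) *\<^sub>R D))) (at s)"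
        by (rule has_derivative_compose[OF _ g]) (auto intro!: derivative_eq_intros)
      moreover have "g' x ((r * \<epsilon>) *\<^sub>R D) = \<epsilon> * g' x D * r" for x r
        by (simp only: linear_cmul[OF has_derivative_linear[OF g]]) (simp add: mult_ac)
      ultimately show ?thesis by (simp add: has_field_derivative_def)
    qed
    obtain s where s: "0 < s" "s < 1" "g (u + (1 * \<epsilon>) *\<^sub>R D) - g (u + (0 * \<epsilon>) *\<^sub>R D) = (1 - 0) * (\<epsilon> * g' (u + (s * \<epsilon>) *\<^sub>R D) D)"
      using MVT2[of 0 1 "\<lambda>s. g (u + (s * \<epsilon>) *\<^sub>R D)" "\<lambda>s. \<epsilon> * g' (u + (s * \<epsilon>) *\<^sub>R D) D"] der by auto
    then have eq: "(g (u + \<epsilon> *\<^sub>R D) - g u) / \<epsilon> = g' (u + (s * \<epsilon>) *\<^sub>R D) D" using u(4) by simp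
    have n: "norm ((s * \<epsilon>) *\<^sub>R D) \<le> d * (R + 1)"
    proof -
      have "\<bar>s\<bar> * \<bar>\<epsilon>\<bar> \<le> 1 * d" by (intro mult_mono) (use s u d in auto)
      then have "\<bar>s * \<epsilon>\<bar> * norm D \<le> d * (R + 1)" by (intro mult_mono D) (use d in \<open>auto simp: abs_mult\<close>)
      then show ?thesis by simp
    qed
    have dR: "d * (R + 1) \<le> R + 1" using d R by (simp add: mult_left_le_one_le)
    have "norm (u + (s * \<epsilon>) *\<^sub>R D) \<le> 2 * R + 1"
      using u(1) n dR norm_triangle_ineq[of u "(s * \<epsilon>) *\<^sub>R D"] by linarith
    then have "(u + (s * \<epsilon>) *\<^sub>R D, D) \<in> K" "(u, \<xi>) \<in> K"
      unfolding K_def using u D R by auto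
    moreover have "dist (u + (s * \<epsilon>) *\<^sub>R D, D) (u, \<xi>) < \<delta>"
    proof -
      have "dist (u + (s * \<epsilon>) *\<^sub>R D, D) (u, \<xi>) \<le> norm ((s * \<epsilon>) *\<^sub>R D) + norm (D - \<xi>)"
        using sqrt_sum_squares_le_sum[of "norm ((s * \<epsilon>) *\<^sub>R D)" "norm (D - \<xi>)"]
        by (simp add: dist_norm norm_Pair)
      also have "\<dots> \<le> d * (R + 1) + d" by (intro add_mono n u)
      also have "\<dots> < \<delta>" using d \<delta>(1) by (simp add: algebra_simps)
      finally show ?thesis .
    qed
    ultimately have "dist (g' (u + (s * \<epsilon>) *\<^sub>R D) D) (g' u \<xi>) < e" using \<delta>(2) by force
    then show ?thesis unfolding eq by (simp add: dist_real_def)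
  qed
  with d(1) show ?thesis by blast
qed

context brownian
begin

section \<open>Regular processes\<close>

lemma has_quadratic_variation_likely:
  assumes "has_quadratic_variation P X T Q" "0 < e" "0 < \<eta>"
  obtains \<delta> where "0 < \<delta>" "\<And>N \<tau>. part 0 T \<delta> N \<tau> \<Longrightarrow>
    likely P \<eta> (\<lambda>w. \<bar>(\<Sum>k<N. (norm (incr X \<tau> k w))\<^sup>2) - Q w\<bar> < e)"
proof -
  have "\<exists>\<delta>>0. \<forall>N \<tau>. part 0 T \<delta> N \<tau> \<longrightarrow>
    likely P \<eta> (\<lambda>w. \<bar>(\<Sum>k<N. (norm (incr X \<tau> k w))\<^sup>2) - Q w\<bar> < e)"
    using assms unfolding has_quadratic_variation_def tendsto_in_prob_mesh by simp
  then show ?thesis using that by blast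
qed

text \<open>\<open>Q\<close> is not known to be measurable, so tightness cannot be read off from it.
  It is taken from the quadratic sum over one fixed fine partition, which is measurable and, like
  every other fine sum, likely within 1 of \<open>Q\<close>; hence the bound
  \<open>C + 2\<close>.\<close>

lemma regular_tame:
  fixes X :: "real \<Rightarrow> 'a \<Rightarrow> real^'n"
  assumes "regular_process P F X"
  shows "tame (\<lambda>t w. X t w $ i)"
proof -
  have m: "X t \<in> borel_measurable (F t)" if "0 \<le> t" for t
    using assms that by (auto simp: regular_process_def adapted_def)
  have c: "AE w in P. continuous_on {0..} (\<lambda>t. X t w)"
    using assms by (auto simp: regular_process_def continuous_process_def)
  have "\<exists>C>0. \<exists>\<delta>>0. \<forall>N \<tau>. part 0 T \<delta> N \<tau> \<longrightarrow>
       likely P \<eta> (\<lambda>w. (\<Sum>k<N. (X (\<tau> (Suc k)) w $ i - X (\<tau> k) w $ i)\<^sup>2) \<le> C)" if "0 \<le> T" "0 < \<eta>" for T \<eta>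
  proof -
    define S where "S N \<tau> w = (\<Sum>k<N. (norm (incr X \<tau> k w))\<^sup>2)" for N \<tau> w
    obtain Q where "has_quadratic_variation P X T Q" using assms \<open>0 \<le> T\<close> by (auto simp: regular_process_def)
    then obtain \<delta> where \<delta>: "0 < \<delta>" "\<And>N \<tau>. part 0 T \<delta> N \<tau> \<Longrightarrow> likely P (\<eta>/4) (\<lambda>w. \<bar>S N \<tau> w - Q w\<bar> < 1)"
      unfolding S_def by (rule has_quadratic_variation_likely[of X T Q 1 "\<eta>/4"]) (use \<open>0 < \<eta>\<close> in auto)
    obtain N0 \<tau>0 where p0: "part 0 T \<delta> N0 \<tau>0" using part_exists[OF \<open>0 \<le> T\<close> \<delta>(1)] by blast
    have "X (\<tau>0 k) \<in> borel_measurable P" if "k \<le> N0" for k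
      using F_measurable[OF _ m] part_bounds[OF p0 that] by auto
    then have "S N0 \<tau>0 \<in> borel_measurable P" unfolding S_def by (auto intro!: borel_measurable_sum)
    from tight_real[OF this, of "\<eta>/4"] obtain C where C: "0 < C" "likely P (\<eta>/4) (\<lambda>w. \<bar>S N0 \<tau>0 w\<bar> \<le> C)"
      using \<open>0 < \<eta>\<close> by auto
    have "likely P \<eta> (\<lambda>w. (\<Sum>k<N. (X (\<tau> (Suc k)) w $ i - X (\<tau> k) w $ i)\<^sup>2) \<le> C + 2)" if p: "part 0 T \<delta> N \<tau>" for N \<tau>
    proof (rule likely_mono[OF likely_conj[OF C(2) likely_conj[OF \<delta>(2)[OF p0] \<delta>(2)[OF p]]]])
      fix w assume *: "\<bar>S N0 \<tau>0 w\<bar> \<le> C \<and> \<bar>S N0 \<tau>0 w - Q w\<bar> < 1 \<and> \<bar>S N \<tau> w - Q w\<bar> < 1"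
      have "(\<Sum>k<N. (X (\<tau> (Suc k)) w $ i - X (\<tau> k) w $ i)\<^sup>2) \<le> S N \<tau> w"
        unfolding S_def
      proof (rule sum_mono)
        fix k
        have "\<bar>(incr X \<tau> k w) $ i\<bar>\<^sup>2 \<le> (norm (incr X \<tau> k w))\<^sup>2"
          by (intro power_mono component_le_norm_cart) auto
        then show "(X (\<tau> (Suc k)) w $ i - X (\<tau> k) w $ i)\<^sup>2 \<le> (norm (incr X \<tau> k w))\<^sup>2" by simp
      qed
      with * show "(\<Sum>k<N. (X (\<tau> (Suc k)) w $ i - X (\<tau> k) w $ i)\<^sup>2) \<le> C + 2" by linarith
    qed (use \<open>0 < \<eta>\<close> in auto)
    then show ?thesis using C(1) \<delta>(1) by (intro exI[of _ "C + 2"]) auto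
  qed
  moreover have "(\<lambda>w. X t w $ i) \<in> borel_measurable (F t)" if "0 \<le> t" for t
    using measurable_compose[OF m[OF that] borel_measurable_nth] .
  moreover have "AE w in P. continuous_on {0..} (\<lambda>t. X t w $ i)"
    using c by eventually_elim (intro continuous_intros)
  ultimately show ?thesis unfolding tame_def by blast
qed

lemma regular_likely_bounded:
  fixes X :: "real \<Rightarrow> 'a \<Rightarrow> real^'n"
  assumes "regular_process P F X" "0 \<le> T" "0 < \<eta>"
  shows "\<exists>R>0. likely P \<eta> (\<lambda>w. \<forall>t\<in>{0..T}. norm (X t w) \<le> R)"
proof -
  have "(\<lambda>w. norm (X t w)) \<in> borel_measurable P" if "0 \<le> t" for t
  proof -
    have "X t \<in> borel_measurable (F t)" using assms that by (simp add: regular_process_def adapted_def)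
    from F_measurable[OF that this] show ?thesis by measurable
  qed
  moreover have "AE w in P. continuous_on {0..} (\<lambda>t. X t w)"
    using assms by (auto simp: regular_process_def continuous_process_def)
  then have "AE w in P. continuous_on {0..} (\<lambda>t. norm (X t w))"
    by eventually_elim (intro continuous_intros)
  ultimately show ?thesis
    using likely_bounded[of "\<lambda>t w. norm (X t w)", OF _ _ assms(2,3)] by auto
qed

text \<open>Continuity is what gives the supremum its meaning: a real \<open>SUP\<close> dominates
  its members only if they are bounded above.\<close>

lemma process_tendsto_likely:
  assumes "process_tendsto P X Y G"
    and cont: "\<forall>\<^sub>F i in G. AE w in P. continuous_on {0..} (\<lambda>t. X i t w - Y t w)"
    and "0 \<le> T" and \<kappa>: "0 < \<kappa>" and \<eta>: "0 < \<eta>"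
  shows "\<forall>\<^sub>F i in G. likely P \<eta> (\<lambda>w. \<forall>t\<in>{0..T}. norm (X i t w - Y t w) \<le> \<kappa>)"
    and "\<forall>\<^sub>F i in G. \<exists>\<delta>>0. \<forall>N \<tau>. part 0 T \<delta> N \<tau> \<longrightarrow> likely P \<eta>
      (\<lambda>w. (\<Sum>k<N. (norm (incr (\<lambda>t w. X i t w - Y t w) \<tau> k w))\<^sup>2) \<le> \<kappa>)"
proof -
  have sup: "tendsto_in_prob P (\<lambda>i w. SUP t\<in>{0..T}. norm (X i t w - Y t w)) (\<lambda>_. 0) G"
    using assms(1,3) by (auto simp: process_tendsto_def)
  have "\<forall>\<^sub>F i in G. likely P (\<eta>/2) (\<lambda>w. norm ((SUP t\<in>{0..T}. norm (X i t w - Y t w)) - 0) < \<kappa>)"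
    using sup \<kappa> \<eta> unfolding tendsto_in_prob_likely by (meson half_gt_zero)
  then show "\<forall>\<^sub>F i in G. likely P \<eta> (\<lambda>w. \<forall>t\<in>{0..T}. norm (X i t w - Y t w) \<le> \<kappa>)"
    using cont
  proof eventually_elim
    case (elim i)
    show ?case
    proof (rule likely_AE_mp[OF elim(1)])
      show "AE w in P. norm ((SUP t\<in>{0..T}. norm (X i t w - Y t w)) - 0) < \<kappa> \<longrightarrow> (\<forall>t\<in>{0..T}. norm (X i t w - Y t w) \<le> \<kappa>)"
        using elim(2)
      proof eventually_elim
        case (elim w)
        have "continuous_on {0..T} (\<lambda>t. norm (X i t w - Y t w))"
          by (intro continuous_on_norm) (auto intro: continuous_on_subset[OF elim])
        then have "compact ((\<lambda>t. norm (X i t w - Y t w)) ` {0..T})"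
          by (rule compact_continuous_image) simp
        then have bdd: "bdd_above ((\<lambda>t. norm (X i t w - Y t w)) ` {0..T})"
          by (intro bounded_imp_bdd_above compact_imp_bounded)
        show ?case
        proof (intro impI ballI)
          fix t assume *: "norm ((SUP t\<in>{0..T}. norm (X i t w - Y t w)) - 0) < \<kappa>" and "t \<in> {0..T}"
          then have "norm (X i t w - Y t w) \<le> (SUP t\<in>{0..T}. norm (X i t w - Y t w))"
            by (intro cSUP_upper bdd)
          with * show "norm (X i t w - Y t w) \<le> \<kappa>" by simp
        qed
      qed
    qed (use \<eta> in auto)
  qed
  obtain Q where Q: "\<forall>\<^sub>F i in G. has_quadratic_variation P (\<lambda>t w. X i t w - Y t w) T (Q i)"
    "tendsto_in_prob P Q (\<lambda>_. 0) G"
    using assms(1,3) by (auto simp: process_tendsto_def)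
  have "\<forall>\<^sub>F i in G. likely P (\<eta>/2) (\<lambda>w. norm (Q i w - 0) < \<kappa>/2)"
    using Q(2) \<kappa> \<eta> unfolding tendsto_in_prob_likely by (meson half_gt_zero)
  with Q(1) show "\<forall>\<^sub>F i in G. \<exists>\<delta>>0. \<forall>N \<tau>. part 0 T \<delta> N \<tau> \<longrightarrow> likely P \<eta>
      (\<lambda>w. (\<Sum>k<N. (norm (incr (\<lambda>t w. X i t w - Y t w) \<tau> k w))\<^sup>2) \<le> \<kappa>)"
  proof eventually_elim
    case (elim i)
    define S where "S N \<tau> w = (\<Sum>k<N. (norm (incr (\<lambda>t w. X i t w - Y t w) \<tau> k w))\<^sup>2)" for N \<tau> w
    have "0 < \<kappa>/2" "0 < \<eta>/2" using \<kappa> \<eta> by auto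
    then obtain \<delta> where \<delta>: "0 < \<delta>" "\<And>N \<tau>. part 0 T \<delta> N \<tau> \<Longrightarrow> likely P (\<eta>/2) (\<lambda>w. \<bar>S N \<tau> w - Q i w\<bar> < \<kappa>/2)"
      unfolding S_def by (rule has_quadratic_variation_likely[OF elim(1)]) auto
    have "likely P \<eta> (\<lambda>w. S N \<tau> w \<le> \<kappa>)" if "part 0 T \<delta> N \<tau>" for N \<tau>
    proof (rule likely_mp[OF \<delta>(2)[OF that] elim(2)])
      fix w assume "\<bar>S N \<tau> w - Q i w\<bar> < \<kappa>/2" "norm (Q i w - 0) < \<kappa>/2"
      then have "S N \<tau> w < \<kappa>/2 + \<kappa>/2" by (simp only: real_norm_def diff_0_right abs_less_iff) linarith
      then show "S N \<tau> w \<le> \<kappa>" by simp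
    qed simp
    with \<delta>(1) show ?case unfolding S_def by blast
  qed
qed

section \<open>Limits of Stratonovich sums\<close>

lemma ssum_limit_diff_quotient:
  assumes "ssum_limit X A" "ssum_limit X' A'" and c: "c \<noteq> 0"
  shows "ssum_limit (\<lambda>t w. (X t w - X' t w) / c) (\<lambda>t w. (A t w - A' t w) / c)"
  unfolding ssum_limit_def
proof (intro allI impI)
  fix t e \<eta> :: real assume t: "0 \<le> t" and "0 < e" "0 < \<eta>"
  define e' where "e' = e * \<bar>c\<bar> / 2"
  have e': "0 < e'" using \<open>0 < e\<close> c by (simp add: e'_def)
  have \<eta>: "0 < \<eta>/2" using \<open>0 < \<eta>\<close> by simp
  obtain d where d: "0 < d" "\<And>N \<tau>. part 0 t d N \<tau> \<Longrightarrow> likely P (\<eta>/2) (\<lambda>w. \<bar>ssum X N \<tau> w - A t w\<bar> < e')"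
    using assms(1) t e' \<eta> unfolding ssum_limit_def by meson
  obtain d' where d': "0 < d'" "\<And>N \<tau>. part 0 t d' N \<tau> \<Longrightarrow> likely P (\<eta>/2) (\<lambda>w. \<bar>ssum X' N \<tau> w - A' t w\<bar> < e')"
    using assms(2) t e' \<eta> unfolding ssum_limit_def by meson
  have "likely P \<eta> (\<lambda>w. \<bar>ssum (\<lambda>t w. (X t w - X' t w) / c) N \<tau> w - (A t w - A' t w) / c\<bar> < e)"
    if p: "part 0 t (min d d') N \<tau>" for N \<tau>
  proof (rule likely_mp[OF d(2) d'(2)])
    show "part 0 t d N \<tau>" "part 0 t d' N \<tau>" using part_mono[OF p] by auto
    fix w assume *: "\<bar>ssum X N \<tau> w - A t w\<bar> < e'" "\<bar>ssum X' N \<tau> w - A' t w\<bar> < e'"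
    have "ssum (\<lambda>t w. (X t w - X' t w) / c) N \<tau> w = (ssum X N \<tau> w - ssum X' N \<tau> w) / c"
      unfolding ssum_def sum_subtractf[symmetric] sum_divide_distrib
      by (rule sum.cong) (use c in \<open>auto simp: field_simps\<close>)
    then have "ssum (\<lambda>t w. (X t w - X' t w) / c) N \<tau> w - (A t w - A' t w) / c =
      ((ssum X N \<tau> w - A t w) - (ssum X' N \<tau> w - A' t w)) / c"
      by (simp add: diff_divide_distrib)
    moreover have "\<bar>(ssum X N \<tau> w - A t w) - (ssum X' N \<tau> w - A' t w)\<bar> < e * \<bar>c\<bar>"
      using * unfolding e'_def by linarith
    ultimately show "\<bar>ssum (\<lambda>t w. (X t w - X' t w) / c) N \<tau> w - (A t w - A' t w) / c\<bar> < e"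
      using c by (simp add: abs_divide pos_divide_less_eq)
  qed simp
  then show "\<exists>\<delta>>0. \<forall>N \<tau>. part 0 t \<delta> N \<tau> \<longrightarrow>
      likely P \<eta> (\<lambda>w. \<bar>ssum (\<lambda>t w. (X t w - X' t w) / c) N \<tau> w - (A t w - A' t w) / c\<bar> < e)"
    using d(1) d'(1) by (intro exI[of _ "min d d'"]) auto
qed

text \<open>The trapezoidal sum is a left-point sum, for the isometry, plus half the sum of products
  of increments, for Young's inequality. The threshold \<kappa> depends neither on the integrand nor
  on the partition, as the passage to the limit requires.\<close>

lemma ssum_small:
  assumes "0 \<le> T" "0 < e" "0 < \<eta>"
  shows "\<exists>\<kappa>>0. \<forall>X \<delta> N \<tau>. (\<forall>t\<ge>0. X t \<in> borel_measurable (F t)) \<longrightarrow>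
    likely P (\<eta>/4) (\<lambda>w. \<forall>t\<in>{0..T}. \<bar>X t w\<bar> \<le> \<kappa>) \<longrightarrow> part 0 T \<delta> N \<tau> \<longrightarrow>
    likely P (\<eta>/4) (\<lambda>w. (\<Sum>k<N. (incr X \<tau> k w)\<^sup>2) \<le> \<kappa>) \<longrightarrow>
    likely P \<eta> (\<lambda>w. \<bar>ssum X N \<tau> w\<bar> < e)"
proof -
  define C where "C = 4 * T / \<eta> + 1"
  have C: "0 < C" using assms by (simp add: C_def add_nonneg_pos)
  have "T < \<eta>/4 * C" using assms by (simp add: C_def field_simps)
  \<comment> \<open>Both \<open>l * C\<close> and \<open>\<kappa> / l\<close> are then at most
    \<open>e / 4\<close>, and half of their sum is left over for the products of increments.\<close>
  define l where "l = e / (4 * C)"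
  have l: "0 < l" using assms C by (simp add: l_def)
  have lC: "l * C = e / 4" using C by (simp add: l_def)
  obtain \<kappa> where "0 < \<kappa>" "\<kappa> \<le> l * e / 4" "\<kappa>\<^sup>2 * T < \<eta>/4 * (e/2)\<^sup>2"
    using small_square[of "l * e / 4" "\<eta>/4 * (e/2)\<^sup>2" T] assms l by auto
  moreover have "\<kappa> / l \<le> e / 4" using \<open>\<kappa> \<le> l * e / 4\<close> l by (simp add: field_simps)
  moreover have "likely P \<eta> (\<lambda>w. \<bar>ssum X N \<tau> w\<bar> < e)"
    if X: "\<forall>t\<ge>0. X t \<in> borel_measurable (F t)" and bd: "likely P (\<eta>/4) (\<lambda>w. \<forall>t\<in>{0..T}. \<bar>X t w\<bar> \<le> \<kappa>)"
      and p: "part 0 T \<delta> N \<tau>" and qv: "likely P (\<eta>/4) (\<lambda>w. (\<Sum>k<N. (incr X \<tau> k w)\<^sup>2) \<le> \<kappa>)"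
    for X \<delta> N \<tau>
  proof -
    have t: "0 \<le> \<tau> k" "\<tau> k \<le> T" if "k \<le> N" for k using part_bounds[OF p that] .
    have m: "likely P (\<eta>/4 + \<eta>/4) (\<lambda>w. \<bar>\<Sum>k<N. X (\<tau> k) w * incr W \<tau> k w\<bar> < e/2)"
    proof (rule likely_martingale_sum[OF p])
      show "likely P (\<eta>/4) (\<lambda>w. \<forall>k<N. \<bar>X (\<tau> k) w\<bar> \<le> \<kappa>)"
        using bd by (rule likely_mono) (use t in auto)
    qed (use X t \<open>\<kappa>\<^sup>2 * T < _\<close> \<open>0 < \<kappa>\<close> \<open>0 < e\<close> in auto)
    have dw: "likely P (\<eta>/4) (\<lambda>w. (\<Sum>k<N. (incr W \<tau> k w)\<^sup>2) < C)"
      by (rule likely_W_quadratic[OF p]) (use C \<open>T < _\<close> in auto)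
    show ?thesis
    proof (rule likely_mono[OF likely_conj[OF m likely_conj[OF dw qv]]])
      fix w assume "\<bar>\<Sum>k<N. X (\<tau> k) w * incr W \<tau> k w\<bar> < e/2 \<and>
         (\<Sum>k<N. (incr W \<tau> k w)\<^sup>2) < C \<and> (\<Sum>k<N. (incr X \<tau> k w)\<^sup>2) \<le> \<kappa>"
      then have a: "\<bar>\<Sum>k<N. X (\<tau> k) w * incr W \<tau> k w\<bar> < e/2"
        and b: "(\<Sum>k<N. (incr W \<tau> k w)\<^sup>2) \<le> C" and c: "(\<Sum>k<N. (incr X \<tau> k w)\<^sup>2) \<le> \<kappa>"
        by auto
      define R where "R = (\<Sum>k<N. incr W \<tau> k w * incr X \<tau> k w)"
      have "ssum X N \<tau> w = (\<Sum>k<N. X (\<tau> k) w * incr W \<tau> k w) + R / 2"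
        unfolding ssum_def R_def sum_divide_distrib sum.distrib[symmetric]
        by (rule sum.cong) (auto simp: field_simps)
      moreover have "\<bar>R\<bar> \<le> e / 2"
      proof -
        have "\<bar>R\<bar> \<le> (\<Sum>k<N. l * (incr W \<tau> k w)\<^sup>2 + (incr X \<tau> k w)\<^sup>2 / l)"
          unfolding R_def by (rule order_trans[OF sum_abs], rule sum_mono, rule abs_mult_le_weighted[OF l])
        also have "\<dots> = l * (\<Sum>k<N. (incr W \<tau> k w)\<^sup>2) + (\<Sum>k<N. (incr X \<tau> k w)\<^sup>2) / l"
          by (simp add: sum.distrib sum_distrib_left sum_divide_distrib)
        also have "\<dots> \<le> l * C + \<kappa> / l"
          by (intro add_mono mult_left_mono divide_right_mono b c) (use l in auto)
        finally show ?thesis using lC \<open>\<kappa> / l \<le> e / 4\<close> by linarith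
      qed
      ultimately show "\<bar>ssum X N \<tau> w\<bar> < e" using a \<open>0 < e\<close> by linarith
    qed auto
  qed
  ultimately show ?thesis by blast
qed

text \<open>A three-term estimate with a single index \<open>i\<close>: once \<kappa> is fixed by
  \<open>ssum_small\<close>, one \<open>i\<close> far enough along the filter is chosen, and only
  then the mesh threshold for that \<open>i\<close>. No uniformity over \<open>i\<close> is
  involved.\<close>

lemma ssum_limit_closure:
  fixes Y :: "real \<Rightarrow> 'a \<Rightarrow> real" and Ye :: "'i \<Rightarrow> real \<Rightarrow> 'a \<Rightarrow> real"
  assumes G: "G \<noteq> bot"
    and lim: "\<forall>\<^sub>F i in G. ssum_limit (Ye i) (Ae i)"
    and A: "\<And>t e \<eta>. 0 \<le> t \<Longrightarrow> 0 < e \<Longrightarrow> 0 < \<eta> \<Longrightarrow> \<forall>\<^sub>F i in G. likely P \<eta> (\<lambda>w. \<bar>Ae i t w - A t w\<bar> < e)"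
    and Y: "\<And>T \<kappa> \<eta>. 0 \<le> T \<Longrightarrow> 0 < \<kappa> \<Longrightarrow> 0 < \<eta> \<Longrightarrow> \<forall>\<^sub>F i in G. likely P \<eta> (\<lambda>w. \<forall>t\<in>{0..T}. \<bar>Ye i t w - Y t w\<bar> \<le> \<kappa>)"
      "\<And>T \<kappa> \<eta>. 0 \<le> T \<Longrightarrow> 0 < \<kappa> \<Longrightarrow> 0 < \<eta> \<Longrightarrow> \<forall>\<^sub>F i in G. \<exists>\<delta>>0. \<forall>N \<tau>. part 0 T \<delta> N \<tau> \<longrightarrow> likely P \<eta>
        (\<lambda>w. (\<Sum>k<N. (incr (\<lambda>t w. Ye i t w - Y t w) \<tau> k w)\<^sup>2) \<le> \<kappa>)"
    and m: "\<And>t. 0 \<le> t \<Longrightarrow> Y t \<in> borel_measurable (F t)"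
      "\<forall>\<^sub>F i in G. \<forall>t\<ge>0. Ye i t \<in> borel_measurable (F t)"
  shows "ssum_limit Y A"
  unfolding ssum_limit_def
proof (intro allI impI)
  fix T e \<eta> :: real assume T: "0 \<le> T" and e: "0 < e" and \<eta>: "0 < \<eta>"
  have e3: "0 < e/3" and \<eta>3: "0 < \<eta>/3" using e \<eta> by auto
  obtain \<kappa> where \<kappa>: "0 < \<kappa>" "\<And>X \<delta> N \<tau>. (\<forall>t\<ge>0. X t \<in> borel_measurable (F t)) \<Longrightarrow>
    likely P (\<eta>/3/4) (\<lambda>w. \<forall>t\<in>{0..T}. \<bar>X t w\<bar> \<le> \<kappa>) \<Longrightarrow> part 0 T \<delta> N \<tau> \<Longrightarrow>
    likely P (\<eta>/3/4) (\<lambda>w. (\<Sum>k<N. (incr X \<tau> k w)\<^sup>2) \<le> \<kappa>) \<Longrightarrow>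
    likely P (\<eta>/3) (\<lambda>w. \<bar>ssum X N \<tau> w\<bar> < e/3)"
    using ssum_small[OF T e3 \<eta>3] by blast
  have \<eta>34: "0 < \<eta>/3/4" using \<eta> by simp
  have "\<forall>\<^sub>F i in G. ssum_limit (Ye i) (Ae i) \<and> likely P (\<eta>/3) (\<lambda>w. \<bar>Ae i T w - A T w\<bar> < e/3) \<and>
     likely P (\<eta>/3/4) (\<lambda>w. \<forall>t\<in>{0..T}. \<bar>Ye i t w - Y t w\<bar> \<le> \<kappa>) \<and>
     (\<exists>\<delta>>0. \<forall>N \<tau>. part 0 T \<delta> N \<tau> \<longrightarrow> likely P (\<eta>/3/4)
        (\<lambda>w. (\<Sum>k<N. (incr (\<lambda>t w. Ye i t w - Y t w) \<tau> k w)\<^sup>2) \<le> \<kappa>)) \<and>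
     (\<forall>t\<ge>0. Ye i t \<in> borel_measurable (F t))"
    using lim A[OF T e3 \<eta>3] Y(1)[OF T \<kappa>(1) \<eta>34] Y(2)[OF T \<kappa>(1) \<eta>34] m(2)
    by eventually_elim (intro conjI)
  from eventually_happens'[OF G this] obtain i \<delta> where i: "ssum_limit (Ye i) (Ae i)" "likely P (\<eta>/3) (\<lambda>w. \<bar>Ae i T w - A T w\<bar> < e/3)"
     "likely P (\<eta>/3/4) (\<lambda>w. \<forall>t\<in>{0..T}. \<bar>Ye i t w - Y t w\<bar> \<le> \<kappa>)" "0 < \<delta>"
     "\<And>N \<tau>. part 0 T \<delta> N \<tau> \<Longrightarrow> likely P (\<eta>/3/4)
        (\<lambda>w. (\<Sum>k<N. (incr (\<lambda>t w. Ye i t w - Y t w) \<tau> k w)\<^sup>2) \<le> \<kappa>)"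
     "\<And>t. 0 \<le> t \<Longrightarrow> Ye i t \<in> borel_measurable (F t)" by blast
  obtain d where d: "0 < d" "\<And>N \<tau>. part 0 T d N \<tau> \<Longrightarrow> likely P (\<eta>/3) (\<lambda>w. \<bar>ssum (Ye i) N \<tau> w - Ae i T w\<bar> < e/3)"
    using i(1) T e3 \<eta>3 unfolding ssum_limit_def by meson
  have "likely P \<eta> (\<lambda>w. \<bar>ssum Y N \<tau> w - A T w\<bar> < e)" if "part 0 T (min d \<delta>) N \<tau>" for N \<tau>
  proof -
    have p: "part 0 T d N \<tau>" "part 0 T \<delta> N \<tau>" using part_mono[OF that] by auto
    have "likely P (\<eta>/3) (\<lambda>w. \<bar>ssum (\<lambda>t w. Ye i t w - Y t w) N \<tau> w\<bar> < e/3)"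
      by (rule \<kappa>(2)[OF _ i(3) p(2) i(5)[OF p(2)]]) (use m(1) i(6) in auto)
    note all = likely_conj[OF this likely_conj[OF i(2) d(2)[OF p(1)]]]
    from all show ?thesis
    proof (rule likely_mono)
      fix w assume *: "\<bar>ssum (\<lambda>t w. Ye i t w - Y t w) N \<tau> w\<bar> < e/3 \<and> \<bar>Ae i T w - A T w\<bar> < e/3 \<and> \<bar>ssum (Ye i) N \<tau> w - Ae i T w\<bar> < e/3"
      have "ssum (\<lambda>t w. Ye i t w - Y t w) N \<tau> w = ssum (Ye i) N \<tau> w - ssum Y N \<tau> w"
        unfolding ssum_def sum_subtractf[symmetric] by (rule sum.cong) (auto simp: field_simps)
      with * have "\<bar>ssum Y N \<tau> w - A T w\<bar> < e/3 + e/3 + e/3" by linarith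
      then show "\<bar>ssum Y N \<tau> w - A T w\<bar> < e" by simp
    qed simp
  qed
  then show "\<exists>\<delta>>0. \<forall>N \<tau>. part 0 T \<delta> N \<tau> \<longrightarrow> likely P \<eta> (\<lambda>w. \<bar>ssum Y N \<tau> w - A T w\<bar> < e)"
    using d(1) i(4) by (intro exI[of _ "min d \<delta>"]) auto
qed

end

section \<open>The variational equation\<close>

lemma dx_nth:
  fixes f :: "real \<Rightarrow> real \<Rightarrow> 'a \<Rightarrow> real^'n"
  assumes "(\<lambda>y. f t y w) differentiable (at x)"
  shows "dx (\<lambda>t x w. f t x w $ i) t x w = dx f t x w $ i"
    and "((\<lambda>y. f t y w $ i) has_vector_derivative dx f t x w $ i) (at x)"
proof -
  have "((\<lambda>y. f t y w) has_vector_derivative dx f t x w) (at x)"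
    using assms unfolding dx_def by (simp add: vector_derivative_works)
  from bounded_linear.has_vector_derivative[OF bounded_linear_vec_nth this]
  show "((\<lambda>y. f t y w $ i) has_vector_derivative dx f t x w $ i) (at x)" .
  then show "dx (\<lambda>t x w. f t x w $ i) t x w = dx f t x w $ i"
    using vector_derivative_at by (auto simp: dx_def)
qed

lemma dx_scaled_diff:
  assumes "(\<lambda>y. f t y w) differentiable (at x)" "(\<lambda>y. g t y w) differentiable (at x)"
  shows "dx (\<lambda>t x w. c *\<^sub>R (f t x w - g t x w)) t x w = c *\<^sub>R (dx f t x w - dx g t x w)"
proof -
  have "((\<lambda>y. f t y w) has_vector_derivative dx f t x w) (at x)" "((\<lambda>y. g t y w) has_vector_derivative dx g t x w) (at x)"
    using assms unfolding dx_def by (simp_all add: vector_derivative_works)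
  from bounded_linear.has_vector_derivative[OF bounded_linear_scaleR_right has_vector_derivative_diff[OF this], of c]
  show ?thesis using vector_derivative_at by (auto simp: dx_def)
qed

context brownian
begin

lemma ssum_component:
  fixes X :: "real \<Rightarrow> 'a \<Rightarrow> real^'n"
  shows "stratonovich_sum W X (N, \<tau>) w $ i = ssum (\<lambda>t w. X t w $ i) N \<tau> w"
  by (simp add: stratonovich_sum_def ssum_def)

lemma has_stratonovich_integral_likely:
  assumes "stratonovich_integrable P W X a b" "0 < e" "0 < \<eta>"
  shows "\<exists>\<delta>>0. \<forall>N \<tau>. part a b \<delta> N \<tau> \<longrightarrow>
    likely P \<eta> (\<lambda>w. norm (stratonovich_sum W X (N, \<tau>) w - stratonovich_integral P W X a b w) < e)"
proof -
  have "has_stratonovich_integral P W X a b (stratonovich_integral P W X a b)"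
    using assms(1) unfolding stratonovich_integrable_def stratonovich_integral_def by (rule someI_ex)
  then show ?thesis
    using assms(2,3) unfolding has_stratonovich_integral_def tendsto_in_prob_mesh by blast
qed

lemma regular_fieldD:
  assumes "regular_field P F f"
  shows "AE w in P. \<forall>t\<ge>0. \<forall>x. (\<lambda>y. f t y w) differentiable (at x)"
    and "regular_process P F (\<lambda>t. f t x)" "regular_process P F (\<lambda>t. dx f t x)"
  using assms by (auto simp: regular_field_def)

lemma regular_processD:
  assumes "regular_process P F X"
  shows "0 \<le> t \<Longrightarrow> X t \<in> borel_measurable (F t)" "AE w in P. continuous_on {0..} (\<lambda>t. X t w)"
  using assms by (auto simp: regular_process_def adapted_def continuous_process_def)

text \<open>A row of the system solved for its stochastic term. It restates the equation as a
  property of trapezoidal sums, which is stable under difference quotients and limits.\<close>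

lemma solution_component:
  assumes sol: "is_solution P F W \<sigma> z" and S2: "\<And>u. grad S2 u $ i = 0"
  shows "ssum_limit (\<lambda>t w. (matK *v dx z t x w) $ i)
    (\<lambda>t w. integral {0..t} (\<lambda>s. grad (S1 \<sigma>) (z s x w) $ i) - (matM *v (z t x w - z 0 x w)) $ i)"
  unfolding ssum_limit_def
proof (intro allI impI)
  fix t e \<eta> :: real assume t: "0 \<le> t" and e: "0 < e" and \<eta>: "0 < \<eta>"
  define IK where "IK = stratonovich_integral P W (\<lambda>s w. matK *v dx z s x w) 0 t"
  define IS where "IS = stratonovich_integral P W (\<lambda>s w. grad S2 (z s x w)) 0 t"
  have int: "stratonovich_integrable P W (\<lambda>s w. matK *v dx z s x w) 0 t"
    "stratonovich_integrable P W (\<lambda>s w. grad S2 (z s x w)) 0 t"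
    and eq: "AE w in P. matM *v (z t x w - z 0 x w) + IK w = integral {0..t} (\<lambda>s. grad (S1 \<sigma>) (z s x w)) + IS w"
    using sol t unfolding is_solution_def IK_def IS_def by blast+
  have e2: "0 < e/2" "0 < \<eta>/4" using e \<eta> by auto
  obtain d where d: "0 < d" "\<And>N \<tau>. part 0 t d N \<tau> \<Longrightarrow>
    likely P (\<eta>/4) (\<lambda>w. norm (stratonovich_sum W (\<lambda>s w. matK *v dx z s x w) (N, \<tau>) w - IK w) < e/2)"
    using has_stratonovich_integral_likely[OF int(1) e2] unfolding IK_def by blast
  obtain d' where d': "0 < d'" "\<And>N \<tau>. part 0 t d' N \<tau> \<Longrightarrow>
    likely P (\<eta>/4) (\<lambda>w. norm (stratonovich_sum W (\<lambda>s w. grad S2 (z s x w)) (N, \<tau>) w - IS w) < e/2)"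
    using has_stratonovich_integral_likely[OF int(2) e2] unfolding IS_def by blast
  have cz: "AE w in P. continuous_on {0..} (\<lambda>t. z t x w)"
    by (rule regular_processD(2)[OF regular_fieldD(2)]) (use sol in \<open>simp add: is_solution_def\<close>)
  have "AE w in P. (matM *v (z t x w - z 0 x w)) $ i + IK w $ i = integral {0..t} (\<lambda>s. grad (S1 \<sigma>) (z s x w) $ i) + IS w $ i"
    using eq cz
  proof eventually_elim
    case (elim w)
    have "(\<lambda>s. grad (S1 \<sigma>) (z s x w)) integrable_on {0..t}"
      by (intro integrable_continuous_real continuous_on_grad_S1 continuous_on_subset[OF elim(2)]) auto
    from integral_component_eq_cart[OF this, of i] elim(1)[THEN arg_cong, of "\<lambda>v. v $ i"] show ?case by simp
  qed
  note ae = likely_AE[OF this, of "\<eta>/4"]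
  have "likely P \<eta> (\<lambda>w. \<bar>ssum (\<lambda>t w. (matK *v dx z t x w) $ i) N \<tau> w -
      (integral {0..t} (\<lambda>s. grad (S1 \<sigma>) (z s x w) $ i) - (matM *v (z t x w - z 0 x w)) $ i)\<bar> < e)"
    if p: "part 0 t (min d d') N \<tau>" for N \<tau>
  proof -
    have p': "part 0 t d N \<tau>" "part 0 t d' N \<tau>" using part_mono[OF p] by auto
    note all = likely_conj[OF d(2)[OF p'(1)] likely_conj[OF d'(2)[OF p'(2)] ae[OF e2(2)]]]
    from all show ?thesis
    proof (rule likely_mono)
      fix w assume *: "norm (stratonovich_sum W (\<lambda>s w. matK *v dx z s x w) (N, \<tau>) w - IK w) < e/2 \<and>
        norm (stratonovich_sum W (\<lambda>s w. grad S2 (z s x w)) (N, \<tau>) w - IS w) < e/2 \<and>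
        (matM *v (z t x w - z 0 x w)) $ i + IK w $ i = integral {0..t} (\<lambda>s. grad (S1 \<sigma>) (z s x w) $ i) + IS w $ i"
      have "\<bar>ssum (\<lambda>t w. (matK *v dx z t x w) $ i) N \<tau> w - IK w $ i\<bar> < e/2"
        using * component_le_norm_cart[of "stratonovich_sum W (\<lambda>s w. matK *v dx z s x w) (N, \<tau>) w - IK w" i]
        by (simp add: ssum_component del: matrix_vector_mult_diff_distrib)
      \<comment> \<open>All sums of this component vanish, so the estimate of their distance to the
        integral bounds the integral itself.\<close>
      moreover have "\<bar>IS w $ i\<bar> < e/2"
        using * component_le_norm_cart[of "stratonovich_sum W (\<lambda>s w. grad S2 (z s x w)) (N, \<tau>) w - IS w" i]
        by (simp add: ssum_component S2) (simp add: ssum_def)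
      ultimately show "\<bar>ssum (\<lambda>t w. (matK *v dx z t x w) $ i) N \<tau> w -
         (integral {0..t} (\<lambda>s. grad (S1 \<sigma>) (z s x w) $ i) - (matM *v (z t x w - z 0 x w)) $ i)\<bar> < e"
        using * by linarith
    qed (use \<eta> in auto)
  qed
  then show "\<exists>\<delta>>0. \<forall>N \<tau>. part 0 t \<delta> N \<tau> \<longrightarrow> likely P \<eta> (\<lambda>w. \<bar>ssum (\<lambda>t w. (matK *v dx z t x w) $ i) N \<tau> w -
      (integral {0..t} (\<lambda>s. grad (S1 \<sigma>) (z s x w) $ i) - (matM *v (z t x w - z 0 x w)) $ i)\<bar> < e)"
    using d(1) d'(1) by (intro exI[of _ "min d d'"]) auto
qed

text \<open>The factors \<open>1\<close> and \<open>- 1\<close> are written out so that both rows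
  have the shape that \<open>variational_limit\<close> linearises.\<close>

lemma solution_limits:
  assumes "is_solution P F W \<sigma> z"
  shows "ssum_limit (\<lambda>t w. dx z t x w $ 3)
      (\<lambda>t w. integral {0..t} (\<lambda>s. S1_p \<sigma> (z s x w)) + 1 * (z t x w $ 2 - z 0 x w $ 2))"
    and "ssum_limit (\<lambda>t w. dx z t x w $ 4)
      (\<lambda>t w. integral {0..t} (\<lambda>s. S1_q \<sigma> (z s x w)) + (- 1) * (z t x w $ 1 - z 0 x w $ 1))"
proof -
  show "ssum_limit (\<lambda>t w. dx z t x w $ 3)
      (\<lambda>t w. integral {0..t} (\<lambda>s. S1_p \<sigma> (z s x w)) + 1 * (z t x w $ 2 - z 0 x w $ 2))"
    using solution_component[OF assms grad_S2(1), of x] unfolding grad_S1 matK_mult matM_mult by (simp add: algebra_simps)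
  show "ssum_limit (\<lambda>t w. dx z t x w $ 4)
      (\<lambda>t w. integral {0..t} (\<lambda>s. S1_q \<sigma> (z s x w)) + (- 1) * (z t x w $ 1 - z 0 x w $ 1))"
    using solution_component[OF assms grad_S2(2), of x] unfolding grad_S1 matK_mult matM_mult by (simp add: algebra_simps)
qed

end

section \<open>Difference quotients along one variation\<close>

locale variation = brownian P F W for P :: "'a measure" and F W +
  fixes \<sigma> :: nat and U :: "'a datum set" and Z :: "'a datum \<Rightarrow> real \<Rightarrow> real \<Rightarrow> 'a \<Rightarrow> real^4"
    and \<phi> :: "'a datum" and dz :: "'a datum \<Rightarrow> real \<Rightarrow> real \<Rightarrow> 'a \<Rightarrow> real^4" and h :: "'a datum"
  assumes flow: "solution_flow P F W \<sigma> U Z" and \<phi>: "\<phi> \<in> U"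
    and ext: "is_exterior_differential P F U Z \<phi> dz" and h: "h \<in> variations U \<phi>"
begin

lemma sol: "is_solution P F W \<sigma> (Z \<phi>)"
  using flow \<phi> by (auto simp: solution_flow_def)

abbreviation "Zs \<epsilon> \<equiv> Z (shift \<phi> h \<epsilon>)"

lemma sol_shift: "\<forall>\<^sub>F \<epsilon> in at 0. \<epsilon> \<noteq> 0 \<and> is_solution P F W \<sigma> (Zs \<epsilon>)"
proof -
  have "\<forall>\<^sub>F \<epsilon> in at 0. shift \<phi> h \<epsilon> \<in> U" using h by (simp add: variations_def)
  moreover have "\<forall>\<^sub>F \<epsilon> in at (0::real). \<epsilon> \<noteq> 0" by (rule eventually_neq_at_within)
  ultimately show ?thesis by eventually_elim (use flow in \<open>auto simp: solution_flow_def\<close>)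
qed

lemma reg_z: "regular_field P F (Z \<phi>)" and reg_dz: "regular_field P F (dz h)"
  using sol ext h by (auto simp: is_solution_def is_exterior_differential_def)

definition DQ :: "real \<Rightarrow> real \<Rightarrow> real \<Rightarrow> 'a \<Rightarrow> real^4" where
  "DQ \<epsilon> t x w = (1 / \<epsilon>) *\<^sub>R (Zs \<epsilon> t x w - Z \<phi> t x w)"

text \<open>It equals \<open>dx (DQ \<epsilon>)\<close> almost surely, where both fields are
  differentiable. This form is adapted because its two terms are, a property that a change on a null
  set could destroy.\<close>

definition DQx :: "real \<Rightarrow> real \<Rightarrow> real \<Rightarrow> 'a \<Rightarrow> real^4" where
  "DQx \<epsilon> t x w = (1 / \<epsilon>) *\<^sub>R (dx (Zs \<epsilon>) t x w - dx (Z \<phi>) t x w)"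

lemma field_conv: "process_tendsto P (\<lambda>\<epsilon> t. DQ \<epsilon> t x) (\<lambda>t. dz h t x) (at 0)"
    "process_tendsto P (\<lambda>\<epsilon> t. dx (DQ \<epsilon>) t x) (\<lambda>t. dx (dz h) t x) (at 0)"
  using ext h unfolding is_exterior_differential_def field_tendsto_def DQ_def[abs_def] by blast+

lemma shift_regular: "\<forall>\<^sub>F \<epsilon> in at 0. \<epsilon> \<noteq> 0 \<and> regular_field P F (Zs \<epsilon>)"
  using sol_shift by eventually_elim (simp add: is_solution_def)

lemma dx_DQ: "\<forall>\<^sub>F \<epsilon> in at 0. AE w in P. \<forall>t\<ge>0. \<forall>x. dx (DQ \<epsilon>) t x w = DQx \<epsilon> t x w"
  using shift_regular
proof eventually_elim
  case (elim \<epsilon>)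
  from regular_fieldD(1)[OF elim[THEN conjunct2]] regular_fieldD(1)[OF reg_z] show ?case
    by eventually_elim (auto simp: DQ_def[abs_def] DQx_def dx_scaled_diff)
qed

lemma continuous_DQ: "\<forall>\<^sub>F \<epsilon> in at 0. AE w in P. continuous_on {0..} (\<lambda>t. DQ \<epsilon> t x w - dz h t x w)"
  using shift_regular
proof eventually_elim
  case (elim \<epsilon>)
  from regular_processD(2)[OF regular_fieldD(2)[OF elim[THEN conjunct2]], of x]
    regular_processD(2)[OF regular_fieldD(2)[OF reg_z], of x]
    regular_processD(2)[OF regular_fieldD(2)[OF reg_dz], of x]
  show ?case unfolding DQ_def by eventually_elim (intro continuous_intros)
qed

lemma continuous_DQx: "\<forall>\<^sub>F \<epsilon> in at 0. AE w in P. continuous_on {0..} (\<lambda>t. dx (DQ \<epsilon>) t x w - dx (dz h) t x w)"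
  using shift_regular dx_DQ
proof eventually_elim
  case (elim \<epsilon>)
  from regular_processD(2)[OF regular_fieldD(3)[OF elim(1)[THEN conjunct2]], of x]
    regular_processD(2)[OF regular_fieldD(3)[OF reg_z], of x]
    regular_processD(2)[OF regular_fieldD(3)[OF reg_dz], of x] elim(2)
  show ?case
  proof eventually_elim
    case (elim w)
    have "continuous_on {0..} (\<lambda>t. DQx \<epsilon> t x w - dx (dz h) t x w)"
      unfolding DQx_def by (intro continuous_intros elim)
    then show ?case by (rule continuous_on_eq) (use elim in auto)
  qed
qed

lemma DQ_likely:
  assumes "0 \<le> T" "0 < \<kappa>" "0 < \<eta>"
  shows "\<forall>\<^sub>F \<epsilon> in at 0. likely P \<eta> (\<lambda>w. \<forall>t\<in>{0..T}. norm (DQ \<epsilon> t x w - dz h t x w) \<le> \<kappa>)"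
  by (rule process_tendsto_likely(1)[OF field_conv(1) continuous_DQ assms])

lemma DQx_likely:
  assumes "0 \<le> T" "0 < \<kappa>" "0 < \<eta>"
  shows "\<forall>\<^sub>F \<epsilon> in at 0. likely P \<eta> (\<lambda>w. \<forall>t\<in>{0..T}. norm (DQx \<epsilon> t x w - dx (dz h) t x w) \<le> \<kappa>)"
proof -
  have "0 < \<eta>/2" using assms by simp
  from process_tendsto_likely(1)[OF field_conv(2) continuous_DQx assms(1,2) this, of x] dx_DQ
  show ?thesis
  proof eventually_elim
    case (elim \<epsilon>)
    from elim(1) show ?case
    proof (rule likely_AE_mp)
      show "AE w in P. (\<forall>t\<in>{0..T}. norm (dx (DQ \<epsilon>) t x w - dx (dz h) t x w) \<le> \<kappa>) \<longrightarrow>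
          (\<forall>t\<in>{0..T}. norm (DQx \<epsilon> t x w - dx (dz h) t x w) \<le> \<kappa>)"
        using elim(2) by eventually_elim auto
    qed (use assms in auto)
  qed
qed

abbreviation "err \<epsilon> x i t w \<equiv> DQx \<epsilon> t x w $ i - dx (dz h) t x w $ i"
abbreviation "verr \<epsilon> x t w \<equiv> dx (DQ \<epsilon>) t x w - dx (dz h) t x w"

lemma DQx_component_quadratic:
  assumes "0 \<le> T" "0 < \<kappa>" "0 < \<eta>"
  shows "\<forall>\<^sub>F \<epsilon> in at 0. \<exists>\<delta>>0. \<forall>N \<tau>. part 0 T \<delta> N \<tau> \<longrightarrow> likely P \<eta>
    (\<lambda>w. (\<Sum>k<N. (incr (err \<epsilon> x i) \<tau> k w)\<^sup>2) \<le> \<kappa>)"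
proof -
  have "0 < \<eta>/2" using assms by simp
  from process_tendsto_likely(2)[OF field_conv(2) continuous_DQx assms(1,2) this, of x] dx_DQ
  show ?thesis
  proof eventually_elim
    case (elim \<epsilon>)
    from elim(1) obtain \<delta> where \<delta>: "0 < \<delta>" "\<And>N \<tau>. part 0 T \<delta> N \<tau> \<Longrightarrow> likely P (\<eta>/2)
      (\<lambda>w. (\<Sum>k<N. (norm (incr (verr \<epsilon> x) \<tau> k w))\<^sup>2) \<le> \<kappa>)" by blast
    have "likely P \<eta> (\<lambda>w. (\<Sum>k<N. (incr (err \<epsilon> x i) \<tau> k w)\<^sup>2) \<le> \<kappa>)" if p: "part 0 T \<delta> N \<tau>" for N \<tau>
    proof (rule likely_AE_mp[OF \<delta>(2)[OF p]])
      show "AE w in P. (\<Sum>k<N. (norm (incr (verr \<epsilon> x) \<tau> k w))\<^sup>2) \<le> \<kappa> \<longrightarrow>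
         (\<Sum>k<N. (incr (err \<epsilon> x i) \<tau> k w)\<^sup>2) \<le> \<kappa>"
        using elim(2)
      proof eventually_elim
        case (elim w)
        have "(\<Sum>k<N. (incr (err \<epsilon> x i) \<tau> k w)\<^sup>2) \<le>
          (\<Sum>k<N. (norm (incr (verr \<epsilon> x) \<tau> k w))\<^sup>2)"
        proof (rule sum_mono)
          fix k assume "k \<in> {..<N}"
          then have "0 \<le> \<tau> k" "0 \<le> \<tau> (Suc k)" using part_bounds(1)[OF p] by auto
          then have eq: "dx (DQ \<epsilon>) (\<tau> (Suc k)) x w = DQx \<epsilon> (\<tau> (Suc k)) x w" "dx (DQ \<epsilon>) (\<tau> k) x w = DQx \<epsilon> (\<tau> k) x w"
            using elim by auto
          let ?v = "(DQx \<epsilon> (\<tau> (Suc k)) x w - dx (dz h) (\<tau> (Suc k)) x w) - (DQx \<epsilon> (\<tau> k) x w - dx (dz h) (\<tau> k) x w)"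
          have "\<bar>?v $ i\<bar>\<^sup>2 \<le> (norm ?v)\<^sup>2" by (intro power_mono component_le_norm_cart) auto
          then show "(incr (err \<epsilon> x i) \<tau> k w)\<^sup>2 \<le> (norm (incr (verr \<epsilon> x) \<tau> k w))\<^sup>2"
            unfolding eq by simp
        qed
        then show ?case by linarith
      qed
    qed (use assms in auto)
    with \<delta>(1) show ?case by blast
  qed
qed

text \<open>Off a small event, the paths of the solution and of the tangent solution stay in a fixed
  ball on \<open>{0..t}\<close>. There the uniform estimate of the difference quotient can be
  integrated in time.\<close>

lemma linearised_drift:
  fixes g :: "real^4 \<Rightarrow> real"
  assumes g: "\<And>u. (g has_derivative g' u) (at u)"
    and g': "continuous_on UNIV (\<lambda>y. g' (fst y) (snd y))"
    and t: "0 \<le> t" and e: "0 < e" and \<eta>: "0 < \<eta>"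
  shows "\<forall>\<^sub>F \<epsilon> in at 0. likely P \<eta> (\<lambda>w.
    \<bar>(integral {0..t} (\<lambda>s. g (Zs \<epsilon> s x w)) - integral {0..t} (\<lambda>s. g (Z \<phi> s x w))) / \<epsilon>
      - integral {0..t} (\<lambda>s. g' (Z \<phi> s x w) (dz h s x w))\<bar> < e)"
proof -
  have \<eta>4: "0 < \<eta>/4" using \<eta> by simp
  obtain R1 where R1: "0 < R1" "likely P (\<eta>/4) (\<lambda>w. \<forall>s\<in>{0..t}. norm (Z \<phi> s x w) \<le> R1)"
    using regular_likely_bounded[OF regular_fieldD(2)[OF reg_z] t \<eta>4, of x] by blast
  obtain R2 where R2: "0 < R2" "likely P (\<eta>/4) (\<lambda>w. \<forall>s\<in>{0..t}. norm (dz h s x w) \<le> R2)"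
    using regular_likely_bounded[OF regular_fieldD(2)[OF reg_dz] t \<eta>4, of x] by blast
  \<comment> \<open>The summand 1 avoids a division by zero at \<open>t = 0\<close>.\<close>
  define e' where "e' = e / (2 * (t + 1))"
  have e': "0 < e'" "e' * t < e"
  proof -
    show "0 < e'" using assms by (simp add: e'_def)
    then have "e' * t \<le> e' * (t + 1)" by simp
    also have "\<dots> = e / 2"
    proof -
      have "e / (2 * c) * c = e / 2" if "c \<noteq> 0" for c using that by simp
      moreover have "t + 1 \<noteq> 0" using t by linarith
      ultimately show ?thesis unfolding e'_def by blast
    qed
    also have "\<dots> < e" using e by simp
    finally show "e' * t < e" .
  qed
  have "0 \<le> max R1 R2" using R1(1) by simp
  from difference_quotient_uniform[OF g g' e'(1) this]
  obtain d where d: "0 < d" "\<And>u \<xi> D \<epsilon>. norm u \<le> max R1 R2 \<Longrightarrow> norm \<xi> \<le> max R1 R2 \<Longrightarrow> norm (D - \<xi>) \<le> d \<Longrightarrow> \<epsilon> \<noteq> 0 \<Longrightarrow> \<bar>\<epsilon>\<bar> \<le> d \<Longrightarrow>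
    \<bar>(g (u + \<epsilon> *\<^sub>R D) - g u) / \<epsilon> - g' u \<xi>\<bar> \<le> e'"
    by blast
  have "\<forall>\<^sub>F \<epsilon> in at (0::real). \<bar>\<epsilon>\<bar> \<le> d"
    unfolding eventually_at using d(1) by (intro exI[of _ d]) (auto simp: dist_real_def)
  then show ?thesis using shift_regular DQ_likely[OF t d(1) \<eta>4, of x]
  proof eventually_elim
    case (elim \<epsilon>)
    have cz: "AE w in P. continuous_on {0..t} (\<lambda>s. Z \<phi> s x w) \<and> continuous_on {0..t} (\<lambda>s. dz h s x w) \<and> continuous_on {0..t} (\<lambda>s. Zs \<epsilon> s x w)"
      using regular_processD(2)[OF regular_fieldD(2)[OF reg_z], of x]
        regular_processD(2)[OF regular_fieldD(2)[OF reg_dz], of x]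
        regular_processD(2)[OF regular_fieldD(2)[OF elim(2)[THEN conjunct2]], of x]
      by eventually_elim (auto elim: continuous_on_subset)
    note all = likely_conj[OF likely_AE[OF cz \<eta>4] likely_conj[OF R1(2) likely_conj[OF R2(2) elim(3)]]]
    from all show ?case
    proof (rule likely_mono)
      fix w
      assume *: "(continuous_on {0..t} (\<lambda>s. Z \<phi> s x w) \<and> continuous_on {0..t} (\<lambda>s. dz h s x w) \<and> continuous_on {0..t} (\<lambda>s. Zs \<epsilon> s x w)) \<and>
       (\<forall>s\<in>{0..t}. norm (Z \<phi> s x w) \<le> R1) \<and> (\<forall>s\<in>{0..t}. norm (dz h s x w) \<le> R2) \<and> (\<forall>s\<in>{0..t}. norm (DQ \<epsilon> s x w - dz h s x w) \<le> d)"
      have cg: "continuous_on UNIV g" by (intro continuous_at_imp_continuous_on ballI has_derivative_continuous[OF g])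
      let ?f1 = "\<lambda>s. g (Zs \<epsilon> s x w)" and ?f2 = "\<lambda>s. g (Z \<phi> s x w)" and ?f3 = "\<lambda>s. g' (Z \<phi> s x w) (dz h s x w)"
      have c: "continuous_on {0..t} ?f1" "continuous_on {0..t} ?f2"
        using * by (auto intro: continuous_on_compose2[OF cg])
      have c3: "continuous_on {0..t} ?f3"
      proof -
        have "continuous_on {0..t} (\<lambda>s. (Z \<phi> s x w, dz h s x w))" using * by (intro continuous_on_Pair) auto
        from continuous_on_compose2[OF g' this] show ?thesis by simp
      qed
      have i: "?f1 integrable_on {0..t}" "?f2 integrable_on {0..t}" "?f3 integrable_on {0..t}"
        using c c3 by (auto intro: integrable_continuous_real)
      have "norm (integral {0..t} (\<lambda>s. (?f1 s - ?f2 s) / \<epsilon> - ?f3 s)) \<le> e' * (t - 0)"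
      proof (rule integral_bound[OF t])
        show "continuous_on {0..t} (\<lambda>s. (?f1 s - ?f2 s) / \<epsilon> - ?f3 s)"
          by (intro continuous_intros c c3) (use elim(2) in auto)
        fix s assume s: "s \<in> {0..t}"
        have "Zs \<epsilon> s x w = Z \<phi> s x w + \<epsilon> *\<^sub>R DQ \<epsilon> s x w"
          using elim(2) by (simp add: DQ_def)
        then show "norm ((?f1 s - ?f2 s) / \<epsilon> - ?f3 s) \<le> e'"
          using d(2)[of "Z \<phi> s x w" "dz h s x w" "DQ \<epsilon> s x w" \<epsilon>] * s elim(1,2) by (auto simp: le_max_iff_disj)
      qed
      moreover have "integral {0..t} (\<lambda>s. (?f1 s - ?f2 s) / \<epsilon> - ?f3 s) = (integral {0..t} ?f1 - integral {0..t} ?f2) / \<epsilon> - integral {0..t} ?f3"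
      proof -
        have "integral {0..t} (\<lambda>s. (?f1 s - ?f2 s) / \<epsilon> - ?f3 s) = integral {0..t} (\<lambda>s. (?f1 s - ?f2 s) / \<epsilon>) - integral {0..t} ?f3"
          by (rule integral_diff) (use i in \<open>auto intro!: integrable_on_divide integrable_diff\<close>)
        also have "integral {0..t} (\<lambda>s. (?f1 s - ?f2 s) / \<epsilon>) = integral {0..t} (\<lambda>s. ?f1 s - ?f2 s) / \<epsilon>"
          by (rule integral_divide)
        also have "integral {0..t} (\<lambda>s. ?f1 s - ?f2 s) = integral {0..t} ?f1 - integral {0..t} ?f2"
          by (rule integral_diff) (use i in auto)
        finally show ?thesis .
      qed
      ultimately show "\<bar>(integral {0..t} ?f1 - integral {0..t} ?f2) / \<epsilon> - integral {0..t} ?f3\<bar> < e"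
        using e'(2) by (simp add: real_norm_def)
    qed (use \<eta> in auto)
  qed
qed

text \<open>Both rows are treated at once through \<open>g\<close>, \<open>i\<close>,
  \<open>j\<close> and \<open>c\<close>. The quotient of the equations of the shifted and the
  original solution is exact; its terms converge by \<open>DQ_likely\<close>,
  \<open>DQx_likely\<close> and \<open>linearised_drift\<close>, and
  \<open>ssum_limit_closure\<close> passes to the limit.\<close>

lemma variational_limit:
  fixes g :: "real^4 \<Rightarrow> real"
  assumes g: "\<And>u. (g has_derivative g' u) (at u)"
    and g': "continuous_on UNIV (\<lambda>y. g' (fst y) (snd y))"
    and lim: "\<And>z. is_solution P F W \<sigma> z \<Longrightarrow> ssum_limit (\<lambda>t w. dx z t x w $ i)
       (\<lambda>t w. integral {0..t} (\<lambda>s. g (z s x w)) + c * (z t x w $ j - z 0 x w $ j))"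
  shows "ssum_limit (\<lambda>t w. dx (dz h) t x w $ i)
       (\<lambda>t w. integral {0..t} (\<lambda>s. g' (Z \<phi> s x w) (dz h s x w)) + c * (dz h t x w $ j - dz h 0 x w $ j))"
proof (rule ssum_limit_closure[where G = "at 0" and Ye = "\<lambda>\<epsilon> t w. DQx \<epsilon> t x w $ i"
    and Ae = "\<lambda>\<epsilon> t w. (integral {0..t} (\<lambda>s. g (Zs \<epsilon> s x w)) - integral {0..t} (\<lambda>s. g (Z \<phi> s x w))) / \<epsilon>
      + c * (DQ \<epsilon> t x w $ j - DQ \<epsilon> 0 x w $ j)"])
  show "at (0::real) \<noteq> bot" by simp
  show "\<forall>\<^sub>F \<epsilon> in at 0. ssum_limit (\<lambda>t w. DQx \<epsilon> t x w $ i)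
     (\<lambda>t w. (integral {0..t} (\<lambda>s. g (Zs \<epsilon> s x w)) - integral {0..t} (\<lambda>s. g (Z \<phi> s x w))) / \<epsilon>
      + c * (DQ \<epsilon> t x w $ j - DQ \<epsilon> 0 x w $ j))"
    using sol_shift
  proof eventually_elim
    case (elim \<epsilon>)
    then have "\<epsilon> \<noteq> 0" by simp
    have 1: "DQx \<epsilon> t x w $ i = (dx (Zs \<epsilon>) t x w $ i - dx (Z \<phi>) t x w $ i) / \<epsilon>" for t w
      by (simp add: DQx_def divide_inverse mult.commute)
    have 2: "(integral {0..t} (\<lambda>s. g (Zs \<epsilon> s x w)) - integral {0..t} (\<lambda>s. g (Z \<phi> s x w))) / \<epsilon>
      + c * (DQ \<epsilon> t x w $ j - DQ \<epsilon> 0 x w $ j) =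
      ((integral {0..t} (\<lambda>s. g (Zs \<epsilon> s x w)) + c * (Zs \<epsilon> t x w $ j - Zs \<epsilon> 0 x w $ j))
       - (integral {0..t} (\<lambda>s. g (Z \<phi> s x w)) + c * (Z \<phi> t x w $ j - Z \<phi> 0 x w $ j))) / \<epsilon>" for t w
      using \<open>\<epsilon> \<noteq> 0\<close> by (simp add: DQ_def field_simps)
    show ?case
      unfolding 1 2 by (rule ssum_limit_diff_quotient[OF lim lim[OF sol]]) (use elim in auto)
  qed
  show "\<forall>\<^sub>F \<epsilon> in at 0. likely P \<eta> (\<lambda>w. \<bar>(integral {0..t} (\<lambda>s. g (Zs \<epsilon> s x w)) - integral {0..t} (\<lambda>s. g (Z \<phi> s x w))) / \<epsilon>
      + c * (DQ \<epsilon> t x w $ j - DQ \<epsilon> 0 x w $ j) - (integral {0..t} (\<lambda>s. g' (Z \<phi> s x w) (dz h s x w)) + c * (dz h t x w $ j - dz h 0 x w $ j))\<bar> < e)"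
    if "0 \<le> t" "0 < e" "0 < \<eta>" for t e \<eta>
  proof -
    \<comment> \<open>The errors at the two times \<open>t\<close> and 0, multiplied by
      \<open>c\<close>, then stay below \<open>e / 2\<close>; the summand 1 covers
      \<open>c = 0\<close>.\<close>
    define \<kappa> where "\<kappa> = e / (4 * (\<bar>c\<bar> + 1))"
    have \<kappa>: "0 < \<kappa>" "\<bar>c\<bar> * (\<kappa> + \<kappa>) \<le> e / 2"
    proof -
      show "0 < \<kappa>" using that by (simp add: \<kappa>_def add_nonneg_pos)
      then have "\<bar>c\<bar> * (\<kappa> + \<kappa>) \<le> (\<bar>c\<bar> + 1) * (\<kappa> + \<kappa>)" by (intro mult_right_mono) auto
      also have "\<dots> = e / 2"
      proof -
        have "k * (e / (4 * k) + e / (4 * k)) = e / 2" if "k \<noteq> 0" for k using that by (simp add: field_simps)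
        moreover have "\<bar>c\<bar> + 1 \<noteq> 0" using abs_ge_zero[of c] by linarith
        ultimately show ?thesis unfolding \<kappa>_def by blast
      qed
      finally show "\<bar>c\<bar> * (\<kappa> + \<kappa>) \<le> e / 2" .
    qed
    have e2: "0 < e/2" "0 < \<eta>/2" using that by auto
    from linearised_drift[OF g g' \<open>0 \<le> t\<close> e2, of x] DQ_likely[OF \<open>0 \<le> t\<close> \<kappa>(1) e2(2), of x]
    show ?thesis
    proof eventually_elim
      case (elim \<epsilon>)
      from elim show ?case
      proof (rule likely_mp)
        fix w
        let ?I = "(integral {0..t} (\<lambda>s. g (Zs \<epsilon> s x w)) - integral {0..t} (\<lambda>s. g (Z \<phi> s x w))) / \<epsilon>"
        let ?J = "integral {0..t} (\<lambda>s. g' (Z \<phi> s x w) (dz h s x w))"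
        assume 1: "\<bar>?I - ?J\<bar> < e/2" and 2: "\<forall>s\<in>{0..t}. norm (DQ \<epsilon> s x w - dz h s x w) \<le> \<kappa>"
        have 3: "\<bar>DQ \<epsilon> s x w $ j - dz h s x w $ j\<bar> \<le> \<kappa>" if "s \<in> {0..t}" for s
          using component_le_norm_cart[of "DQ \<epsilon> s x w - dz h s x w" j] 2 that by force
        have "\<bar>(DQ \<epsilon> t x w $ j - DQ \<epsilon> 0 x w $ j) - (dz h t x w $ j - dz h 0 x w $ j)\<bar> \<le> \<kappa> + \<kappa>"
          using 3[of t] 3[of 0] \<open>0 \<le> t\<close> by auto
        then have "\<bar>c * ((DQ \<epsilon> t x w $ j - DQ \<epsilon> 0 x w $ j) - (dz h t x w $ j - dz h 0 x w $ j))\<bar> \<le> \<bar>c\<bar> * (\<kappa> + \<kappa>)"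
          unfolding abs_mult by (rule mult_left_mono) simp
        then have "\<bar>c * (DQ \<epsilon> t x w $ j - DQ \<epsilon> 0 x w $ j) - c * (dz h t x w $ j - dz h 0 x w $ j)\<bar> \<le> e / 2"
          using \<kappa>(2) unfolding right_diff_distrib[of c "DQ \<epsilon> t x w $ j - DQ \<epsilon> 0 x w $ j"] by linarith
        with 1 show "\<bar>?I + c * (DQ \<epsilon> t x w $ j - DQ \<epsilon> 0 x w $ j) - (?J + c * (dz h t x w $ j - dz h 0 x w $ j))\<bar> < e"
          by linarith
      qed simp
    qed
  qed
  show "\<forall>\<^sub>F \<epsilon> in at 0. likely P \<eta> (\<lambda>w. \<forall>t\<in>{0..T}. \<bar>DQx \<epsilon> t x w $ i - dx (dz h) t x w $ i\<bar> \<le> \<kappa>)"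
    if "0 \<le> T" "0 < \<kappa>" "0 < \<eta>" for T \<kappa> \<eta>
    using DQx_likely[OF that, of x]
  proof eventually_elim
    case (elim \<epsilon>)
    then show ?case
    proof (rule likely_mono)
      fix w assume *: "\<forall>t\<in>{0..T}. norm (DQx \<epsilon> t x w - dx (dz h) t x w) \<le> \<kappa>"
      show "\<forall>t\<in>{0..T}. \<bar>DQx \<epsilon> t x w $ i - dx (dz h) t x w $ i\<bar> \<le> \<kappa>"
      proof
        fix t assume "t \<in> {0..T}"
        with * show "\<bar>DQx \<epsilon> t x w $ i - dx (dz h) t x w $ i\<bar> \<le> \<kappa>"
          using component_le_norm_cart[of "DQx \<epsilon> t x w - dx (dz h) t x w" i] by force
      qed
    qed simp
  qed
  show "\<forall>\<^sub>F \<epsilon> in at 0. \<exists>\<delta>>0. \<forall>N \<tau>. part 0 T \<delta> N \<tau> \<longrightarrow> likely P \<eta>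
     (\<lambda>w. (\<Sum>k<N. (incr (err \<epsilon> x i) \<tau> k w)\<^sup>2) \<le> \<kappa>)"
    if "0 \<le> T" "0 < \<kappa>" "0 < \<eta>" for T \<kappa> \<eta>
    by (rule DQx_component_quadratic[OF that])
  show "(\<lambda>w. dx (dz h) t x w $ i) \<in> borel_measurable (F t)" if "0 \<le> t" for t
    using measurable_compose[OF regular_processD(1)[OF regular_fieldD(3)[OF reg_dz] that] borel_measurable_nth] .
  show "\<forall>\<^sub>F \<epsilon> in at 0. \<forall>t\<ge>0. (\<lambda>w. DQx \<epsilon> t x w $ i) \<in> borel_measurable (F t)"
    using shift_regular
  proof eventually_elim
    case (elim \<epsilon>)
    show ?case
    proof (intro allI impI)
      fix t :: real assume t: "0 \<le> t"
      have [measurable]: "dx (Zs \<epsilon>) t x \<in> borel_measurable (F t)" "dx (Z \<phi>) t x \<in> borel_measurable (F t)"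
        using regular_processD(1)[OF regular_fieldD(3) t] elim reg_z by blast+
      have "DQx \<epsilon> t x \<in> borel_measurable (F t)" unfolding DQx_def by measurable
      then show "(\<lambda>w. DQx \<epsilon> t x w $ i) \<in> borel_measurable (F t)"
        by (rule measurable_compose[OF _ borel_measurable_nth])
    qed
  qed
qed

lemma variation_limits:
  "ssum_limit (\<lambda>t w. dx (dz h) t x w $ 3)
     (\<lambda>t w. integral {0..t} (\<lambda>s. hess_p \<sigma> (Z \<phi> s x w) (dz h s x w)) + 1 * (dz h t x w $ 2 - dz h 0 x w $ 2))"
  "ssum_limit (\<lambda>t w. dx (dz h) t x w $ 4)
     (\<lambda>t w. integral {0..t} (\<lambda>s. hess_q \<sigma> (Z \<phi> s x w) (dz h s x w)) + (- 1) * (dz h t x w $ 1 - dz h 0 x w $ 1))"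
  by (rule variational_limit[OF has_derivative_S1_p continuous_hess_p], erule solution_limits(1))
     (rule variational_limit[OF has_derivative_S1_q continuous_hess_q], erule solution_limits(2))

text \<open>The identity holds for the difference quotients, and both of its sides converge in
  probability. The null set of the conclusion may depend on \<open>t\<close> and
  \<open>x\<close>.\<close>

lemma variation_gradient_component:
  assumes t: "0 \<le> t" and grad: "\<And>z. is_solution P F W \<sigma> z \<Longrightarrow> AE w in P. \<forall>t\<ge>0. \<forall>x. z t x w $ i = dx z t x w $ j"
  shows "AE w in P. dz h t x w $ i = dx (dz h) t x w $ j"
proof (rule likely_close_imp_AE_eq)
  fix e \<eta> :: real assume "0 < e" "0 < \<eta>"
  then have \<kappa>: "0 < e/2" and \<eta>: "0 < \<eta>/4" by auto
  have "\<forall>\<^sub>F \<epsilon> in at 0. is_solution P F W \<sigma> (Zs \<epsilon>) \<and>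
      likely P (\<eta>/4) (\<lambda>w. \<forall>s\<in>{0..t}. norm (DQ \<epsilon> s x w - dz h s x w) \<le> e/2) \<and>
      likely P (\<eta>/4) (\<lambda>w. \<forall>s\<in>{0..t}. norm (DQx \<epsilon> s x w - dx (dz h) s x w) \<le> e/2)"
    using sol_shift DQ_likely[OF t \<kappa> \<eta>, of x] DQx_likely[OF t \<kappa> \<eta>, of x]
    by eventually_elim (intro conjI; simp)
  from eventually_happens'[OF _ this] obtain \<epsilon> where \<epsilon>: "is_solution P F W \<sigma> (Zs \<epsilon>)"
      "likely P (\<eta>/4) (\<lambda>w. \<forall>s\<in>{0..t}. norm (DQ \<epsilon> s x w - dz h s x w) \<le> e/2)"
      "likely P (\<eta>/4) (\<lambda>w. \<forall>s\<in>{0..t}. norm (DQx \<epsilon> s x w - dx (dz h) s x w) \<le> e/2)" by auto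
  have "AE w in P. DQ \<epsilon> t x w $ i = DQx \<epsilon> t x w $ j"
    using grad[OF sol] grad[OF \<epsilon>(1)]
    by eventually_elim (use t in \<open>simp add: DQ_def DQx_def\<close>)
  from likely_conj[OF likely_AE[OF this \<eta>] likely_conj[OF \<epsilon>(2,3)]]
  show "likely P \<eta> (\<lambda>w. \<bar>dz h t x w $ i - dx (dz h) t x w $ j\<bar> \<le> e)"
  proof (rule likely_mono)
    fix w assume *: "DQ \<epsilon> t x w $ i = DQx \<epsilon> t x w $ j \<and> (\<forall>s\<in>{0..t}. norm (DQ \<epsilon> s x w - dz h s x w) \<le> e/2) \<and>
      (\<forall>s\<in>{0..t}. norm (DQx \<epsilon> s x w - dx (dz h) s x w) \<le> e/2)"
    have "\<bar>DQ \<epsilon> t x w $ i - dz h t x w $ i\<bar> \<le> e/2"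
      using component_le_norm_cart[of "DQ \<epsilon> t x w - dz h t x w" i] * t by force
    moreover have "\<bar>DQx \<epsilon> t x w $ j - dx (dz h) t x w $ j\<bar> \<le> e/2"
      using component_le_norm_cart[of "DQx \<epsilon> t x w - dx (dz h) t x w" j] * t by force
    ultimately show "\<bar>dz h t x w $ i - dx (dz h) t x w $ j\<bar> \<le> e"
      using * by linarith
  qed (use \<open>0 < \<eta>\<close> in auto)
qed

lemma solution_gradient:
  assumes "is_solution P F W \<sigma> z"
  shows "AE w in P. \<forall>t\<ge>0. \<forall>x. z t x w $ 3 = dx z t x w $ 1" "AE w in P. \<forall>t\<ge>0. \<forall>x. z t x w $ 4 = dx z t x w $ 2"
proof -
  have "AE w in P. \<forall>t\<ge>0. \<forall>x. z t x w $ 3 = dx (\<lambda>t x w. z t x w $ 1) t x w \<and>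
                       z t x w $ 4 = dx (\<lambda>t x w. z t x w $ 2) t x w"
    and "regular_field P F z" using assms by (auto simp: is_solution_def)
  from this(1) regular_fieldD(1)[OF this(2)]
  have "AE w in P. \<forall>t\<ge>0. \<forall>x. z t x w $ 3 = dx z t x w $ 1 \<and> z t x w $ 4 = dx z t x w $ 2"
    by eventually_elim (simp add: dx_nth(1))
  then show "AE w in P. \<forall>t\<ge>0. \<forall>x. z t x w $ 3 = dx z t x w $ 1" "AE w in P. \<forall>t\<ge>0. \<forall>x. z t x w $ 4 = dx z t x w $ 2"
    by (eventually_elim, blast)+
qed

lemma variation_gradient:
  assumes "0 \<le> t"
  shows "AE w in P. dz h t x w $ 3 = dx (dz h) t x w $ 1" "AE w in P. dz h t x w $ 4 = dx (dz h) t x w $ 2"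
  by (rule variation_gradient_component[OF assms], erule solution_gradient)+

end

section \<open>The conservation law\<close>

text \<open>Since the sum of \<open>a j s * f j s\<close> vanishes at every \<open>s\<close>, the
  averages of \<open>a j\<close> on a cell may be replaced by their deviation from
  \<open>a j s\<close> under the integral. This deviation is at most \<kappa>, so each cell costs a
  multiple of its length.\<close>

lemma drift_sum_le:
  fixes a f :: "'j \<Rightarrow> real \<Rightarrow> real"
  assumes p: "part 0 T \<delta> N \<tau>" and J: "finite J"
    and f: "\<And>j. j \<in> J \<Longrightarrow> continuous_on {0..T} (f j)" "\<And>j s. j \<in> J \<Longrightarrow> s \<in> {0..T} \<Longrightarrow> \<bar>f j s\<bar> \<le> R"
    and a: "\<And>j. j \<in> J \<Longrightarrow> continuous_on {0..T} (a j)"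
      "\<And>j s t. j \<in> J \<Longrightarrow> s \<in> {0..T} \<Longrightarrow> t \<in> {0..T} \<Longrightarrow> \<bar>s - t\<bar> < \<delta> \<Longrightarrow> \<bar>a j s - a j t\<bar> \<le> \<kappa>"
    and zero: "\<And>s. s \<in> {0..T} \<Longrightarrow> (\<Sum>j\<in>J. a j s * f j s) = 0" and "0 \<le> \<kappa>"
  shows "\<bar>\<Sum>i<N. \<Sum>j\<in>J. (a j (\<tau> i) + a j (\<tau> (Suc i))) / 2 * (integral {0..\<tau> (Suc i)} (f j) - integral {0..\<tau> i} (f j))\<bar>
    \<le> real (card J) * (\<kappa> * R) * T"
proof -
  have cell: "\<bar>\<Sum>j\<in>J. (a j (\<tau> i) + a j (\<tau> (Suc i))) / 2 * (integral {0..\<tau> (Suc i)} (f j) - integral {0..\<tau> i} (f j))\<bar>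
    \<le> real (card J) * (\<kappa> * R) * (\<tau> (Suc i) - \<tau> i)" if i: "i < N" for i
  proof -
    have t: "0 \<le> \<tau> i" "\<tau> i \<le> \<tau> (Suc i)" "\<tau> (Suc i) \<le> T" "\<tau> (Suc i) - \<tau> i < \<delta>"
      using part_bounds[OF p, of i] part_bounds[OF p, of "Suc i"] p i by (auto simp: part_def)
    define c where "c j = (a j (\<tau> i) + a j (\<tau> (Suc i))) / 2" for j
    have fi: "f j integrable_on {0..\<tau> (Suc i)}" if "j \<in> J" for j
      by (rule integrable_continuous_real) (use f(1)[OF that] t in \<open>auto intro: continuous_on_subset\<close>)
    have fc: "continuous_on {\<tau> i..\<tau> (Suc i)} (f j)" if "j \<in> J" for j
      using f(1)[OF that] t by (auto intro: continuous_on_subset)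
    have ac: "continuous_on {\<tau> i..\<tau> (Suc i)} (a j)" if "j \<in> J" for j
      using a(1)[OF that] t by (auto intro: continuous_on_subset)
    have "(\<Sum>j\<in>J. c j * (integral {0..\<tau> (Suc i)} (f j) - integral {0..\<tau> i} (f j))) =
      (\<Sum>j\<in>J. integral {\<tau> i..\<tau> (Suc i)} (\<lambda>s. c j * f j s))"
    proof (rule sum.cong)
      fix j assume "j \<in> J"
      then have "integral {0..\<tau> (Suc i)} (f j) - integral {0..\<tau> i} (f j) = integral {\<tau> i..\<tau> (Suc i)} (f j)"
        using Henstock_Kurzweil_Integration.integral_combine[OF t(1,2) fi, of j] by linarith
      moreover have "integral {\<tau> i..\<tau> (Suc i)} (\<lambda>s. c j * f j s) = c j * integral {\<tau> i..\<tau> (Suc i)} (f j)"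
        by (rule Henstock_Kurzweil_Integration.integral_mult_right)
      ultimately show "c j * (integral {0..\<tau> (Suc i)} (f j) - integral {0..\<tau> i} (f j)) = integral {\<tau> i..\<tau> (Suc i)} (\<lambda>s. c j * f j s)"
        by (simp only:)
    qed simp
    also have "\<dots> = integral {\<tau> i..\<tau> (Suc i)} (\<lambda>s. \<Sum>j\<in>J. c j * f j s)"
      by (rule Henstock_Kurzweil_Integration.integral_sum[symmetric, OF J]) (intro integrable_continuous_real continuous_intros fc)
    also have "\<dots> = integral {\<tau> i..\<tau> (Suc i)} (\<lambda>s. \<Sum>j\<in>J. (c j - a j s) * f j s)"
    proof (rule Henstock_Kurzweil_Integration.integral_cong)
      fix s assume "s \<in> {\<tau> i..\<tau> (Suc i)}"
      then have "(\<Sum>j\<in>J. a j s * f j s) = 0" using t by (intro zero) auto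
      then show "(\<Sum>j\<in>J. c j * f j s) = (\<Sum>j\<in>J. (c j - a j s) * f j s)"
        by (simp add: left_diff_distrib sum_subtractf)
    qed
    finally have eq: "(\<Sum>j\<in>J. c j * (integral {0..\<tau> (Suc i)} (f j) - integral {0..\<tau> i} (f j))) =
      integral {\<tau> i..\<tau> (Suc i)} (\<lambda>s. \<Sum>j\<in>J. (c j - a j s) * f j s)" .
    have "norm (integral {\<tau> i..\<tau> (Suc i)} (\<lambda>s. \<Sum>j\<in>J. (c j - a j s) * f j s)) \<le> (real (card J) * (\<kappa> * R)) * (\<tau> (Suc i) - \<tau> i)"
    proof (rule integral_bound[OF t(2)])
      show "continuous_on {\<tau> i..\<tau> (Suc i)} (\<lambda>s. \<Sum>j\<in>J. (c j - a j s) * f j s)"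
        by (intro continuous_intros ac fc)
      fix s assume s: "s \<in> {\<tau> i..\<tau> (Suc i)}"
      have "\<bar>\<Sum>j\<in>J. (c j - a j s) * f j s\<bar> \<le> (\<Sum>j\<in>J. \<kappa> * R)"
      proof (rule order_trans[OF sum_abs], rule sum_mono)
        fix j assume j: "j \<in> J"
        have "\<bar>a j (\<tau> i) - a j s\<bar> \<le> \<kappa>" "\<bar>a j (\<tau> (Suc i)) - a j s\<bar> \<le> \<kappa>"
          by (rule a(2)[OF j]; use s t in auto)+
        then have "\<bar>c j - a j s\<bar> \<le> \<kappa>" unfolding c_def by (simp add: abs_le_iff field_simps)
        moreover have "\<bar>f j s\<bar> \<le> R" by (rule f(2)[OF j]) (use s t in auto)
        ultimately show "\<bar>(c j - a j s) * f j s\<bar> \<le> \<kappa> * R"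
          unfolding abs_mult by (intro mult_mono) (use \<open>0 \<le> \<kappa>\<close> in auto)
      qed
      then show "norm (\<Sum>j\<in>J. (c j - a j s) * f j s) \<le> real (card J) * (\<kappa> * R)" by simp
    qed
    then show ?thesis using eq by (simp add: c_def)
  qed
  have "\<bar>\<Sum>i<N. \<Sum>j\<in>J. (a j (\<tau> i) + a j (\<tau> (Suc i))) / 2 * (integral {0..\<tau> (Suc i)} (f j) - integral {0..\<tau> i} (f j))\<bar>
    \<le> (\<Sum>i<N. real (card J) * (\<kappa> * R) * (\<tau> (Suc i) - \<tau> i))"
    by (rule order_trans[OF sum_abs], rule sum_mono, rule cell) simp
  also have "\<dots> = real (card J) * (\<kappa> * R) * T"
    using p sum_lessThan_telescope[of \<tau> N] by (simp add: part_def sum_distrib_left[symmetric])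
  finally show ?thesis .
qed

context brownian
begin

definition cadapted :: "(real \<Rightarrow> 'a \<Rightarrow> real) \<Rightarrow> bool" where
  "cadapted X \<longleftrightarrow> (\<forall>t\<ge>0. X t \<in> borel_measurable (F t)) \<and> (AE w in P. continuous_on {0..} (\<lambda>t. X t w))"

lemma tame_cadapted: "tame X \<Longrightarrow> cadapted X"
  by (simp add: tame_def cadapted_def)

abbreviation drift_sum :: "'j set \<Rightarrow> ('j \<Rightarrow> real \<Rightarrow> 'a \<Rightarrow> real) \<Rightarrow> ('j \<Rightarrow> real \<Rightarrow> 'a \<Rightarrow> real) \<Rightarrow> nat \<Rightarrow> (nat \<Rightarrow> real) \<Rightarrow> 'a \<Rightarrow> real" where
  "drift_sum J a f N \<tau> w \<equiv> \<Sum>i<N. \<Sum>j\<in>J. mid (a j) \<tau> i w *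
    (integral {0..\<tau> (Suc i)} (\<lambda>s. f j s w) - integral {0..\<tau> i} (\<lambda>s. f j s w))"

lemma drift_negligible:
  fixes a f :: "'j \<Rightarrow> real \<Rightarrow> 'a \<Rightarrow> real"
  assumes J: "finite J" and a: "\<And>j. j \<in> J \<Longrightarrow> cadapted (a j)" and f: "\<And>j. j \<in> J \<Longrightarrow> cadapted (f j)"
    and zero: "\<And>s w. (\<Sum>j\<in>J. a j s w * f j s w) = 0"
    and T: "0 \<le> T" and e: "0 < e" and \<eta>: "0 < \<eta>"
  shows "\<exists>\<delta>>0. \<forall>N \<tau>. part 0 T \<delta> N \<tau> \<longrightarrow> likely P \<eta> (\<lambda>w. \<bar>drift_sum J a f N \<tau> w\<bar> < e)"
proof -
  define \<zeta> where "\<zeta> = \<eta> / 4"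
  define \<zeta>' where "\<zeta>' = \<zeta> / (real (card J) + 1)"
  have \<zeta>: "0 < \<zeta>" "0 < \<zeta>'" using \<eta> by (auto simp: \<zeta>_def \<zeta>'_def add_nonneg_pos)
  have m: "X t \<in> borel_measurable P" if "cadapted X" "0 \<le> t" for X t
    by (rule F_measurable[OF that(2)]) (use that in \<open>simp add: cadapted_def\<close>)
  have c: "AE w in P. continuous_on {0..} (\<lambda>t. X t w)" if "cadapted X" for X
    using that by (simp add: cadapted_def)
  have "\<forall>j\<in>J. \<exists>B>0. likely P \<zeta>' (\<lambda>w. \<forall>t\<in>{0..T}. \<bar>f j t w\<bar> \<le> B)"
    by (intro ballI likely_bounded[OF _ _ T \<zeta>(2)] m[OF f] c[OF f])
  from bchoice[OF this] obtain B where "\<forall>j\<in>J. 0 < B j \<and> likely P \<zeta>' (\<lambda>w. \<forall>t\<in>{0..T}. \<bar>f j t w\<bar> \<le> B j)" ..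
  then have B: "\<And>j. j \<in> J \<Longrightarrow> 0 < B j" "\<And>j. j \<in> J \<Longrightarrow> likely P \<zeta>' (\<lambda>w. \<forall>t\<in>{0..T}. \<bar>f j t w\<bar> \<le> B j)"
    by simp_all
  define R where "R = (\<Sum>j\<in>J. B j) + 1"
  have R: "B j \<le> R" if "j \<in> J" for j
    using member_le_sum[of j J B] that J B(1) by (auto simp: R_def less_imp_le)
  have "0 \<le> (\<Sum>j\<in>J. B j)" using B(1) by (intro sum_nonneg) (simp add: less_imp_le)
  then have R0: "0 < R" by (simp add: R_def)
  \<comment> \<open>It dominates \<open>real (card J) * R * T\<close>; the added ones keep it
    positive when \<open>J\<close> is empty or \<open>T = 0\<close>.\<close>
  define D where "D = (real (card J) + 1) * R * (T + 1)"
  have D: "0 < D" using R0 T by (simp add: D_def add_nonneg_pos)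
  define \<kappa> where "\<kappa> = e / (2 * D)"
  have \<kappa>: "0 < \<kappa>" "D * \<kappa> < e" using D e by (auto simp: \<kappa>_def)
  have "\<forall>j\<in>J. \<exists>h>0. likely P \<zeta>' (\<lambda>w. osc_le (a j) T h \<kappa> w)"
    by (intro ballI likely_modulus[OF _ _ T \<kappa>(1) \<zeta>(2)] m[OF a] c[OF a])
  from bchoice[OF this] obtain h where "\<forall>j\<in>J. 0 < h j \<and>
      likely P \<zeta>' (\<lambda>w. osc_le (a j) T (h j) \<kappa> w)" ..
  then have h: "\<And>j. j \<in> J \<Longrightarrow> 0 < h j" "\<And>j. j \<in> J \<Longrightarrow>
      likely P \<zeta>' (\<lambda>w. osc_le (a j) T (h j) \<kappa> w)" by blast+
  define \<delta> where "\<delta> = Min (insert 1 (h ` J))"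
  have \<delta>: "0 < \<delta>" "\<And>j. j \<in> J \<Longrightarrow> \<delta> \<le> h j" using J h(1) by (auto simp: \<delta>_def)
  have L1: "likely P \<zeta> (\<lambda>w. \<forall>j\<in>J. \<forall>t\<in>{0..T}. \<bar>f j t w\<bar> \<le> B j)"
    by (rule likely_ball[OF J _ \<zeta>(1)]) (use B(2) in \<open>simp add: \<zeta>'_def\<close>)
  have L2: "likely P \<zeta> (\<lambda>w. \<forall>j\<in>J. osc_le (a j) T (h j) \<kappa> w)"
    by (rule likely_ball[OF J _ \<zeta>(1)]) (use h(2) in \<open>simp add: \<zeta>'_def\<close>)
  have "AE w in P. \<forall>j\<in>J. continuous_on {0..} (\<lambda>t. a j t w) \<and> continuous_on {0..} (\<lambda>t. f j t w)"
    using J a f c by (auto simp: AE_finite_all)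
  then have L3: "likely P \<zeta> (\<lambda>w. \<forall>j\<in>J. continuous_on {0..} (\<lambda>t. a j t w) \<and> continuous_on {0..} (\<lambda>t. f j t w))"
    by (rule likely_AE[OF _ \<zeta>(1)])
  have "likely P \<eta> (\<lambda>w. \<bar>drift_sum J a f N \<tau> w\<bar> < e)" if p: "part 0 T \<delta> N \<tau>" for N \<tau>
  proof (rule likely_mono[OF likely_conj[OF L1 likely_conj[OF L2 L3]]])
    fix w assume *: "(\<forall>j\<in>J. \<forall>t\<in>{0..T}. \<bar>f j t w\<bar> \<le> B j) \<and>
        (\<forall>j\<in>J. osc_le (a j) T (h j) \<kappa> w) \<and>
        (\<forall>j\<in>J. continuous_on {0..} (\<lambda>t. a j t w) \<and> continuous_on {0..} (\<lambda>t. f j t w))"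
    have "\<bar>drift_sum J a f N \<tau> w\<bar> \<le> real (card J) * (\<kappa> * R) * T"
    proof (rule drift_sum_le[OF p J, where a = "\<lambda>j s. a j s w" and f = "\<lambda>j s. f j s w"])
      fix j assume j: "j \<in> J"
      have "continuous_on {0..} (\<lambda>t. a j t w)" "continuous_on {0..} (\<lambda>t. f j t w)" using * j by auto
      then show "continuous_on {0..T} (\<lambda>s. f j s w)" "continuous_on {0..T} (\<lambda>s. a j s w)"
        by (auto elim: continuous_on_subset)
      show "\<bar>f j s w\<bar> \<le> R" if "s \<in> {0..T}" for s
        using * j that R[OF j] by (meson order_trans)
      show "\<bar>a j s w - a j t w\<bar> \<le> \<kappa>" if "s \<in> {0..T}" "t \<in> {0..T}" "\<bar>s - t\<bar> < \<delta>" for s t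
        using * j that \<delta>(2)[OF j] by (meson order_less_le_trans)
    qed (use zero \<kappa> in auto)
    also have "\<dots> \<le> D * \<kappa>"
    proof -
      have "real (card J) * R * T \<le> D" unfolding D_def by (intro mult_mono) (use R0 T in auto)
      then have "real (card J) * R * T * \<kappa> \<le> D * \<kappa>" by (rule mult_right_mono) (use \<kappa> in simp)
      then show ?thesis by (simp add: mult_ac)
    qed
    finally show "\<bar>drift_sum J a f N \<tau> w\<bar> < e" using \<kappa>(2) by simp
  qed (use \<eta> in \<open>auto simp: \<zeta>_def\<close>)
  with \<delta>(1) show ?thesis by blast
qed

text \<open>Sums over one partition finer than both thresholds are close to both values. It
  identifies the value picked by \<open>SOME\<close> in \<open>stratonovich_integral\<close> with a
  known one.\<close>

lemma has_stratonovich_integral_unique: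
  fixes X :: "real \<Rightarrow> 'a \<Rightarrow> real"
  assumes "a \<le> b" "has_stratonovich_integral P W X a b I" "has_stratonovich_integral P W X a b I'"
  shows "AE w in P. I w = I' w"
proof (rule likely_close_imp_AE_eq)
  fix e \<eta> :: real assume "0 < e" "0 < \<eta>"
  then have pos: "0 < e/2" "0 < \<eta>/2" by auto
  have "\<exists>\<delta>>0. \<forall>N \<tau>. part a b \<delta> N \<tau> \<longrightarrow> likely P (\<eta>/2) (\<lambda>w. \<bar>stratonovich_sum W X (N, \<tau>) w - K w\<bar> < e/2)"
    if "has_stratonovich_integral P W X a b K" for K
    using that pos unfolding has_stratonovich_integral_def tendsto_in_prob_mesh real_norm_def by blast
  from this[OF assms(2)] this[OF assms(3)] obtain d d' where d: "0 < d" "0 < d'"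
    "\<And>N \<tau>. part a b d N \<tau> \<Longrightarrow> likely P (\<eta>/2) (\<lambda>w. \<bar>stratonovich_sum W X (N, \<tau>) w - I w\<bar> < e/2)"
    "\<And>N \<tau>. part a b d' N \<tau> \<Longrightarrow> likely P (\<eta>/2) (\<lambda>w. \<bar>stratonovich_sum W X (N, \<tau>) w - I' w\<bar> < e/2)" by blast
  obtain N where p: "part a b (min d d') N (unif a b N)"
    using part_exists[OF assms(1), of "min d d'"] d(1,2) by (metis min_less_iff_conj order_refl)
  show "likely P \<eta> (\<lambda>w. \<bar>I w - I' w\<bar> \<le> e)"
  proof (rule likely_mp[OF d(3) d(4)])
    show "part a b d N (unif a b N)" "part a b d' N (unif a b N)" using part_mono[OF p] by auto
    show "\<bar>I w - I' w\<bar> \<le> e" if "\<bar>stratonovich_sum W X (N, unif a b N) w - I w\<bar> < e/2"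
      "\<bar>stratonovich_sum W X (N, unif a b N) w - I' w\<bar> < e/2" for w
      using that by linarith
  qed simp
qed

end

section \<open>The two-forms on a pair of variations\<close>

locale variation_pair = vh: variation P F W \<sigma> U Z \<phi> dz h + vk: variation P F W \<sigma> U Z \<phi> dz k
  for P :: "'a measure" and F W \<sigma> U Z \<phi> dz h k
begin

lemma omega_eq: "omega_form dz h k t x w = dz h t x w $ 2 * dz k t x w $ 1 - dz h t x w $ 1 * dz k t x w $ 2"
  by (simp add: omega_form_def wedge_matM)

text \<open>The product rule gives eight terms. The third and fourth components are the space
  derivatives of the first and second, so the four terms containing a derivative of the first two
  components cancel in pairs.\<close>

lemma dx_kappa:
  assumes "0 \<le> t"
  shows "AE w in P. dx (kappa_form dz h k) t x w =
    dz h t x w $ 1 * dx (dz k) t x w $ 3 - dz k t x w $ 1 * dx (dz h) t x w $ 3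
    + dz h t x w $ 2 * dx (dz k) t x w $ 4 - dz k t x w $ 2 * dx (dz h) t x w $ 4"
  using vh.regular_fieldD(1)[OF vh.reg_dz] vh.regular_fieldD(1)[OF vk.reg_dz]
    vh.variation_gradient[OF assms, of x] vk.variation_gradient[OF assms, of x]
proof eventually_elim
  case (elim w)
  have d: "((\<lambda>y. dz h t y w $ i) has_vector_derivative dx (dz h) t x w $ i) (at x)"
    "((\<lambda>y. dz k t y w $ i) has_vector_derivative dx (dz k) t x w $ i) (at x)" for i
    using elim(1,2) assms by (auto intro: dx_nth(2))
  have eq: "kappa_form dz h k t y w = dz h t y w $ 1 * dz k t y w $ 3 - dz h t y w $ 3 * dz k t y w $ 1
     + dz h t y w $ 2 * dz k t y w $ 4 - dz h t y w $ 4 * dz k t y w $ 2" for y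
    by (simp add: kappa_form_def wedge_matK)
  note m = has_vector_derivative_mult[OF d(1) d(2)]
  show ?case unfolding dx_def[of "kappa_form dz h k"] eq
    by (rule vector_derivative_at[THEN trans],
        rule has_vector_derivative_diff[OF has_vector_derivative_add[OF has_vector_derivative_diff[OF m m] m] m])
      (use elim(3-6) in \<open>simp add: algebra_simps\<close>)
qed

text \<open>Each of the four terms in \<open>dx_kappa\<close> is an undifferentiated component times
  an integrand whose integral is known from \<open>variation_limits\<close>, so associativity
  applies term by term.\<close>

lemma kappa_ssum_limit:
  "vh.ssum_limit (\<lambda>t w. dx (kappa_form dz h k) t x w) (\<lambda>t w. - (omega_form dz h k t x w - omega_form dz h k 0 x w))"
  unfolding vh.ssum_limit_def
proof (intro allI impI)
  fix T e \<eta> :: real assume T: "0 \<le> T" and e: "0 < e" and \<eta>: "0 < \<eta>"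
  have e8: "0 < e/8" "0 < \<eta>/8" using e \<eta> by auto
  define u where "u i t w = dz h t x w $ i" for i t w
  define v where "v i t w = dz k t x w $ i" for i t w
  define u' where "u' i t w = dx (dz h) t x w $ i" for i t w
  define v' where "v' i t w = dx (dz k) t x w $ i" for i t w
  define hu1 where "hu1 t w = hess_p \<sigma> (Z \<phi> t x w) (dz h t x w)" for t w
  define hu2 where "hu2 t w = hess_q \<sigma> (Z \<phi> t x w) (dz h t x w)" for t w
  define hv1 where "hv1 t w = hess_p \<sigma> (Z \<phi> t x w) (dz k t x w)" for t w
  define hv2 where "hv2 t w = hess_q \<sigma> (Z \<phi> t x w) (dz k t x w)" for t w
  \<comment> \<open>The linearised equation read as the value of the integral of
    \<open>u' 3\<close>; likewise for the next three.\<close>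
  define Au3 where "Au3 t w = integral {0..t} (\<lambda>s. hu1 s w) + 1 * (u 2 t w - u 2 0 w)" for t w
  define Au4 where "Au4 t w = integral {0..t} (\<lambda>s. hu2 s w) + (- 1) * (u 1 t w - u 1 0 w)" for t w
  define Av3 where "Av3 t w = integral {0..t} (\<lambda>s. hv1 s w) + 1 * (v 2 t w - v 2 0 w)" for t w
  define Av4 where "Av4 t w = integral {0..t} (\<lambda>s. hv2 s w) + (- 1) * (v 1 t w - v 1 0 w)" for t w
  have A: "vh.ssum_limit (u' 3) Au3" "vh.ssum_limit (u' 4) Au4" "vh.ssum_limit (v' 3) Av3" "vh.ssum_limit (v' 4) Av4"
    using vh.variation_limits[of x] vk.variation_limits[of x]
    unfolding u'_def[abs_def] v'_def[abs_def] Au3_def[abs_def] Au4_def[abs_def] Av3_def[abs_def] Av4_def[abs_def]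
      hu1_def hu2_def hv1_def hv2_def u_def v_def by auto
  have tu: "vh.tame (u i)" "vh.tame (u' i)" for i
    using vh.regular_tame[OF vh.regular_fieldD(2)[OF vh.reg_dz]] vh.regular_tame[OF vh.regular_fieldD(3)[OF vh.reg_dz]]
    unfolding u_def[abs_def] u'_def[abs_def] by auto
  have tv: "vh.tame (v i)" "vh.tame (v' i)" for i
    using vh.regular_tame[OF vh.regular_fieldD(2)[OF vk.reg_dz]] vh.regular_tame[OF vh.regular_fieldD(3)[OF vk.reg_dz]]
    unfolding v_def[abs_def] v'_def[abs_def] by auto
  have neg: "vh.cadapted (\<lambda>t w. - X t w)" if "vh.cadapted X" for X
  proof -
    have "AE w in P. continuous_on {0..} (\<lambda>t. X t w)" using that by (simp add: vh.cadapted_def)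
    then have "AE w in P. continuous_on {0..} (\<lambda>t. - X t w)" by eventually_elim (intro continuous_intros)
    then show ?thesis using that by (simp add: vh.cadapted_def)
  qed
  have hess: "vh.cadapted (\<lambda>t w. H (Z \<phi> t x w) (y t w))"
    if H: "continuous_on UNIV (\<lambda>y::(real^4) \<times> (real^4). H (fst y) (snd y) :: real)" and y: "regular_process P F y" for H y
    unfolding vh.cadapted_def
  proof (intro conjI allI impI)
    fix t :: real assume t: "0 \<le> t"
    have "(\<lambda>w. (Z \<phi> t x w, y t w)) \<in> borel_measurable (F t)"
      using vh.regular_processD(1)[OF vh.regular_fieldD(2)[OF vh.reg_z] t] vh.regular_processD(1)[OF y t]
      by (rule borel_measurable_Pair)
    from measurable_compose[OF this borel_measurable_continuous_onI[OF H]]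
    show "(\<lambda>w. H (Z \<phi> t x w) (y t w)) \<in> borel_measurable (F t)" by simp
  next
    show "AE w in P. continuous_on {0..} (\<lambda>t. H (Z \<phi> t x w) (y t w))"
      using vh.regular_processD(2)[OF vh.regular_fieldD(2)[OF vh.reg_z], of x] vh.regular_processD(2)[OF y]
    proof eventually_elim
      case (elim w)
      have "continuous_on {0..} (\<lambda>t. (Z \<phi> t x w, y t w))" by (intro continuous_intros elim)
      from continuous_on_compose2[OF H this] show ?case by simp
    qed
  qed
  \<comment> \<open>The factor and the drift of the four drift terms left when the linearised
    equation is inserted into the Leibniz rule. With these signs, the sum of the products vanishes
    by \<open>hessian_symmetric\<close>.\<close>
  define a where "a j = [\<lambda>t w. - v 1 t w, u 2, \<lambda>t w. - v 2 t w, u 1] ! j" for j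
  define f where "f j = [hu1, hv2, hu2, hv1] ! j" for j
  have J: "(\<Sum>j\<in>{..<4::nat}. g j) = g 0 + g 1 + g 2 + g 3" for g :: "nat \<Rightarrow> real"
    by (simp add: eval_nat_numeral)
  have four: "j = 0 \<or> j = 1 \<or> j = 2 \<or> j = 3" if "j \<in> {..<4::nat}" for j using that by auto
  have av: "a 0 = (\<lambda>t w. - v 1 t w)" "a 1 = u 2" "a 2 = (\<lambda>t w. - v 2 t w)" "a 3 = u 1"
    and fv: "f 0 = hu1" "f 1 = hv2" "f 2 = hu2" "f 3 = hv1"
    by (simp_all add: a_def f_def)
  have "\<exists>\<delta>>0. \<forall>N \<tau>. part 0 T \<delta> N \<tau> \<longrightarrow> likely P (\<eta>/8) (\<lambda>w. \<bar>vh.drift_sum {..<4::nat} a f N \<tau> w\<bar> < e/8)"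
  proof (rule vh.drift_negligible[OF _ _ _ _ T e8])
    fix j :: nat assume "j \<in> {..<4}"
    from four[OF this] show "vh.cadapted (a j)"
      using neg[OF vh.tame_cadapted[OF tv(1)]] vh.tame_cadapted[OF tu(1)] by (auto simp: av simp del: One_nat_def)
    have "vh.cadapted hu1" "vh.cadapted hu2" "vh.cadapted hv1" "vh.cadapted hv2"
      unfolding hu1_def[abs_def] hu2_def[abs_def] hv1_def[abs_def] hv2_def[abs_def]
      by (rule hess continuous_hess_p continuous_hess_q vh.regular_fieldD(2)[OF vh.reg_dz] vh.regular_fieldD(2)[OF vk.reg_dz])+
    with four[OF \<open>j \<in> {..<4}\<close>] show "vh.cadapted (f j)" by (auto simp: fv simp del: One_nat_def)
  next
    fix s w
    show "(\<Sum>j\<in>{..<4::nat}. a j s w * f j s w) = 0"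
      using hessian_symmetric[of \<sigma> "Z \<phi> s x w" "dz h s x w" "dz k s x w"]
      unfolding J av fv by (simp add: hu1_def hu2_def hv1_def hv2_def u_def v_def algebra_simps)
  qed simp
  then obtain d0 where d0: "0 < d0" "\<And>N \<tau>. part 0 T d0 N \<tau> \<Longrightarrow> likely P (\<eta>/8) (\<lambda>w. \<bar>vh.drift_sum {..<4::nat} a f N \<tau> w\<bar> < e/8)" by blast
  define S where "S b A N \<tau> w = (\<Sum>i<N. mid b \<tau> i w * incr A \<tau> i w)"
    for b A :: "real \<Rightarrow> 'a \<Rightarrow> real" and N \<tau> w
  have assoc: "\<exists>\<delta>>0. \<forall>N \<tau>. part 0 T \<delta> N \<tau> \<longrightarrow> likely P (\<eta>/8) (\<lambda>w. \<bar>S b A N \<tau> w - vh.ssum (\<lambda>t w. b t w * Y t w) N \<tau> w\<bar> < e/8)"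
    if "vh.tame b" "vh.tame Y" "vh.ssum_limit Y A" for b Y A
    using vh.stratonovich_associative[OF that T e8] unfolding S_def .
  obtain d1 where d1: "0 < d1" "\<And>N \<tau>. part 0 T d1 N \<tau> \<Longrightarrow> likely P (\<eta>/8) (\<lambda>w. \<bar>S (v 1) Au3 N \<tau> w - vh.ssum (\<lambda>t w. v 1 t w * u' 3 t w) N \<tau> w\<bar> < e/8)"
    using assoc[OF tv(1) tu(2) A(1)] by blast
  obtain d2 where d2: "0 < d2" "\<And>N \<tau>. part 0 T d2 N \<tau> \<Longrightarrow> likely P (\<eta>/8) (\<lambda>w. \<bar>S (u 2) Av4 N \<tau> w - vh.ssum (\<lambda>t w. u 2 t w * v' 4 t w) N \<tau> w\<bar> < e/8)"
    using assoc[OF tu(1) tv(2) A(4)] by blast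
  obtain d3 where d3: "0 < d3" "\<And>N \<tau>. part 0 T d3 N \<tau> \<Longrightarrow> likely P (\<eta>/8) (\<lambda>w. \<bar>S (v 2) Au4 N \<tau> w - vh.ssum (\<lambda>t w. v 2 t w * u' 4 t w) N \<tau> w\<bar> < e/8)"
    using assoc[OF tv(1) tu(2) A(2)] by blast
  obtain d4 where d4: "0 < d4" "\<And>N \<tau>. part 0 T d4 N \<tau> \<Longrightarrow> likely P (\<eta>/8) (\<lambda>w. \<bar>S (u 1) Av3 N \<tau> w - vh.ssum (\<lambda>t w. u 1 t w * v' 3 t w) N \<tau> w\<bar> < e/8)"
    using assoc[OF tu(1) tv(2) A(3)] by blast
  define \<delta> where "\<delta> = min d0 (min (min d1 d2) (min d3 d4))"
  have \<delta>: "0 < \<delta>" "\<delta> \<le> d0" "\<delta> \<le> d1" "\<delta> \<le> d2" "\<delta> \<le> d3" "\<delta> \<le> d4" using d0 d1 d2 d3 d4 by (auto simp: \<delta>_def)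
  have "likely P \<eta> (\<lambda>w. \<bar>vh.ssum (\<lambda>t w. dx (kappa_form dz h k) t x w) N \<tau> w - - (omega_form dz h k T x w - omega_form dz h k 0 x w)\<bar> < e)"
    if p: "part 0 T \<delta> N \<tau>" for N \<tau>
  proof -
    define kap where "kap t w = u 1 t w * v' 3 t w - v 1 t w * u' 3 t w + u 2 t w * v' 4 t w - v 2 t w * u' 4 t w" for t w
    \<comment> \<open>The formula for the derivative has a null set for each time; a partition has
      only finitely many.\<close>
    have "AE w in P. \<forall>i\<in>{..N}. dx (kappa_form dz h k) (\<tau> i) x w = kap (\<tau> i) w"
      using dx_kappa part_bounds(1)[OF p] by (simp add: AE_finite_all kap_def u_def v_def u'_def v'_def)
    note L0 = vh.likely_AE[OF this e8(2)]
    note L1 = d0(2)[OF part_mono[OF p \<delta>(2)]] and L2 = d1(2)[OF part_mono[OF p \<delta>(3)]] and L3 = d2(2)[OF part_mono[OF p \<delta>(4)]]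
      and L4 = d3(2)[OF part_mono[OF p \<delta>(5)]] and L5 = d4(2)[OF part_mono[OF p \<delta>(6)]]
    note all = vh.likely_conj[OF L0 vh.likely_conj[OF L1 vh.likely_conj[OF L2 vh.likely_conj[OF L3 vh.likely_conj[OF L4 L5]]]]]
    from all show ?thesis
    proof (rule likely_mono, goal_cases)
      case 1
      show ?case using \<eta> by simp
    next
      case (2 w)
      let ?D = "vh.drift_sum {..<4::nat} a f N \<tau> w"
      have 0: "\<And>i. i \<le> N \<Longrightarrow> dx (kappa_form dz h k) (\<tau> i) x w = kap (\<tau> i) w" and 1: "\<bar>?D\<bar> < e/8"
        and 2: "\<bar>S (v 1) Au3 N \<tau> w - vh.ssum (\<lambda>t w. v 1 t w * u' 3 t w) N \<tau> w\<bar> < e/8"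
        and 3: "\<bar>S (u 2) Av4 N \<tau> w - vh.ssum (\<lambda>t w. u 2 t w * v' 4 t w) N \<tau> w\<bar> < e/8"
        and 4: "\<bar>S (v 2) Au4 N \<tau> w - vh.ssum (\<lambda>t w. v 2 t w * u' 4 t w) N \<tau> w\<bar> < e/8"
        and 5: "\<bar>S (u 1) Av3 N \<tau> w - vh.ssum (\<lambda>t w. u 1 t w * v' 3 t w) N \<tau> w\<bar> < e/8" using 2 by auto
      have "vh.ssum (\<lambda>t w. dx (kappa_form dz h k) t x w) N \<tau> w = vh.ssum kap N \<tau> w"
        unfolding vh.ssum_def by (rule sum.cong) (use 0 in auto)
      also have "\<dots> = vh.ssum (\<lambda>t w. u 1 t w * v' 3 t w) N \<tau> w - vh.ssum (\<lambda>t w. v 1 t w * u' 3 t w) N \<tau> w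
         + vh.ssum (\<lambda>t w. u 2 t w * v' 4 t w) N \<tau> w - vh.ssum (\<lambda>t w. v 2 t w * u' 4 t w) N \<tau> w"
        unfolding vh.ssum_def sum_subtractf[symmetric] sum.distrib[symmetric]
        by (rule sum.cong) (auto simp: kap_def field_simps)
      finally have k: "vh.ssum (\<lambda>t w. dx (kappa_form dz h k) t x w) N \<tau> w = \<dots>" .
      define Om where "Om t = u 2 t w * v 1 t w - u 1 t w * v 2 t w" for t
      \<comment> \<open>The increment of a product is exactly the sum of average times increment, in
        both orders. Each increment of a component is an increment of some \<open>A\<close> minus a
        drift, up to sign.\<close>
      have cell: "Om (\<tau> (Suc i)) - Om (\<tau> i) =
        mid (v 1) \<tau> i w * incr Au3 \<tau> i w
        - mid (u 2) \<tau> i w * incr Av4 \<tau> i w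
        + mid (v 2) \<tau> i w * incr Au4 \<tau> i w
        - mid (u 1) \<tau> i w * incr Av3 \<tau> i w
        + (\<Sum>j\<in>{..<4::nat}. mid (a j) \<tau> i w *
        (integral {0..\<tau> (Suc i)} (\<lambda>s. f j s w) - integral {0..\<tau> i} (\<lambda>s. f j s w)))" for i
        unfolding J av fv Om_def Au3_def Au4_def Av3_def Av4_def by (simp add: field_simps)
      have "Om T - Om 0 = (\<Sum>i<N. Om (\<tau> (Suc i)) - Om (\<tau> i))"
        using p sum_lessThan_telescope[of "\<lambda>i. Om (\<tau> i)" N] by (simp add: part_def)
      also have "\<dots> = S (v 1) Au3 N \<tau> w - S (u 2) Av4 N \<tau> w + S (v 2) Au4 N \<tau> w - S (u 1) Av3 N \<tau> w + ?D"
        unfolding cell S_def by (simp only: sum.distrib sum_subtractf)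
      finally have o: "Om T - Om 0 = \<dots>" .
      have oo: "omega_form dz h k t x w = Om t" for t by (simp add: omega_eq Om_def u_def v_def)
      have "\<bar>(vh.ssum (\<lambda>t w. dx (kappa_form dz h k) t x w) N \<tau> w) - - (Om T - Om 0)\<bar> < e/8 + e/8 + e/8 + e/8 + e/8"
        unfolding k o using 1 2 3 4 5 by linarith
      also have "\<dots> \<le> e" using e by simp
      finally show ?case
        unfolding oo .
    qed
  qed
  with \<delta>(1) show "\<exists>\<delta>>0. \<forall>N \<tau>. part 0 T \<delta> N \<tau> \<longrightarrow> likely P \<eta> (\<lambda>w. \<bar>vh.ssum (\<lambda>t w. dx (kappa_form dz h k) t x w) N \<tau> w -
     - (omega_form dz h k T x w - omega_form dz h k 0 x w)\<bar> < e)" by blast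
qed

text \<open>The limit is known from time 0; subtracting it at \<open>t0\<close> gives the general
  interval.\<close>

lemma conservation_law:
  assumes t: "0 \<le> t0" "t0 \<le> t1"
  shows "has_stratonovich_integral P W (\<lambda>t w. dx (kappa_form dz h k) t x w) t0 t1
    (\<lambda>w. - (omega_form dz h k t1 x w - omega_form dz h k t0 x w))"
  unfolding has_stratonovich_integral_def
proof
  have m: "(\<lambda>w. dz h s x w $ i) \<in> borel_measurable P" "(\<lambda>w. dz k s x w $ i) \<in> borel_measurable P" if "0 \<le> s" for s i
    using vh.F_measurable[OF that measurable_compose[OF vh.regular_processD(1)[OF vh.regular_fieldD(2)[OF vh.reg_dz] that] borel_measurable_nth]]
      vh.F_measurable[OF that measurable_compose[OF vh.regular_processD(1)[OF vh.regular_fieldD(2)[OF vk.reg_dz] that] borel_measurable_nth]] .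
  show "(\<lambda>w. - (omega_form dz h k t1 x w - omega_form dz h k t0 x w)) \<in> borel_measurable P"
    unfolding omega_eq by (intro borel_measurable_uminus borel_measurable_diff borel_measurable_times m) (use t in auto)
  show "tendsto_in_prob P (stratonovich_sum W (\<lambda>t w. dx (kappa_form dz h k) t x w))
     (\<lambda>w. - (omega_form dz h k t1 x w - omega_form dz h k t0 x w)) (mesh_filter t0 t1)"
    unfolding tendsto_in_prob_mesh vh.stratonovich_sum_real real_norm_def
    using vh.ssum_limit_increment[OF kappa_ssum_limit t, of _ _ x] by (simp add: algebra_simps)
qed

end

theorem theorem2p1:
  fixes P :: "'a measure" and F :: "real \<Rightarrow> 'a measure" and W :: "real \<Rightarrow> 'a \<Rightarrow> real"
    and \<sigma> :: nat
    and U :: "'a datum set"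
    and Z :: "'a datum \<Rightarrow> real \<Rightarrow> real \<Rightarrow> 'a \<Rightarrow> real^4"
    and \<phi> :: "'a datum"
    and dz :: "'a datum \<Rightarrow> real \<Rightarrow> real \<Rightarrow> 'a \<Rightarrow> real^4"
  assumes "stochastic_basis P F"
    and "brownian_motion P F W"
    and "0 < \<sigma>" and "\<sigma> \<le> 2"
    and "solution_flow P F W \<sigma> U Z"
    and "\<phi> \<in> U"
    and "is_exterior_differential P F U Z \<phi> dz"
  shows "\<forall>h\<in>variations U \<phi>. \<forall>k\<in>variations U \<phi>. \<forall>t0 t1 x. 0 \<le> t0 \<longrightarrow> t0 \<le> t1 \<longrightarrow>
    stratonovich_integrable P W (\<lambda>t \<omega>. dx (kappa_form dz h k) t x \<omega>) t0 t1 \<and>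
    (AE \<omega> in P. omega_form dz h k t1 x \<omega> - omega_form dz h k t0 x \<omega>
       = - stratonovich_integral P W (\<lambda>t \<omega>. dx (kappa_form dz h k) t x \<omega>) t0 t1 \<omega>)"
proof (intro ballI allI impI)
  fix h k and t0 t1 x :: real assume h: "h \<in> variations U \<phi>" and k: "k \<in> variations U \<phi>" and t: "0 \<le> t0" "t0 \<le> t1"
  interpret prob_space P using assms(1) by (simp add: stochastic_basis_def)
  interpret brownian P F W by unfold_locales (rule assms)+
  interpret variation_pair P F W \<sigma> U Z \<phi> dz h k by unfold_locales (rule assms h k)+
  let ?K = "\<lambda>t w. dx (kappa_form dz h k) t x w"
  note I = conservation_law[OF t, of x]
  have int: "stratonovich_integrable P W ?K t0 t1"
    unfolding stratonovich_integrable_def using I by blast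
  then have "has_stratonovich_integral P W ?K t0 t1 (stratonovich_integral P W ?K t0 t1)"
    unfolding stratonovich_integrable_def stratonovich_integral_def by (rule someI_ex)
  from has_stratonovich_integral_unique[OF t(2) I this] int
  show "stratonovich_integrable P W ?K t0 t1 \<and>
    (AE w in P. omega_form dz h k t1 x w - omega_form dz h k t0 x w = - stratonovich_integral P W ?K t0 t1 w)"
    by auto
qed

end
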